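(* For every integer $\ell\ge0$, applying the single-valued projection $\mathrm{sv}$ coefficientwise (with $\mathrm{sv}$ extended linearly to Laurent polynomials in a variable $X$) to the Laurent polynomial $b_\ell(X)$ gives $$\mathrm{sv}\big(b_\ell(X)\big)=d_\ell(X).$$
   Context: Theta functions: for $\tau$ in the upper half-plane, $q=e^{2\pi i\tau}$, $\eta(\tau)=q^{1/24}\prod_{n\ge1}(1-q^n)$, $\theta_1(z,\tau)=2q^{1/8}\sin(\pi z)\prod_{n\ge1}(1-q^n)(1-q^ne^{2\pi i z})(1-q^ne^{-2\pi i z})$, $\Lambda_\tau=\mathbb{Z}\tau+\mathbb{Z}$. Closed string side: $G(z,\tau)=-\log\left|\theta_1(z,\tau)/\eta(\tau)\right|^2+2\pi\,\mathrm{Im}(z)^2/\mathrm{Im}(\tau)$ and $$D_\ell(\tau)=\iint_{\mathbb{C}/\Lambda_\tau}G(z,\tau)^\ell\,\frac{i\,dz\,d\overline z}{2\,\mathrm{Im}(\tau)}.$$ With $Y=2\pi\,\mathrm{Im}(\tau)\to+\infty$, it is known that $D_\ell(\tau)=d_\ell(Y)$ up to exponentially small terms (up to $O(e^{-cY})$ for some $c>0$) for a unique Laurent polynomial $d_\ell$. Open string side: for $\tau\in i\mathbb{R}_{>0}$ let $$P_B(z,\tau)=-\log\left|\frac{\theta_1(z,\tau)}{\eta(\tau)}\right|-\frac{i\pi}{\tau}\Big(z^2+\frac16\Big),\qquad B_\ell(\tau)=\int_{\mathbb{R}\tau/\mathbb{Z}\tau}P_B(z,\tau)^\ell\,\frac{dz}{\tau}$$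 (for $z\in\mathbb{R}\tau$ one has $P_B(z+\tau,\tau)=P_B(z,\tau)$; the normalization is such that $B_1(\tau)=0$). With $T=\pi\tau/i\to+\infty$, it is known that $B_\ell(\tau)=b_\ell(T)+O(e^{-T})$ for a unique Laurent polynomial $b_\ell$, with coefficients in the $\mathbb{Q}$-algebra $\mathcal{Z}$ of multiple zeta values; in fact the coefficients of $b_\ell$ are rational linear combinations of products of single zeta values $\zeta(k)$, $k\ge2$. Single-valued projection: assuming the standard conjectures on the structure of $\mathcal{Z}$ (under which it is well defined), $\mathrm{sv}:\mathcal{Z}\to\mathcal{Z}$ denotes Brown's single-valued projection. It is a $\mathbb{Q}$-algebra homomorphism, and on single zeta values it is given, for all $k\ge1$, by $\mathrm{sv}(\zeta(2k))=0$ and $\mathrm{sv}(\zeta(2k+1))=2\zeta(2k+1)$. *)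

theory Defs
  imports
    "HOL-Complex_Analysis.Contour_Integration"
    "HOL-Library.Landau_Symbols"
    "HOL-Library.Poly_Mapping"
begin

definition nome :: "complex \<Rightarrow> complex" where
  "nome \<tau> = exp (2 * of_real pi * \<i> * \<tau>)"

(* The fractional powers of q are q^r = exp (2 pi i r tau). *)
definition dedekind_eta :: "complex \<Rightarrow> complex" where
  "dedekind_eta \<tau> =
     exp (2 * of_real pi * \<i> * \<tau> / 24) * prodinf (\<lambda>n. 1 - nome \<tau> ^ Suc n)"

definition theta1 :: "complex \<Rightarrow> complex \<Rightarrow> complex" where
  "theta1 z \<tau> =
     2 * exp (2 * of_real pi * \<i> * \<tau> / 8) * sin (of_real pi * z) *
     prodinf (\<lambda>n. (1 - nome \<tau> ^ Suc n)
                   * (1 - nome \<tau> ^ Suc n * exp (2 * of_real pi * \<i> * z))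
                   * (1 - nome \<tau> ^ Suc n * exp (- (2 * of_real pi * \<i> * z))))"

(* A real Laurent polynomial is a finitely supported map from exponents to coefficients. *)
type_synonym laurent_poly = "int \<Rightarrow>\<^sub>0 real"

definition laurent_eval :: "laurent_poly \<Rightarrow> real \<Rightarrow> real" where
  "laurent_eval p x = (\<Sum>k\<in>Poly_Mapping.keys p. Poly_Mapping.lookup p k * x powi k)"

definition closed_propagator :: "complex \<Rightarrow> complex \<Rightarrow> real" where
  "closed_propagator z \<tau> =
     - ln ((cmod (theta1 z \<tau> / dedekind_eta \<tau>))\<^sup>2) + 2 * pi * (Im z)\<^sup>2 / Im \<tau>"

(* The integrand is invariant under the lattice, so the integral over the torus is the one
   over this fundamental domain. *)
definition fundamental_parallelogram :: "complex \<Rightarrow> complex set" where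
  "fundamental_parallelogram \<tau> =
     {of_real u + of_real v * \<tau> | u v. 0 \<le> u \<and> u < 1 \<and> 0 \<le> v \<and> v < 1}"

(* i dz d(conj z) / 2 is the Lebesgue measure dx dy. *)
definition closed_D :: "nat \<Rightarrow> complex \<Rightarrow> real" where
  "closed_D l \<tau> =
     (LINT z:fundamental_parallelogram \<tau>|lborel. closed_propagator z \<tau> ^ l) / Im \<tau>"

definition closed_laurent :: "nat \<Rightarrow> laurent_poly" where
  "closed_laurent l = (THE d. \<exists>c>0.
     (\<lambda>\<tau>. closed_D l \<tau> - laurent_eval d (2 * pi * Im \<tau>))
       \<in> O[filtercomap Im at_top](\<lambda>\<tau>. exp (- c * (2 * pi * Im \<tau>))))"

definition open_propagator :: "complex \<Rightarrow> complex \<Rightarrow> complex" where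
  "open_propagator z \<tau> =
     - of_real (ln (cmod (theta1 z \<tau> / dedekind_eta \<tau>)))
     - \<i> * of_real pi / \<tau> * (z\<^sup>2 + 1 / 6)"

(* The segment from 0 to \<tau> is one period of the integrand. *)
definition open_B :: "nat \<Rightarrow> complex \<Rightarrow> complex" where
  "open_B l \<tau> = contour_integral (linepath 0 \<tau>) (\<lambda>z. open_propagator z \<tau> ^ l / \<tau>)"

(* \<tau> = i T / pi is the point of the positive imaginary axis with T = pi \<tau> / i. *)
definition open_laurent :: "nat \<Rightarrow> laurent_poly" where
  "open_laurent l = (THE b.
     (\<lambda>T. cmod (open_B l (\<i> * of_real (T / pi)) - of_real (laurent_eval b T)))
       \<in> O[at_top](\<lambda>T. exp (- T)))"

definition mzv :: "nat list \<Rightarrow> real" where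
  "mzv ks =
     (\<Sum>\<^sub>\<infinity> ns \<in> {ns. length ns = length ks \<and> sorted_wrt (<) ns \<and> (\<forall>n\<in>set ns. 0 < n)}.
        \<Prod>i<length ks. 1 / real (ns ! i) ^ (ks ! i))"

definition admissible :: "nat list \<Rightarrow> bool" where
  "admissible ks \<longleftrightarrow> (\<forall>k\<in>set ks. 1 \<le> k) \<and> (ks \<noteq> [] \<longrightarrow> 2 \<le> last ks)"

inductive_set mzv_algebra :: "real set" where
  mzv: "admissible ks \<Longrightarrow> mzv ks \<in> mzv_algebra"
| rat: "of_rat r \<in> mzv_algebra"
| add: "x \<in> mzv_algebra \<Longrightarrow> y \<in> mzv_algebra \<Longrightarrow> x + y \<in> mzv_algebra"
| mult: "x \<in> mzv_algebra \<Longrightarrow> y \<in> mzv_algebra \<Longrightarrow> x * y \<in> mzv_algebra"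

(* Brown's projection is a well-defined map on real multiple zeta values only under the standard
   conjectures on their algebra, so it enters as a parameter: an endomorphism of the Q-algebra
   of multiple zeta values with the values of Brown's projection on single zeta values
   (mzv [k] is the sum of 1 / n ^ k over n > 0). Only the restriction of sv to mzv_algebra
   is constrained. *)
definition single_valued_projection :: "(real \<Rightarrow> real) \<Rightarrow> bool" where
  "single_valued_projection sv \<longleftrightarrow>
     (\<forall>x\<in>mzv_algebra. sv x \<in> mzv_algebra) \<and>
     sv 1 = 1 \<and>
     (\<forall>x\<in>mzv_algebra. \<forall>y\<in>mzv_algebra. sv (x + y) = sv x + sv y) \<and>
     (\<forall>x\<in>mzv_algebra. \<forall>y\<in>mzv_algebra. sv (x * y) = sv x * sv y) \<and>
     (\<forall>r. \<forall>x\<in>mzv_algebra. sv (of_rat r * x) = of_rat r * sv x) \<and>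
     (\<forall>k\<ge>1. sv (mzv [2 * k]) = 0) \<and>
     (\<forall>k\<ge>1. sv (mzv [2 * k + 1]) = 2 * mzv [2 * k + 1])"

end

theory Submission
  imports Defs "HOL-Complex_Analysis.Complex_Analysis"
begin

text \<open>
Why the theorem is true. Write \<open>v = Im z / Im \<tau>\<close> and let \<open>K\<close> be \<open>2 T\<close> in the open case and \<open>Y\<close> in
the closed case, so that \<open>\<bar>q\<bar> = exp (- K)\<close>. By the product formula for \<open>\<theta>\<^sub>1\<close>, both propagators have the form
\<open>p v + f (K v) y + f (K (1 - v)) (c - y) + O (exp (- K))\<close> on the strip \<open>0 < v < 1\<close>,
where \<open>p v = c\<^sub>0 + \<rho> K (v\<^sup>2 - v)\<close> and \<open>f\<close> decays exponentially. In the open case \<open>\<rho> = 1/2\<close>,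
\<open>c\<^sub>0 = T/6 - \<zeta>(2)/T\<close> and \<open>f x = - ln (1 - exp (- x))\<close>; in the closed case \<open>\<rho> = 1\<close>, \<open>c\<^sub>0 = Y/6\<close>
and \<open>f x y = - ln \<bar>1 - w\<bar>\<^sup>2\<close> with \<open>w = exp (- x + 2 \<pi> i y)\<close>.

Up to logarithmic singularities, the product of the two end terms is \<open>O (exp (- K))\<close>, so in the integral of the \<open>l\<close>-th power the ends do not
interact, and each of them may be integrated to infinity (\<open>two_ended_asymptotics\<close>). With \<open>x = K v\<close> one has
\<open>p = c\<^sub>0 + \<rho> x\<^sup>2 / K - \<rho> x\<close>. Joining the linear term to \<open>f\<close> and expanding in the rest gives a Laurent
polynomial in \<open>K\<close> whose transcendental coefficients are the moments
\<open>\<integral> x\<^bsup>2 m\<^esup> ((f - \<rho> x)\<^bsup>n\<^esup> - (- \<rho> x)\<^bsup>n\<^esup>)\<close>.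
Only even powers of \<open>x\<close> occur, and this is essential: the moments with odd powers are not related by \<open>sv\<close>.
Since \<open>sv (\<zeta>(2)) = 0\<close> accounts for the difference between the two constants \<open>c\<^sub>0\<close>, it remains to show that \<open>sv\<close>
maps an open moment to \<open>2 \<cdot> 4\<^bsup>m\<^esup>\<close> times the closed moment with the same \<open>m\<close> and \<open>n\<close> (\<open>sv_maps_moment\<close>).

For this, compare generating functions in \<open>t\<close>, with a second parameter \<open>e\<close> that records \<open>m\<close>. Put
\<open>a = t (1/2 + e)\<close>, \<open>b = t (1/2 - e)\<close> and \<open>E(t) = \<Gamma>(1 + a) \<Gamma>(1 + b) \<Gamma>(1 - t)\<close>; taking even powers of \<open>x\<close> means
adding the values at \<open>e\<close> and \<open>- e\<close>, that is, exchanging \<open>a\<close> and \<open>b\<close>. On the open side one adds two beta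
integrals, and the reflection formula turns the sum into
\<open>(E(t) (sin (\<pi> a) + sin (\<pi> b)) / \<pi> - t) / (a b)\<close>. On the closed side one adds, up to normalization and the terms with \<open>f = 0\<close>, the integrals of
\<open>\<bar>w\<bar>\<^bsup>2 b - 2\<^esup> \<bar>1 - w\<bar>\<^bsup>- 2 t\<^esup>\<close> and of \<open>\<bar>w\<bar>\<^bsup>2 a - 2\<^esup> \<bar>1 - w\<bar>\<^bsup>- 2 t\<^esup>\<close> over the unit disc; \<open>w \<mapsto> 1/w\<close>
carries the second to the exterior of the disc, so the sum is the complex beta integral, a product
of two real beta integrals (\<open>klt_mellin_sum\<close>), and the result is
\<open>t (E(t) / E(- t) - 1) / (2 a b)\<close>.

Finally \<open>ln E(t)\<close> is the sum over \<open>k \<ge> 2\<close> of \<open>\<zeta>(k)/k \<cdot> (t\<^bsup>k\<^esup> + (- a)\<^bsup>k\<^esup> + (- b)\<^bsup>k\<^esup>)\<close>. Doubling the odd zeta values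
and dropping the even ones changes \<open>E(t)\<close> into \<open>E(t) / E(- t)\<close>, and dropping the powers of \<open>\<pi>\<^sup>2\<close> changes the
sine factor into \<open>a + b = t\<close>. Hence \<open>sv\<close> maps the open generating function to twice the closed one. The
factor \<open>4\<^bsup>m\<^esup>\<close> comes from the different scales: \<open>x\<close> stands for \<open>2 T v\<close> on the open side and for \<open>Y v\<close> on the closed side.
\<close>

section \<open>Elementary estimates and integrals on the half-line\<close>

text \<open>This is \<open>Li\<^sub>1 (exp (- x))\<close>: the open kernel itself, and half of the bound for the closed one.\<close>

definition edge_log :: "real \<Rightarrow> real" where
  "edge_log x = - ln (1 - exp (- x))"

lemma edge_log_nonneg: "x > 0 \<Longrightarrow> 0 \<le> edge_log x"
  by (simp add: edge_log_def)

text \<open>A form of exponential decay that survives the logarithmic singularity at \<open>0\<close>: it is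
\<open>- ln (1 - u) \<le> u / (1 - u)\<close> with the denominator cleared. Both the decoupling of the two ends and
the convergence of the moments rest on it.\<close>

lemma edge_log_le_exp:
  assumes "x > 0"
  shows "edge_log x \<le> exp (- x) * (1 + edge_log x)"
proof -
  define u where "u = exp (- x)"
  have u: "0 < u" "u < 1" using assms by (auto simp: u_def)
  have "ln (1 / (1 - u)) \<le> 1 / (1 - u) - 1"
    using u by (intro ln_le_minus_one) auto
  hence "edge_log x \<le> u / (1 - u)"
    using u by (simp add: edge_log_def ln_div u_def[symmetric] field_simps)
  hence "edge_log x * (1 - u) \<le> u" using u by (simp add: field_simps)
  thus ?thesis by (simp add: u_def algebra_simps)
qed

lemma edge_log_antimono: "0 < x \<Longrightarrow> x \<le> y \<Longrightarrow> edge_log y \<le> edge_log x"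
  by (simp add: edge_log_def)

lemma edge_log_borel [measurable]: "edge_log \<in> borel_measurable borel"
  unfolding edge_log_def by measurable

lemma exp_mult_edge_log: "x > 0 \<Longrightarrow> exp (t * edge_log x) = (1 - exp (- x)) powr (- t)"
  by (simp add: edge_log_def powr_def)

text \<open>The substitution \<open>u = exp (- c x)\<close>, which turns the integrals over the half-line into Mellin transforms over the
unit interval.\<close>

lemma exp_substitution:
  fixes g :: "real \<Rightarrow> real"
  assumes [measurable]: "g \<in> borel_measurable borel" and c: "c > 0"
  shows "set_integrable lborel {0<..} (\<lambda>x. c * exp (- (c * x)) * g (exp (- (c * x)))) \<longleftrightarrow>
           set_integrable lborel {0<..<1} g"
    and "set_integrable lborel {0<..<1} g \<Longrightarrow>
           (LINT x:{0<..}|lborel. c * exp (- (c * x)) * g (exp (- (c * x)))) = (LINT u:{0<..<1}|lborel. g u)"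
proof -
  let ?k = "\<lambda>x::real. exp (- (c * x))"
  have img: "?k ` {0<..} = {0<..<1}"
  proof (intro set_eqI iffI)
    fix u :: real assume u: "u \<in> {0<..<1}"
    have "u = ?k (- ln u / c)" "- ln u / c > 0" using u c by (auto simp: field_simps)
    thus "u \<in> ?k ` {0<..}" by blast
  qed (use c in auto)
  have der: "(?k has_field_derivative - (c * ?k x)) (at x within {0<..})" for x
    by (auto intro!: derivative_eq_intros)
  have S: "{0<..} \<in> sets (lebesgue :: real measure)" by simp
  have inj: "inj_on ?k {0<..}" using c by (auto simp: inj_on_def)
  have abs: "\<bar>- (c * ?k x)\<bar> = c * ?k x" for x using c by (simp add: abs_mult)
  have lb: "set_integrable lebesgue A k \<longleftrightarrow> set_integrable lborel A k"
    if "A \<in> sets borel" "k \<in> borel_measurable borel" for A and k :: "real \<Rightarrow> real"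
    unfolding set_integrable_def by (rule integrable_completion) (use that in measurable)
  note cv = has_absolute_integral_change_of_variables_1'[OF S der inj, where f = g, unfolded img abs]
  have meas: "(\<lambda>x. c * ?k x * g (?k x)) \<in> borel_measurable borel" by measurable
  have cv1: "(\<lambda>x. c * ?k x * g (?k x)) absolutely_integrable_on {0<..} \<longleftrightarrow> g absolutely_integrable_on {0<..<1}"
    using cv by blast
  show *: "set_integrable lborel {0<..} (\<lambda>x. c * ?k x * g (?k x)) \<longleftrightarrow> set_integrable lborel {0<..<1} g"
    using cv1 lb[OF _ meas] lb[OF _ assms(1)] by simp
  assume g: "set_integrable lborel {0<..<1} g"
  hence "integral {0<..} (\<lambda>x. c * ?k x * g (?k x)) = integral {0<..<1} g"
    using cv[of "integral {0<..<1} g"] lb[OF _ assms(1)] by simp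
  thus "(LINT x:{0<..}|lborel. c * ?k x * g (?k x)) = (LINT u:{0<..<1}|lborel. g u)"
    using set_borel_integral_eq_integral(2)[OF g] set_borel_integral_eq_integral(2)[OF *[THEN iffD2, OF g]] by simp
qed

lemma beta_integral_open:
  assumes "a > 0" "b > (0::real)"
  shows "set_integrable lborel {0<..<1} (\<lambda>u. u powr (a - 1) * (1 - u) powr (b - 1))"
    and "(LINT u:{0<..<1}|lborel. u powr (a - 1) * (1 - u) powr (b - 1)) = Beta a b"
proof -
  let ?g = "\<lambda>u::real. u powr (a - 1) * (1 - u) powr (b - 1)"
  show int: "set_integrable lborel {0<..<1} ?g"
    by (rule set_integrable_subset[OF integrable_Beta[OF assms]]) auto
  have "(LINT u:{0<..<1}|lborel. ?g u) = integral {0<..<1} ?g"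
    by (rule set_borel_integral_eq_integral(2)[OF int])
  also have "\<dots> = integral {0..1} ?g"
    by (rule integral_open_interval_real[symmetric])
  also have "\<dots> = Beta a b" using has_integral_Beta_real[OF assms] by (rule integral_unique)
  finally show "(LINT u:{0<..<1}|lborel. ?g u) = Beta a b" .
qed

lemma exp_beta_integral:
  assumes "a > 0" "t < (1::real)"
  shows "set_integrable lborel {0<..} (\<lambda>x. exp (- (a * x)) * exp (t * edge_log x))"
    and "(LINT x:{0<..}|lborel. exp (- (a * x)) * exp (t * edge_log x)) = Beta a (1 - t)"
proof -
  let ?g = "\<lambda>u::real. u powr (a - 1) * (1 - u) powr ((1 - t) - 1)"
  have eq: "1 * exp (- (1 * x)) * ?g (exp (- (1 * x))) = exp (- (a * x)) * exp (t * edge_log x)"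
    if "x \<in> {0<..}" for x
  proof -
    have "exp (- x) * exp (- x) powr (a - 1) = exp (- (a * x))"
      by (simp add: powr_def flip: exp_add) (simp add: algebra_simps)
    thus ?thesis using that by (simp add: exp_mult_edge_log mult.assoc[symmetric])
  qed
  have b: "set_integrable lborel {0<..<1} ?g" "(LINT u:{0<..<1}|lborel. ?g u) = Beta a (1 - t)"
    using beta_integral_open[of a "1 - t"] assms by auto
  have "set_integrable lborel {0<..} (\<lambda>x. 1 * exp (- (1 * x)) * ?g (exp (- (1 * x))))"
    by (subst exp_substitution) (use b in auto)
  also have "?this \<longleftrightarrow> set_integrable lborel {0<..} (\<lambda>x. exp (- (a * x)) * exp (t * edge_log x))"
    by (rule set_integrable_cong) (use eq in auto)
  finally show "set_integrable lborel {0<..} (\<lambda>x. exp (- (a * x)) * exp (t * edge_log x))" .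
  have "(LINT x:{0<..}|lborel. exp (- (a * x)) * exp (t * edge_log x)) =
        (LINT x:{0<..}|lborel. 1 * exp (- (1 * x)) * ?g (exp (- (1 * x))))"
    by (rule set_lebesgue_integral_cong) (use eq in auto)
  also have "\<dots> = Beta a (1 - t)"
    by (subst exp_substitution(2)) (use b in auto)
  finally show "(LINT x:{0<..}|lborel. exp (- (a * x)) * exp (t * edge_log x)) = Beta a (1 - t)" .
qed

lemma power_le_exp:
  fixes \<delta> :: real
  assumes "\<delta> > 0"
  obtains C where "C \<ge> 0" "\<And>y. y \<ge> 0 \<Longrightarrow> (1 + y) ^ n \<le> C * exp (\<delta> * y)"
proof -
  define k where "k = real (Suc n)"
  have k: "k \<ge> 1" by (simp add: k_def)
  have "(1 + y) ^ n \<le> (1 + k / \<delta>) ^ n * exp (\<delta> * y)" if "y \<ge> 0" for y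
  proof -
    have "1 + y \<le> (1 + k / \<delta>) * (1 + \<delta> * y / k)"
      using assms k that by (simp add: field_simps)
    also have "\<dots> \<le> (1 + k / \<delta>) * exp (\<delta> * y / k)"
      using assms k by (intro mult_left_mono) auto
    finally have "(1 + y) ^ n \<le> ((1 + k / \<delta>) * exp (\<delta> * y / k)) ^ n"
      using that by (intro power_mono) auto
    also have "\<dots> = (1 + k / \<delta>) ^ n * exp (real n * (\<delta> * y / k))"
      by (simp only: power_mult_distrib exp_of_nat_mult)
    also have "\<dots> \<le> (1 + k / \<delta>) ^ n * exp (\<delta> * y)"
    proof -
      have "real n * (\<delta> * y / k) \<le> k * (\<delta> * y / k)"
        using assms that k by (intro mult_right_mono) (auto simp: k_def)
      thus ?thesis using assms k by (intro mult_left_mono) auto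
    qed
    finally show ?thesis .
  qed
  moreover have "(1 + k / \<delta>) ^ n \<ge> 0" using k assms by auto
  ultimately show thesis using that by blast
qed

lemma abs_power_diff_le:
  fixes s r :: real
  assumes "\<bar>s\<bar> + \<bar>r\<bar> \<le> D" "D \<ge> 1"
  shows "\<bar>(s + r) ^ n - s ^ n\<bar> \<le> real n * \<bar>r\<bar> * D ^ n"
proof (induction n)
  case (Suc n)
  have "(s + r) ^ Suc n - s ^ Suc n = (s + r) * ((s + r) ^ n - s ^ n) + r * s ^ n"
    by (simp add: algebra_simps)
  hence "\<bar>(s + r) ^ Suc n - s ^ Suc n\<bar> \<le> \<bar>s + r\<bar> * \<bar>(s + r) ^ n - s ^ n\<bar> + \<bar>r\<bar> * \<bar>s\<bar> ^ n"
    by (metis abs_mult abs_triangle_ineq power_abs)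
  also have "\<dots> \<le> D * (real n * \<bar>r\<bar> * D ^ n) + \<bar>r\<bar> * D ^ Suc n"
  proof (intro add_mono mult_mono Suc.IH)
    have "\<bar>s\<bar> ^ n \<le> D ^ n" using assms by (intro power_mono) auto
    also have "\<dots> \<le> D ^ Suc n" using assms(2) by (intro power_increasing) auto
    finally show "\<bar>s\<bar> ^ n \<le> D ^ Suc n" .
  qed (use assms in auto)
  also have "\<dots> = real (Suc n) * \<bar>r\<bar> * D ^ Suc n" by (simp add: algebra_simps)
  finally show ?case .
qed auto

text \<open>The mixed second difference of the \<open>n\<close>-th power is divisible by \<open>a b\<close>; this is what makes the two ends of the
strip independent up to the size of the product of the end terms.\<close>

lemma abs_power_cross_le:
  fixes p a b :: real
  assumes "\<bar>p\<bar> + \<bar>a\<bar> + \<bar>b\<bar> \<le> D" "D \<ge> 1"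
  shows "\<bar>(p + a + b) ^ n - (p + a) ^ n - (p + b) ^ n + p ^ n\<bar> \<le> (real n)\<^sup>2 * (\<bar>a\<bar> * \<bar>b\<bar>) * D ^ n"
proof (induction n)
  case (Suc n)
  define c where "c = (p + a + b) ^ n - (p + a) ^ n - (p + b) ^ n + p ^ n"
  have "(p + a + b) ^ Suc n - (p + a) ^ Suc n - (p + b) ^ Suc n + p ^ Suc n
      = (p + a + b) * c + b * ((p + a) ^ n - p ^ n) + a * ((p + b) ^ n - p ^ n)"
    by (simp add: c_def algebra_simps)
  hence "\<bar>(p + a + b) ^ Suc n - (p + a) ^ Suc n - (p + b) ^ Suc n + p ^ Suc n\<bar>
      \<le> \<bar>p + a + b\<bar> * \<bar>c\<bar> + \<bar>b\<bar> * \<bar>(p + a) ^ n - p ^ n\<bar> + \<bar>a\<bar> * \<bar>(p + b) ^ n - p ^ n\<bar>"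
    by (simp only: abs_mult[symmetric])
  also have "\<dots> \<le> D * ((real n)\<^sup>2 * (\<bar>a\<bar> * \<bar>b\<bar>) * D ^ n) + \<bar>b\<bar> * (real n * \<bar>a\<bar> * D ^ n) + \<bar>a\<bar> * (real n * \<bar>b\<bar> * D ^ n)"
    using assms Suc.IH
    by (intro add_mono mult_mono abs_power_diff_le) (auto simp: c_def)
  also have "\<dots> \<le> D * ((real n)\<^sup>2 * (\<bar>a\<bar> * \<bar>b\<bar>) * D ^ n) + \<bar>b\<bar> * (real n * \<bar>a\<bar> * D ^ Suc n) + \<bar>a\<bar> * (real n * \<bar>b\<bar> * D ^ Suc n)"
    using assms by (intro add_mono mult_left_mono power_increasing) auto
  also have "\<dots> = ((real n)\<^sup>2 + 2 * real n) * (\<bar>a\<bar> * \<bar>b\<bar>) * D ^ Suc n" by (simp add: algebra_simps)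
  also have "\<dots> \<le> (real (Suc n))\<^sup>2 * (\<bar>a\<bar> * \<bar>b\<bar>) * D ^ Suc n"
    using assms by (intro mult_right_mono) (auto simp: power2_eq_square algebra_simps)
  finally show ?case .
qed auto

lemma set_integrable_bound:
  fixes g w :: "'a::euclidean_space \<Rightarrow> real"
  assumes w: "set_integrable lborel A w" and "A \<in> sets borel" "g \<in> borel_measurable borel"
    and le: "\<And>p. p \<in> A \<Longrightarrow> \<bar>g p\<bar> \<le> w p"
  shows "set_integrable lborel A g" "\<bar>LINT p:A|lborel. g p\<bar> \<le> (LINT p:A|lborel. w p)"
proof -
  have [measurable]: "A \<in> sets borel" "g \<in> borel_measurable borel" by fact+
  show g: "set_integrable lborel A g"
    unfolding set_integrable_def
  proof (rule Bochner_Integration.integrable_bound[OF w[unfolded set_integrable_def]])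
    show "AE p in lborel. norm (indicat_real A p *\<^sub>R g p) \<le> norm (indicat_real A p *\<^sub>R w p)"
    proof (rule AE_I2)
      fix p show "norm (indicat_real A p *\<^sub>R g p) \<le> norm (indicat_real A p *\<^sub>R w p)"
        using le[of p] by (cases "p \<in> A") auto
    qed
  qed measurable
  have "\<bar>LINT p:A|lborel. g p\<bar> \<le> (LINT p:A|lborel. \<bar>g p\<bar>)"
    using set_integral_norm_bound[OF g] by simp
  also have "\<dots> \<le> (LINT p:A|lborel. w p)"
    using le g w by (intro set_integral_mono set_integrable_abs) auto
  finally show "\<bar>LINT p:A|lborel. g p\<bar> \<le> (LINT p:A|lborel. w p)" .
qed

text \<open>Used for the rescaling \<open>x = K v\<close> and for the change from \<open>Im z\<close> to \<open>v\<close>.\<close>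

lemma lborel_affine_plane:
  fixes g :: "real \<times> real \<Rightarrow> real"
  assumes [measurable]: "g \<in> borel_measurable borel" and c: "c1 \<noteq> 0" "c2 \<noteq> 0"
  shows "integrable lborel (\<lambda>p. g (t1 + c1 * fst p, t2 + c2 * snd p)) \<longleftrightarrow> integrable lborel g"
    and "(LINT p|lborel. g p) = \<bar>c1 * c2\<bar> * (LINT p|lborel. g (t1 + c1 * fst p, t2 + c2 * snd p))"
proof -
  let ?T = "\<lambda>p::real\<times>real. (t1 + c1 * fst p, t2 + c2 * snd p)"
  let ?c = "\<lambda>j::real\<times>real. if j = (1, 0) then c1 else c2"
  have B: "(Basis :: (real \<times> real) set) = {(1, 0), (0, 1)}"
    by (auto simp: Basis_prod_def)
  have T: "(t1, t2) + (\<Sum>j\<in>Basis. (?c j * (p \<bullet> j)) *\<^sub>R j) = ?T p" for p :: "real \<times> real"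
    by (cases p) (simp add: B)
  have ne: "?c j \<noteq> 0" if "j \<in> Basis" for j using c by auto
  have P: "(\<Prod>j\<in>(Basis::(real\<times>real) set). \<bar>?c j\<bar>) = \<bar>c1 * c2\<bar>"
    by (simp add: B abs_mult)
  have eq: "lborel = density (distr lborel borel ?T) (\<lambda>_. ennreal \<bar>c1 * c2\<bar>)"
    using lborel_affine_euclidean[of ?c "(t1, t2)", OF ne] unfolding T P .
  have [measurable]: "?T \<in> borel_measurable borel" 
    by (auto intro!: borel_measurable_continuous_onI continuous_intros)
  show "integrable lborel (\<lambda>p. g (?T p)) \<longleftrightarrow> integrable lborel g"
  proof -
    have "integrable lborel g \<longleftrightarrow> integrable (density (distr lborel borel ?T) (\<lambda>_. ennreal \<bar>c1 * c2\<bar>)) g"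
      using eq by simp
    also have "\<dots> \<longleftrightarrow> integrable (distr lborel borel ?T) (\<lambda>p. \<bar>c1 * c2\<bar> *\<^sub>R g p)"
      by (rule integrable_density) auto
    also have "\<dots> \<longleftrightarrow> integrable lborel (\<lambda>p. \<bar>c1 * c2\<bar> *\<^sub>R g (?T p))"
      by (rule integrable_distr_eq) auto
    finally show ?thesis using c by simp
  qed
  show "(LINT p|lborel. g p) = \<bar>c1 * c2\<bar> * (LINT p|lborel. g (?T p))"
  proof -
    have "(LINT p|lborel. g p) = (LINT p|density (distr lborel borel ?T) (\<lambda>_. ennreal \<bar>c1 * c2\<bar>). g p)"
      using eq by simp
    also have "\<dots> = (LINT p|distr lborel borel ?T. \<bar>c1 * c2\<bar> *\<^sub>R g p)"
      by (rule integral_density) auto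
    also have "\<dots> = (LINT p|lborel. \<bar>c1 * c2\<bar> *\<^sub>R g (?T p))"
      by (rule integral_distr) auto
    finally show ?thesis by simp
  qed
qed

lemma fubini_rectangle:
  fixes g :: "real \<times> real \<Rightarrow> real"
  assumes "set_integrable lborel (A \<times> B) g"
  shows "(LINT p:A \<times> B|lborel. g p) = (LINT x:A|lborel. (LINT y:B|lborel. g (x, y)))"
proof -
  have "integrable (lborel \<Otimes>\<^sub>M lborel) (\<lambda>p. indicator (A \<times> B) p *\<^sub>R g p)"
    using assms by (simp add: lborel_prod set_integrable_def)
  from lborel_pair.integral_fst'[OF this]
  have "(LINT p:A \<times> B|lborel. g p) = (LINT x|lborel. LINT y|lborel. indicator (A \<times> B) (x, y) *\<^sub>R g (x, y))"
    by (simp add: lborel_prod set_lebesgue_integral_def)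
  also have "\<dots> = (LINT x|lborel. indicator A x *\<^sub>R (LINT y|lborel. indicator B y *\<^sub>R g (x, y)))"
    by (intro Bochner_Integration.integral_cong refl) (auto simp: indicator_def)
  finally show ?thesis by (simp add: set_lebesgue_integral_def)
qed

section \<open>Integration over strips\<close>

lemma fst_borel [measurable]: "fst \<in> borel_measurable (borel :: (real \<times> real) measure)"
  by (intro borel_measurable_continuous_onI continuous_intros)

lemma snd_borel [measurable]: "snd \<in> borel_measurable (borel :: (real \<times> real) measure)"
  by (intro borel_measurable_continuous_onI continuous_intros)

lemma rect_borel [measurable]:
  "A \<in> sets borel \<Longrightarrow> B \<in> sets borel \<Longrightarrow> A \<times> B \<in> sets (borel :: (real \<times> real) measure)"
  by (metis borel_prod pair_measureI)

lemma set_integral_sum_fun: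
  fixes g :: "'i \<Rightarrow> 'a \<Rightarrow> real"
  assumes "\<And>i. i \<in> I \<Longrightarrow> set_integrable M A (g i)"
  shows "set_integrable M A (\<lambda>x. \<Sum>i\<in>I. g i x)"
    and "(LINT x:A|M. (\<Sum>i\<in>I. g i x)) = (\<Sum>i\<in>I. LINT x:A|M. g i x)"
  using assms unfolding set_integrable_def set_lebesgue_integral_def
  by (auto simp: sum_distrib_left intro!: Bochner_Integration.integral_sum)

text \<open>One integrable function that dominates all integrands below: with \<open>u = exp (- x)\<close> its integral is a beta
integral, and any polynomial in \<open>x\<close> and \<open>edge_log x\<close> times \<open>edge_log x\<close> is bounded by a multiple of it. The
exponent \<open>1/8\<close> is small enough to leave a decay better than \<open>exp (- K / 2)\<close> in the tail estimates.\<close>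

definition majorant :: "real \<Rightarrow> real" where "majorant x = exp ((edge_log x - x) / 8)"

lemma majorant_borel [measurable]: "majorant \<in> borel_measurable borel"
  unfolding majorant_def by measurable

lemma majorant_integrable: "set_integrable lborel {0<..} majorant"
proof -
  have "set_integrable lborel {0<..} (\<lambda>x. exp (- (1 / 8 * x)) * exp (1 / 8 * edge_log x))"
    by (rule exp_beta_integral) auto
  thus ?thesis by (simp add: majorant_def[abs_def] flip: exp_add) (simp add: diff_divide_distrib)
qed

text \<open>The first coordinate is \<open>x\<close> or \<open>v\<close>, the second is the angle \<open>y\<close>, measured in full turns. The open kernel does
not depend on the angle; it is given one in order to treat both cases together.\<close>

abbreviation half_cylinder :: "(real \<times> real) set" where "half_cylinder \<equiv> {0<..} \<times> {0..1}"
abbreviation unit_box :: "(real \<times> real) set" where "unit_box \<equiv> {0<..<1} \<times> {0..1}"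

lemma set_integral_unit_const: "(LINT y:{0..1::real}|lborel. c) = (c :: real)"
  by (simp add: set_lebesgue_integral_def)

lemma set_integrable_strip:
  fixes w :: "real \<Rightarrow> real"
  assumes "set_integrable lborel A w"  "A \<in> sets borel" "w \<in> borel_measurable borel"
  shows "set_integrable lborel (A \<times> {0..1::real}) (\<lambda>p. w (fst p))"
    and "(LINT p:A \<times> {0..1::real}|lborel. w (fst p)) = (LINT x:A|lborel. w x)"
proof -
  have [measurable]: "A \<in> sets borel" "w \<in> borel_measurable borel" by fact+
  let ?g = "\<lambda>p::real\<times>real. indicator (A \<times> {0..1}) p *\<^sub>R w (fst p)"
  have eq: "?g (x, y) = (indicator A x * w x) * indicator {0..1} y" for x y
    by (auto simp: indicator_def)
  have "integrable (lborel \<Otimes>\<^sub>M lborel) ?g"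
  proof (rule lborel_pair.Fubini_integrable)
    show "?g \<in> borel_measurable (lborel \<Otimes>\<^sub>M lborel)" by (simp add: lborel_prod)
    show "integrable lborel (\<lambda>x. LINT y|lborel. norm (?g (x, y)))"
      using integrable_norm[OF assms(1)[unfolded set_integrable_def]]
      unfolding eq by (simp add: abs_mult)
    show "AE x in lborel. integrable lborel (\<lambda>y. ?g (x, y))"
      unfolding eq by (intro AE_I2 integrable_mult_right) simp
  qed
  thus int: "set_integrable lborel (A \<times> {0..1::real}) (\<lambda>p. w (fst p))"
    by (simp add: set_integrable_def lborel_prod)
  show "(LINT p:A \<times> {0..1::real}|lborel. w (fst p)) = (LINT x:A|lborel. w x)"
    by (subst fubini_rectangle[OF int]) (simp add: set_integral_unit_const)
qed

text \<open>The factor \<open>edge_log x\<close> supplies the decay \<open>exp (- x)\<close>, and the polynomial costs only a small exponential.\<close>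

lemma edge_log_mult_power_le:
  obtains C where "C \<ge> 0"
    "\<And>x. x > 0 \<Longrightarrow> edge_log x * (1 + (x + edge_log x)) ^ n \<le> C * exp (- x + (x + edge_log x) / 8)"
proof -
  have "(0::real) < 1 / 8" by simp
  from power_le_exp[OF this, of "Suc n"]
  obtain C where C: "C \<ge> 0" "\<And>y::real. y \<ge> 0 \<Longrightarrow> (1 + y) ^ Suc n \<le> C * exp (1 / 8 * y)"
    by blast
  have "edge_log x * (1 + (x + edge_log x)) ^ n \<le> C * exp (- x + (x + edge_log x) / 8)" if x: "x > 0" for x
  proof -
    have l: "edge_log x \<ge> 0" by (rule edge_log_nonneg[OF x])
    have "edge_log x \<le> exp (- x) * (1 + (x + edge_log x))"
      using edge_log_le_exp[OF x] x by (smt (verit) exp_gt_zero mult_left_mono)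
    hence "edge_log x * (1 + (x + edge_log x)) ^ n \<le> exp (- x) * (1 + (x + edge_log x)) * (1 + (x + edge_log x)) ^ n"
      using x l by (intro mult_right_mono) auto
    also have "\<dots> = exp (- x) * (1 + (x + edge_log x)) ^ Suc n" by simp
    also have "\<dots> \<le> exp (- x) * (C * exp (1 / 8 * (x + edge_log x)))"
      using x l by (intro mult_left_mono C) auto
    also have "\<dots> = C * exp (- x + (x + edge_log x) / 8)"
      by (simp add: exp_add[symmetric] algebra_simps)
    finally show ?thesis .
  qed
  thus thesis using that C(1) by blast
qed

lemma edge_log_mult_power_le_majorant:
  obtains C where "C \<ge> 0" "\<And>x. x > 0 \<Longrightarrow> edge_log x * (1 + (x + edge_log x)) ^ n \<le> C * majorant x"
proof -
  obtain C where C: "C \<ge> 0"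
    "\<And>x. x > 0 \<Longrightarrow> edge_log x * (1 + (x + edge_log x)) ^ n \<le> C * exp (- x + (x + edge_log x) / 8)"
    by (rule edge_log_mult_power_le[of n]) blast
  have "edge_log x * (1 + (x + edge_log x)) ^ n \<le> C * majorant x" if x: "x > 0" for x
    by (rule order_trans[OF C(2)[OF x]]) (use C(1) x in \<open>auto simp: majorant_def intro!: mult_left_mono\<close>)
  thus thesis using that C(1) by blast
qed

lemma scale_strip:
  fixes g :: "real \<times> real \<Rightarrow> real"
  assumes K: "K > 0" and [measurable]: "g \<in> borel_measurable borel"
  shows "set_integrable lborel unit_box (\<lambda>p. g (K * fst p, snd p)) \<longleftrightarrow> set_integrable lborel ({0<..<K} \<times> {0..1}) g"
    and "(LINT p:unit_box|lborel. g (K * fst p, snd p)) = (LINT p:{0<..<K} \<times> {0..1}|lborel. g p) / K"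
proof -
  let ?g = "\<lambda>p. indicator ({0<..<K} \<times> {0..1}) p *\<^sub>R g p"
  have eq: "?g (0 + K * fst p, 0 + 1 * snd p) = indicator unit_box p *\<^sub>R g (K * fst p, snd p)" for p
    using K by (cases p) (auto simp: indicator_def zero_less_mult_iff)
  have [measurable]: "?g \<in> borel_measurable borel" by measurable
  have "integrable lborel (\<lambda>p. ?g (0 + K * fst p, 0 + 1 * snd p)) \<longleftrightarrow> integrable lborel ?g"
    by (rule lborel_affine_plane) (use K in auto)
  thus "set_integrable lborel unit_box (\<lambda>p. g (K * fst p, snd p)) \<longleftrightarrow> set_integrable lborel ({0<..<K} \<times> {0..1}) g"
    unfolding eq set_integrable_def .
  have "(LINT p|lborel. ?g p) = \<bar>K * 1\<bar> * (LINT p|lborel. ?g (0 + K * fst p, 0 + 1 * snd p))"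
    by (rule lborel_affine_plane) (use K in auto)
  thus "(LINT p:unit_box|lborel. g (K * fst p, snd p)) = (LINT p:{0<..<K} \<times> {0..1}|lborel. g p) / K"
    using K unfolding eq set_lebesgue_integral_def by simp
qed

lemma periodic_of_int:
  fixes g :: "real \<Rightarrow> 'a"
  assumes "\<And>x. g (x + 1) = g x"
  shows "g (x + of_int n) = g x"
proof (induction n rule: int_induct[of _ 0])
  case (step1 i) thus ?case using assms[of "x + of_int i"] by (simp add: add.assoc)
next
  case (step2 i) thus ?case using assms[of "x + of_int (i - 1)"] by (simp add: add.assoc)
qed auto

text \<open>A period may start anywhere: integer shifts cost nothing, and after them the overhanging piece is moved back by one
period.\<close>

lemma periodic_integral_shift:
  fixes g :: "real \<Rightarrow> real"
  assumes [measurable]: "g \<in> borel_measurable borel" and B: "\<And>x. \<bar>g x\<bar> \<le> B"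
    and per: "\<And>x. g (x + 1) = g x"
  shows "(LINT x:{a..a + 1}|lborel. g x) = (LINT x:{0..1}|lborel. g x)"
proof -
  have int: "set_integrable lborel {c..d} g" for c d
    by (rule set_integrable_bound[where w = "\<lambda>_. B"]) (use B in \<open>auto intro!: borel_integrable_atLeastAtMost' continuous_intros\<close>)
  have shift: "(LINT x:{c + t..d + t}|lborel. g x) = (LINT x:{c..d}|lborel. g (x + t))" for c d t
    unfolding set_lebesgue_integral_def
    by (subst lborel_integral_real_affine[of 1 _ t]) (auto intro!: Bochner_Integration.integral_cong simp: indicator_def add.commute)
  note perint = periodic_of_int[of g, OF per]
  define r where "r = frac a"
  have r: "0 \<le> r" "r < 1" "a = r + of_int \<lfloor>a\<rfloor>" by (auto simp: r_def frac_def frac_lt_1) linarith+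
  have split: "(LINT x:{c..e}|lborel. g x) = (LINT x:{c..d}|lborel. g x) + (LINT x:{d..e}|lborel. g x)"
    if "c \<le> d" "d \<le> e" for c d e
  proof -
    have "{c..e} = {c..d} \<union> {d..e}" using that by auto
    moreover have "AE x in lborel. \<not> (x \<in> {c..d} \<and> x \<in> {d..e})"
      using AE_lborel_singleton[of d] by eventually_elim auto
    ultimately show ?thesis using set_integral_Un_AE[of "{c..d}" "{d..e}" lborel g] int by simp
  qed
  have "(LINT x:{a..a + 1}|lborel. g x) = (LINT x:{r..r + 1}|lborel. g x)"
    using shift[of r "of_int \<lfloor>a\<rfloor>" "r + 1"] r(3) by (simp add: perint algebra_simps)
  also have "\<dots> = (LINT x:{r..1}|lborel. g x) + (LINT x:{1..r + 1}|lborel. g x)"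
    by (rule split) (use r in auto)
  also have "(LINT x:{1..r + 1}|lborel. g x) = (LINT x:{0..r}|lborel. g x)"
    using shift[of 0 1 r] by (simp add: per)
  also have "(LINT x:{r..1}|lborel. g x) + (LINT x:{0..r}|lborel. g x) = (LINT x:{0..1}|lborel. g x)"
    using split[of 0 r 1] r by simp
  finally show ?thesis .
qed

lemma periodic_integral_reflect:
  fixes g :: "real \<Rightarrow> real"
  assumes [measurable]: "g \<in> borel_measurable borel" and B: "\<And>x. \<bar>g x\<bar> \<le> B"
    and per: "\<And>x. g (x + 1) = g x"
  shows "(LINT x:{0..1}|lborel. g (c - x)) = (LINT x:{0..1}|lborel. g x)"
proof -
  have "(LINT x:{c - 1..(c - 1) + 1}|lborel. g x) = (LINT x:{0..1}|lborel. g (c - x))"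
    unfolding set_lebesgue_integral_def
    by (subst lborel_integral_real_affine[of "-1" _ c]) (auto intro!: Bochner_Integration.integral_cong simp: indicator_def)
  thus ?thesis using periodic_integral_shift[OF assms, of "c - 1"] by simp
qed

section \<open>Propagators with two decoupled ends\<close>

text \<open>The term that each end of the strip contributes to a propagator, together with the slope \<open>\<rho>\<close> of its
piecewise linear part.\<close>

locale torus_kernel =
  fixes f :: "real \<Rightarrow> real \<Rightarrow> real" and \<rho> :: real
  assumes kernel_borel: "(\<lambda>p. f (fst p) (snd p)) \<in> borel_measurable borel"
    and kernel_bound: "\<And>x y. x > 0 \<Longrightarrow> \<bar>f x y\<bar> \<le> 2 * edge_log x"
    and kernel_periodic: "\<And>x y. f x (y + 1) = f x y"
    and slope: "0 < \<rho>" "\<rho> \<le> 1"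
begin

lemma kernel_measurable [measurable (raw)]:
  assumes "u \<in> borel_measurable M" "v \<in> borel_measurable M"
  shows "(\<lambda>p. f (u p) (v p)) \<in> borel_measurable M"
proof -
  have "(\<lambda>p. (u p, v p)) \<in> M \<rightarrow>\<^sub>M borel"
    using measurable_Pair[OF assms] by (simp add: borel_prod)
  from measurable_compose[OF this kernel_borel] show ?thesis by simp
qed

text \<open>The subtracted power is the value at \<open>f = 0\<close>; it makes the integral converge at infinity.\<close>

definition moment :: "nat \<Rightarrow> nat \<Rightarrow> real" where
  "moment k n = (LINT p:half_cylinder|lborel. fst p ^ k *
     ((f (fst p) (snd p) - \<rho> * fst p) ^ n - (- (\<rho> * fst p)) ^ n))"

lemma kernel_power_diff_le:
  assumes x: "x > 0" and s: "\<bar>s\<bar> \<le> c * (1 + x)\<^sup>2" and c: "c \<ge> 1"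
  shows "\<bar>(s + f x y) ^ n - s ^ n\<bar> \<le> 2 * real n * (c + 2) ^ n * (edge_log x * (1 + (x + edge_log x)) ^ (2 * n))"
proof -
  have l: "edge_log x \<ge> 0" by (rule edge_log_nonneg[OF x])
  let ?D = "(c + 2) * (1 + (x + edge_log x))\<^sup>2"
  have "(1 + x)\<^sup>2 \<le> (1 + (x + edge_log x))\<^sup>2" using x l by (intro power_mono) auto
  hence s': "\<bar>s\<bar> \<le> c * (1 + (x + edge_log x))\<^sup>2"
    using s c by (meson mult_left_mono order_trans zero_le_one)
  have "edge_log x \<le> 1 + (x + edge_log x)" using x by simp
  also have "\<dots> \<le> (1 + (x + edge_log x))\<^sup>2" using x l by (intro self_le_power) auto
  finally have f': "\<bar>f x y\<bar> \<le> 2 * (1 + (x + edge_log x))\<^sup>2" using kernel_bound[OF x, of y] by simp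
  have "\<bar>(s + f x y) ^ n - s ^ n\<bar> \<le> real n * \<bar>f x y\<bar> * ?D ^ n"
  proof (rule abs_power_diff_le)
    show "\<bar>s\<bar> + \<bar>f x y\<bar> \<le> ?D" using s' f' by (simp add: algebra_simps)
    have "1 * 1 \<le> ?D" using x l c by (intro mult_mono one_le_power) auto
    thus "1 \<le> ?D" by simp
  qed
  also have "\<dots> \<le> real n * (2 * edge_log x) * ?D ^ n"
    using kernel_bound[OF x, of y] c by (intro mult_mono) auto
  also have "\<dots> = 2 * real n * (c + 2) ^ n * (edge_log x * (1 + (x + edge_log x)) ^ (2 * n))"
    by (simp add: power_mult_distrib power_mult)
  finally show ?thesis .
qed

lemma moment_integrable:
  "set_integrable lborel half_cylinder (\<lambda>p. fst p ^ k *
     ((f (fst p) (snd p) - \<rho> * fst p) ^ n - (- (\<rho> * fst p)) ^ n))"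
proof -
  obtain C where C: "C \<ge> 0" "\<And>x. x > 0 \<Longrightarrow> edge_log x * (1 + (x + edge_log x)) ^ (k + 2 * n) \<le> C * majorant x"
    by (rule edge_log_mult_power_le_majorant[of "k + 2 * n"]) blast
  let ?A = "2 * real n * 3 ^ n"
  show ?thesis
  proof (rule set_integrable_bound)
    show "set_integrable lborel half_cylinder (\<lambda>p. ?A * C * majorant (fst p))"
      by (intro set_integrable_mult_right set_integrable_strip majorant_integrable) auto
    fix p :: "real \<times> real" assume "p \<in> half_cylinder"
    then obtain x y where p: "p = (x, y)" and x: "x > 0" by auto
    have l: "edge_log x \<ge> 0" by (rule edge_log_nonneg[OF x])
    have "\<rho> * x \<le> 1 * x" using slope x by (intro mult_right_mono) auto
    also have "\<dots> \<le> (1 + x)\<^sup>2" using x by (simp add: power2_eq_square algebra_simps)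
    finally have "\<bar>(- (\<rho> * x) + f x y) ^ n - (- (\<rho> * x)) ^ n\<bar> \<le>
        2 * real n * (1 + 2) ^ n * (edge_log x * (1 + (x + edge_log x)) ^ (2 * n))"
      using x slope by (intro kernel_power_diff_le) auto
    hence "x ^ k * \<bar>(f x y - \<rho> * x) ^ n - (- (\<rho> * x)) ^ n\<bar> \<le>
        (1 + (x + edge_log x)) ^ k * (?A * (edge_log x * (1 + (x + edge_log x)) ^ (2 * n)))"
      using x l by (intro mult_mono power_mono) (auto simp: algebra_simps)
    also have "\<dots> = ?A * (edge_log x * (1 + (x + edge_log x)) ^ (k + 2 * n))"
      by (simp add: power_add)
    also have "\<dots> \<le> ?A * (C * majorant x)"
      using C(2)[OF x] by (intro mult_left_mono) auto
    finally show "\<bar>fst p ^ k * ((f (fst p) (snd p) - \<rho> * fst p) ^ n - (- (\<rho> * fst p)) ^ n)\<bar> \<le> ?A * C * majorant (fst p)"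
      using x by (simp add: p abs_mult)
  qed measurable
qed

text \<open>The integral of \<open>excess\<close> over the half-cylinder, that is, \<open>K\<close> times the contribution of one end to the
expansion.\<close>

definition moment_sum :: "nat \<Rightarrow> real \<Rightarrow> real \<Rightarrow> real" where
  "moment_sum l K c0 = (\<Sum>n\<le>l. \<Sum>m\<le>l - n.
     real (l choose n) * real ((l - n) choose m) * (\<rho> / K) ^ m * c0 ^ (l - n - m) * moment (2 * m) n)"

text \<open>The change of the \<open>l\<close>-th power caused by one end term, in the variable \<open>x = K v\<close> (the second coordinate of the
argument is the angle).\<close>

definition excess :: "nat \<Rightarrow> real \<Rightarrow> real \<Rightarrow> real \<times> real \<Rightarrow> real" where
  "excess l K c0 p = (c0 + \<rho> * (fst p)\<^sup>2 / K - \<rho> * fst p + f (fst p) (snd p)) ^ l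
                   - (c0 + \<rho> * (fst p)\<^sup>2 / K - \<rho> * fst p) ^ l"

lemma excess_borel [measurable]: "excess l K c0 \<in> borel_measurable borel"
  unfolding excess_def by measurable

text \<open>The term \<open>- \<rho> x\<close> is kept together with \<open>f\<close>. Expanding in \<open>c0 + \<rho> x\<^sup>2 / K\<close> instead of in
the whole quadratic is what leaves only even powers of \<open>x\<close> in front.\<close>

lemma excess_expand:
  "excess l K c0 p = (\<Sum>n\<le>l. \<Sum>m\<le>l - n.
     real (l choose n) * real ((l - n) choose m) * (\<rho> / K) ^ m * c0 ^ (l - n - m) *
     (fst p ^ (2 * m) * ((f (fst p) (snd p) - \<rho> * fst p) ^ n - (- (\<rho> * fst p)) ^ n)))"
proof -
  let ?x = "fst p"
  let ?s = "f (fst p) (snd p) - \<rho> * fst p" and ?u = "- (\<rho> * fst p)"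
  let ?a = "(\<rho> / K) * ?x\<^sup>2 + c0"
  have exp_a: "?a ^ j = (\<Sum>m\<le>j. real (j choose m) * (\<rho> / K) ^ m * c0 ^ (j - m) * ?x ^ (2 * m))" for j
    unfolding binomial_ring by (intro sum.cong refl) (simp add: power_mult_distrib power_mult power_divide)
  have "c0 + \<rho> * ?x\<^sup>2 / K - \<rho> * ?x + f (fst p) (snd p) = ?s + ?a"
       "c0 + \<rho> * ?x\<^sup>2 / K - \<rho> * ?x = ?u + ?a" by (simp_all add: algebra_simps)
  hence "excess l K c0 p = (?s + ?a) ^ l - (?u + ?a) ^ l"
    by (simp only: excess_def)
  also have "\<dots> = (\<Sum>n\<le>l. real (l choose n) * ?a ^ (l - n) * (?s ^ n - ?u ^ n))"
    unfolding binomial_ring sum_subtractf[symmetric] by (intro sum.cong refl) (simp add: algebra_simps)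
  also have "\<dots> = (\<Sum>n\<le>l. \<Sum>m\<le>l - n. real (l choose n) * real ((l - n) choose m) * (\<rho> / K) ^ m * c0 ^ (l - n - m) *
     (?x ^ (2 * m) * (?s ^ n - ?u ^ n)))"
    unfolding exp_a sum_distrib_left sum_distrib_right by (intro sum.cong refl) (simp only: mult_ac)
  finally show ?thesis .
qed

lemma excess_integral:
  "set_integrable lborel half_cylinder (excess l K c0)"
  "(LINT p:half_cylinder|lborel. excess l K c0 p) = moment_sum l K c0"
proof -
  let ?c = "\<lambda>n m. real (l choose n) * real ((l - n) choose m) * (\<rho> / K) ^ m * c0 ^ (l - n - m)"
  let ?t = "\<lambda>n m p. ?c n m * (fst p ^ (2 * m) *
    ((f (fst p) (snd p) - \<rho> * fst p) ^ n - (- (\<rho> * fst p)) ^ n))"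
  have eq: "excess l K c0 = (\<lambda>p. \<Sum>n\<le>l. \<Sum>m\<le>l - n. ?t n m p)"
    by (rule ext) (rule excess_expand)
  have i1: "set_integrable lborel half_cylinder (?t n m)" for n m
    by (intro set_integrable_mult_right moment_integrable)
  show "set_integrable lborel half_cylinder (excess l K c0)"
    unfolding eq by (intro set_integral_sum_fun(1) i1)
  show "(LINT p:half_cylinder|lborel. excess l K c0 p) = moment_sum l K c0"
    unfolding eq
    by (subst set_integral_sum_fun(2), intro set_integral_sum_fun(1) i1,
        subst set_integral_sum_fun(2), rule i1)
       (simp add: moment_sum_def moment_def mult.assoc)
qed

lemma power_le_exp_eighth:
  obtains C :: real where "C \<ge> 0" "\<And>K. K \<ge> 1 \<Longrightarrow> K ^ n \<le> C * exp (K / 8)"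
proof -
  have "(0::real) < 1 / 8" by simp
  from power_le_exp[OF this, of n]
  obtain C where C: "C \<ge> 0" "\<And>y::real. y \<ge> 0 \<Longrightarrow> (1 + y) ^ n \<le> C * exp (1 / 8 * y)" by blast
  have "K ^ n \<le> C * exp (K / 8)" if "K \<ge> 1" for K
    using C(2)[of K] power_mono[of K "1 + K" n] that by simp
  thus thesis using that C(1) by blast
qed

text \<open>The ends are integrated to infinity, although they occupy only \<open>x < K\<close>. The error is
exponentially small, with the polynomial growth in \<open>K\<close> absorbed into the exponent.\<close>

lemma excess_tail:
  obtains C where "C \<ge> 0"
    "\<And>K c0. K \<ge> 1 \<Longrightarrow> \<bar>c0\<bar> \<le> C0 * K \<Longrightarrow>
       \<bar>LINT p:{K..} \<times> {0..1}|lborel. excess l K c0 p\<bar> \<le> C * exp (- (5 * K / 8))"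
proof -
  obtain C1 where C1: "C1 \<ge> 0" "\<And>x. x > 0 \<Longrightarrow>
      edge_log x * (1 + (x + edge_log x)) ^ (2 * l) \<le> C1 * exp (- x + (x + edge_log x) / 8)"
    by (rule edge_log_mult_power_le[of "2 * l"]) blast
  obtain C2 :: real where C2: "C2 \<ge> 0" "\<And>K. K \<ge> 1 \<Longrightarrow> K ^ l \<le> C2 * exp (K / 8)"
    by (rule power_le_exp_eighth[of l]) blast
  define c where "c = \<bar>C0\<bar> + 2"
  let ?M = "LINT x:{0<..}|lborel. majorant x"
  define C where "C = 2 * real l * (c + 2) ^ l * C1 * C2 * ?M"
  have M: "?M \<ge> 0" unfolding set_lebesgue_integral_def
    by (intro Bochner_Integration.integral_nonneg) (auto simp: majorant_def indicator_def)
  have "\<bar>LINT p:{K..} \<times> {0..1}|lborel. excess l K c0 p\<bar> \<le> C * exp (- (5 * K / 8))"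
    if K: "K \<ge> 1" and c0: "\<bar>c0\<bar> \<le> C0 * K" for K c0
  proof -
    let ?w = "2 * real l * (c * K + 2 * K) ^ l * C1 * exp (- (3 * K / 4))"
    have w: "set_integrable lborel ({K..} \<times> {0..1}) (\<lambda>p::real\<times>real. ?w * majorant (fst p))"
      by (rule set_integrable_subset[of _ half_cylinder])
         (use K in \<open>auto intro!: set_integrable_mult_right set_integrable_strip majorant_integrable\<close>)
    have "\<bar>LINT p:{K..} \<times> {0..1}|lborel. excess l K c0 p\<bar> \<le> (LINT p:{K..} \<times> {0..1::real}|lborel. ?w * majorant (fst p))"
    proof (rule set_integrable_bound(2)[OF w])
      fix p :: "real \<times> real" assume "p \<in> {K..} \<times> {0..1}"
      then obtain x y where p: "p = (x, y)" and x: "x \<ge> K" by auto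
      have x0: "x > 0" using x K by simp
      have l: "edge_log x \<ge> 0" by (rule edge_log_nonneg[OF x0])
      let ?s = "c0 + \<rho> * x\<^sup>2 / K - \<rho> * x"
      have "\<bar>\<rho> * x\<^sup>2 / K\<bar> \<le> x\<^sup>2"
      proof -
        have "\<rho> * x\<^sup>2 \<le> K * x\<^sup>2" using slope K by (intro mult_right_mono) auto
        thus ?thesis using slope K by (simp add: field_simps)
      qed
      moreover have "\<bar>\<rho> * x\<bar> \<le> x" using slope x0 by (simp add: abs_mult)
      ultimately have "\<bar>?s\<bar> \<le> C0 * K + x\<^sup>2 + x" using c0 by linarith
      also have "\<dots> \<le> \<bar>C0\<bar> * K * (1 + x)\<^sup>2 + 2 * K * (1 + x)\<^sup>2"
      proof -
        have "1 \<le> (1 + x)\<^sup>2" using x0 by (intro one_le_power) auto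
        hence "\<bar>C0\<bar> * K * 1 \<le> \<bar>C0\<bar> * K * (1 + x)\<^sup>2"
          using K by (intro mult_left_mono) auto
        moreover have "C0 * K \<le> \<bar>C0\<bar> * K" using K by (intro mult_right_mono) auto
        ultimately have "C0 * K \<le> \<bar>C0\<bar> * K * (1 + x)\<^sup>2" by simp
        moreover have "x\<^sup>2 + x \<le> 2 * 1 * (1 + x)\<^sup>2" using x0 by (simp add: power2_eq_square algebra_simps)
        moreover have "2 * 1 * (1 + x)\<^sup>2 \<le> 2 * K * (1 + x)\<^sup>2"
          using K by (intro mult_right_mono mult_left_mono) auto
        ultimately show ?thesis by linarith
      qed
      finally have s: "\<bar>?s\<bar> \<le> c * K * (1 + x)\<^sup>2" by (simp add: c_def algebra_simps)
      have cK: "c * K \<ge> 1" using K by (simp add: c_def mult_ge1_I)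
      have "\<bar>(?s + f x y) ^ l - ?s ^ l\<bar> \<le> 2 * real l * (c * K + 2) ^ l * (edge_log x * (1 + (x + edge_log x)) ^ (2 * l))"
        by (rule kernel_power_diff_le[OF x0 s cK])
      also have "\<dots> \<le> 2 * real l * (c * K + 2 * K) ^ l * (C1 * exp (- x + (x + edge_log x) / 8))"
        using C1(2)[OF x0] x0 K cK l
        by (intro mult_mono[OF _ C1(2)[OF x0]] mult_left_mono power_mono) auto
      also have "\<dots> \<le> 2 * real l * (c * K + 2 * K) ^ l * (C1 * (exp (- (3 * K / 4)) * majorant x))"
        using C1(1) cK K x unfolding majorant_def exp_add[symmetric]
        by (intro mult_left_mono) (auto simp: field_simps)
      finally show "\<bar>excess l K c0 p\<bar> \<le> ?w * majorant (fst p)"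
        by (simp add: excess_def p mult_ac)
    qed auto
    also have "\<dots> \<le> (LINT p:half_cylinder|lborel. ?w * majorant (fst p))"
      unfolding set_lebesgue_integral_def
    proof (rule Bochner_Integration.integral_mono)
      show "integrable lborel (\<lambda>p. indicat_real ({K..} \<times> {0..1::real}) p *\<^sub>R (?w * majorant (fst p)))"
        using w unfolding set_integrable_def .
      show "integrable lborel (\<lambda>p. indicat_real half_cylinder p *\<^sub>R (?w * majorant (fst p)))"
        unfolding set_integrable_def[symmetric]
        by (intro set_integrable_mult_right set_integrable_strip majorant_integrable) auto
      show "indicat_real ({K..} \<times> {0..1}) p *\<^sub>R (?w * majorant (fst p)) \<le> indicat_real half_cylinder p *\<^sub>R (?w * majorant (fst p))" for p
        using K C1(1) by (cases p) (auto simp: indicator_def majorant_def c_def)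
    qed
    also have "\<dots> = ?w * ?M"
      by (simp only: set_integral_mult_right)
         (subst set_integrable_strip(2), auto intro: majorant_integrable)
    also have "?w = 2 * real l * (c + 2) ^ l * C1 * (K ^ l * exp (- (3 * K / 4)))"
      by (simp add: power_mult_distrib[symmetric] algebra_simps)
    also have "\<dots> * ?M \<le> 2 * real l * (c + 2) ^ l * C1 * (C2 * exp (K / 8) * exp (- (3 * K / 4))) * ?M"
      using C1(1) C2(2)[OF K] M by (intro mult_right_mono mult_left_mono) (auto simp: c_def)
    also have "\<dots> = C * exp (- (5 * K / 8))"
      by (simp add: C_def mult.assoc flip: exp_add)
    finally show ?thesis .
  qed
  moreover have "C \<ge> 0" using C1(1) C2(1) M by (simp add: C_def c_def)
  ultimately show thesis using that by blast
qed

lemma one_end_asymptotics: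
  obtains C where "C \<ge> 0"
    "\<And>K c0. K \<ge> 1 \<Longrightarrow> \<bar>c0\<bar> \<le> C0 * K \<Longrightarrow>
       set_integrable lborel unit_box (\<lambda>p. excess l K c0 (K * fst p, snd p)) \<and>
       \<bar>(LINT p:unit_box|lborel. excess l K c0 (K * fst p, snd p)) - moment_sum l K c0 / K\<bar> \<le> C * exp (- (5 * K / 8))"
proof -
  obtain C where C: "C \<ge> 0"
    "\<And>K c0. K \<ge> 1 \<Longrightarrow> \<bar>c0\<bar> \<le> C0 * K \<Longrightarrow>
       \<bar>LINT p:{K..} \<times> {0..1}|lborel. excess l K c0 p\<bar> \<le> C * exp (- (5 * K / 8))"
    by (rule excess_tail[of C0 l]) blast
  have "set_integrable lborel unit_box (\<lambda>p. excess l K c0 (K * fst p, snd p)) \<and>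
       \<bar>(LINT p:unit_box|lborel. excess l K c0 (K * fst p, snd p)) - moment_sum l K c0 / K\<bar> \<le> C * exp (- (5 * K / 8))"
    if K: "K \<ge> 1" and c0: "\<bar>c0\<bar> \<le> C0 * K" for K c0
  proof -
    let ?E = "excess l K c0"
    let ?lo = "{0<..<K} \<times> {0..1::real}" and ?hi = "{K..} \<times> {0..1::real}"
    have i: "set_integrable lborel ?lo ?E" "set_integrable lborel ?hi ?E"
      by (rule set_integrable_subset[OF excess_integral(1)]; use K in auto)+
    have "half_cylinder = ?lo \<union> ?hi" using K by auto
    hence "moment_sum l K c0 = (LINT p:?lo|lborel. ?E p) + (LINT p:?hi|lborel. ?E p)"
      using set_integral_Un[OF _ i] excess_integral(2)[of l K c0] by fastforce
    hence "(LINT p:?lo|lborel. ?E p) / K - moment_sum l K c0 / K = - (LINT p:?hi|lborel. ?E p) / K"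
      by (simp add: add_divide_distrib)
    moreover have "\<bar>- (LINT p:?hi|lborel. ?E p) / K\<bar> \<le> \<bar>LINT p:?hi|lborel. ?E p\<bar>"
      using K by (simp add: divide_le_eq mult_le_cancel_left1)
    ultimately show ?thesis
      using scale_strip[of K ?E] i K C(2)[OF K c0] by simp
  qed
  thus thesis using that C(1) by blast
qed

text \<open>The part of the propagator that is quadratic in \<open>v\<close>: the Green function of a circle of length \<open>K\<close>, up to
a factor and an additive constant.\<close>

definition worldline :: "real \<Rightarrow> real \<Rightarrow> real \<Rightarrow> real" where
  "worldline K c0 v = c0 + \<rho> * K * (v\<^sup>2 - v)"

lemma worldline_borel [measurable]: "worldline K c0 \<in> borel_measurable borel"
  unfolding worldline_def by measurable

lemma worldline_reflect: "worldline K c0 (1 - v) = worldline K c0 v"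
  by (simp add: worldline_def power2_eq_square algebra_simps)

lemma excess_scaled:
  "K > 0 \<Longrightarrow> excess l K c0 (K * v, y) = (worldline K c0 v + f (K * v) y) ^ l - worldline K c0 v ^ l"
  by (simp add: excess_def worldline_def power2_eq_square algebra_simps)

lemma abs_worldline_le:
  assumes "0 < v" "v < 1" "K \<ge> 1"
  shows "\<bar>worldline K c0 v\<bar> \<le> \<bar>c0\<bar> + K"
proof -
  have "v\<^sup>2 - v = - (v * (1 - v))" by (simp add: power2_eq_square algebra_simps)
  moreover have "0 \<le> v * (1 - v)" "v * (1 - v) \<le> 1 * 1"
    using assms by (simp, intro mult_mono) auto
  ultimately have "\<bar>v\<^sup>2 - v\<bar> \<le> 1" by simp
  hence "\<rho> * K * \<bar>v\<^sup>2 - v\<bar> \<le> 1 * K * 1"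
    using slope assms by (intro mult_mono) auto
  hence "\<bar>\<rho> * K * (v\<^sup>2 - v)\<bar> \<le> K" using slope assms by (simp add: abs_mult)
  thus ?thesis unfolding worldline_def by linarith
qed

text \<open>The end at \<open>v = 1\<close> contributes the same as the one at \<open>v = 0\<close>: the quadratic part is
symmetric under \<open>v \<mapsto> 1 - v\<close>, and a reflection and translation of the angle does not change an integral over a period.\<close>

lemma excess_reflected_end:
  assumes K: "K \<ge> 1"
    and int: "set_integrable lborel unit_box (\<lambda>p. excess l K c0 (K * fst p, snd p))"
  shows "set_integrable lborel unit_box (\<lambda>p. excess l K c0 (K * (1 - fst p), c - snd p))" (is ?I)
    and "(LINT p:unit_box|lborel. excess l K c0 (K * (1 - fst p), c - snd p)) =
         (LINT p:unit_box|lborel. excess l K c0 (K * fst p, snd p))"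
proof -
  let ?g = "\<lambda>x y. excess l K c0 (K * x, y)"
  have bnd: "\<exists>B. \<forall>y. \<bar>?g x y\<bar> \<le> B" if "x > 0" for x
  proof (intro exI allI)
    fix y
    let ?p = "c0 + \<rho> * (K * x)\<^sup>2 / K - \<rho> * (K * x)"
    have "K * x > 0" using K that by simp
    hence "\<bar>f (K * x) y\<bar> \<le> 2 * edge_log (K * x)" by (rule kernel_bound)
    thus "\<bar>?g x y\<bar> \<le> real l * (2 * edge_log (K * x)) * (1 + \<bar>?p\<bar> + 2 * edge_log (K * x)) ^ l"
      unfolding excess_def fst_conv snd_conv
      by (intro order_trans[OF abs_power_diff_le[where D = "1 + \<bar>?p\<bar> + 2 * edge_log (K * x)"]] mult_right_mono mult_left_mono) auto
  qed
  have per: "?g x (y + 1) = ?g x y" for x y by (simp add: excess_def kernel_periodic)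
  have gm [measurable]: "?g x \<in> borel_measurable borel" for x unfolding excess_def by measurable
  have inner: "(LINT y:{0..1}|lborel. ?g x (c - y)) = (LINT y:{0..1}|lborel. ?g x y)" if "x > 0" for x
    using periodic_integral_reflect[OF gm _ per] bnd[OF that] by blast
  show I: ?I
  proof -
    obtain C where C: "C \<ge> 0" "\<And>x. x > 0 \<Longrightarrow> edge_log x * (1 + (x + edge_log x)) ^ (2 * l) \<le> C * majorant x"
      by (rule edge_log_mult_power_le_majorant[of "2 * l"]) blast
    let ?A = "2 * real l * (\<bar>c0\<bar> + 2 + 2) ^ l * C"
    have w: "set_integrable lborel {0<..<1} (\<lambda>v. ?A * majorant (K * (1 - v)))"
    proof -
      have "set_integrable lborel {0<..<K} (\<lambda>x. ?A * majorant x)"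
        by (intro set_integrable_mult_right set_integrable_subset[OF majorant_integrable]) auto
      hence "integrable lborel (\<lambda>x. indicator {0<..<K} x *\<^sub>R (?A * majorant x))"
        by (simp only: set_integrable_def)
      hence "integrable lborel (\<lambda>v. indicator {0<..<K} (K + (-K) * v) *\<^sub>R (?A * majorant (K + (-K) * v)))"
        by (intro lborel_integrable_real_affine) (use K in auto)
      also have "(\<lambda>v. indicator {0<..<K} (K + (-K) * v) *\<^sub>R (?A * majorant (K + (-K) * v)))
        = (\<lambda>v. indicator {0<..<1} v *\<^sub>R (?A * majorant (K * (1 - v))))"
        using K by (auto simp: fun_eq_iff indicator_def algebra_simps mult_less_cancel_left zero_less_mult_iff)
      finally show ?thesis by (simp only: set_integrable_def)
    qed
    show ?I
    proof (rule set_integrable_bound[OF set_integrable_strip(1)[OF w]])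
      fix p :: "real \<times> real" assume "p \<in> unit_box"
      then obtain v y where p: "p = (v, y)" and v: "0 < v" "v < 1" by auto
      define x where "x = K * (1 - v)"
      have x: "x > 0" "x \<le> K" using v K by (auto simp: x_def)
      let ?s = "c0 + \<rho> * x\<^sup>2 / K - \<rho> * x"
      have "\<rho> * x\<^sup>2 / K \<le> 1 * x\<^sup>2 / 1" using slope K by (intro frac_le mult_right_mono) auto
      moreover have "\<rho> * x \<le> 1 * x" using slope x by (intro mult_right_mono) auto
      moreover have "\<rho> * x\<^sup>2 / K \<ge> 0" "\<rho> * x \<ge> 0" using slope K x by auto
      ultimately have "\<bar>?s\<bar> \<le> \<bar>c0\<bar> + x\<^sup>2 + x" by linarith
      also have "\<dots> \<le> (\<bar>c0\<bar> + 2) * (1 + x)\<^sup>2"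
        using x by (simp add: power2_eq_square algebra_simps mult_nonneg_nonneg add_nonneg_nonneg)
      finally have "\<bar>(?s + f x (c - y)) ^ l - ?s ^ l\<bar> \<le>
          2 * real l * (\<bar>c0\<bar> + 2 + 2) ^ l * (edge_log x * (1 + (x + edge_log x)) ^ (2 * l))"
        by (intro kernel_power_diff_le x) auto
      also have "\<dots> \<le> 2 * real l * (\<bar>c0\<bar> + 2 + 2) ^ l * (C * majorant x)"
        using C(2)[OF x(1)] by (intro mult_left_mono) auto
      finally show "\<bar>excess l K c0 (K * (1 - fst p), c - snd p)\<bar> \<le> ?A * majorant (K * (1 - fst p))"
        by (simp add: p excess_def x_def[symmetric] mult.assoc)
    qed auto
  qed
  have "(LINT p:unit_box|lborel. ?g (1 - fst p) (c - snd p)) =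
      (LINT v:{0<..<1}|lborel. LINT y:{0..1}|lborel. ?g (1 - v) (c - y))"
    using fubini_rectangle[OF I] by simp
  also have "\<dots> = (LINT v:{0<..<1}|lborel. LINT y:{0..1}|lborel. ?g (1 - v) y)"
    by (rule set_lebesgue_integral_cong) (auto simp: inner)
  also have "\<dots> = (LINT v:{0<..<1}|lborel. LINT y:{0..1}|lborel. ?g v y)"
    unfolding set_lebesgue_integral_def
    by (subst (1) lborel_integral_real_affine[of "-1" _ 1])
       (auto intro!: Bochner_Integration.integral_cong simp: indicator_def)
  also have "\<dots> = (LINT p:unit_box|lborel. ?g (fst p) (snd p))"
    using fubini_rectangle[OF int] by simp
  finally show "(LINT p:unit_box|lborel. excess l K c0 (K * (1 - fst p), c - snd p)) =
         (LINT p:unit_box|lborel. excess l K c0 (K * fst p, snd p))" by simp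
qed

lemma edge_weight_integrable:
  "set_integrable lborel unit_box (\<lambda>p. (1 + edge_log (fst p) + edge_log (1 - fst p)) ^ n)"
proof -
  have "(0::real) < 1 / 8" by simp
  from power_le_exp[OF this, of n]
  obtain C :: real where C: "C \<ge> 0" "\<And>y::real. y \<ge> 0 \<Longrightarrow> (1 + y) ^ n \<le> C * exp (1 / 8 * y)" by blast
  let ?w = "\<lambda>v. C * 2 ^ n * exp (1 / 8) * (majorant v + majorant (1 - v))"
  have m: "set_integrable lborel {0<..<1} majorant"
    by (rule set_integrable_subset[OF majorant_integrable]) auto
  hence "integrable lborel (\<lambda>x. indicator {0<..<1} x *\<^sub>R majorant x)" by (simp only: set_integrable_def)
  hence "integrable lborel (\<lambda>v. indicator {0<..<1} (1 + (-1) * v) *\<^sub>R majorant (1 + (-1) * v))"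
    by (intro lborel_integrable_real_affine) auto
  also have "(\<lambda>v. indicator {0<..<1} (1 + (-1) * v) *\<^sub>R majorant (1 + (-1) * v)) =
      (\<lambda>v. indicator {0<..<1} v *\<^sub>R majorant (1 - v))"
    by (auto simp: fun_eq_iff indicator_def)
  finally have m': "set_integrable lborel {0<..<1} (\<lambda>v. majorant (1 - v))" by (simp only: set_integrable_def)
  have w: "set_integrable lborel {0<..<1} ?w"
    by (intro set_integrable_mult_right set_integral_add m m')
  show ?thesis
  proof (rule set_integrable_bound[OF set_integrable_strip(1)[OF w]])
    fix p :: "real \<times> real" assume "p \<in> unit_box"
    then obtain v y where p: "p = (v, y)" and v: "0 < v" "v < 1" by auto
    have one: "(1 + 2 * edge_log x) ^ n \<le> C * 2 ^ n * exp (1 / 8) * majorant x" if "0 < x" "x < 1" for x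
    proof -
      have l: "edge_log x \<ge> 0" by (rule edge_log_nonneg[OF that(1)])
      have "(1 + 2 * edge_log x) ^ n \<le> (2 * (1 + edge_log x)) ^ n" using l by (intro power_mono) auto
      also have "\<dots> = 2 ^ n * (1 + edge_log x) ^ n" by (simp only: power_mult_distrib)
      also have "\<dots> \<le> 2 ^ n * (C * exp (1 / 8 * edge_log x))" by (intro mult_left_mono C l) auto
      also have "exp (1 / 8 * edge_log x) \<le> exp (1 / 8) * majorant x"
        unfolding majorant_def exp_add[symmetric] using that by (simp add: field_simps)
      hence "2 ^ n * (C * exp (1 / 8 * edge_log x)) \<le> 2 ^ n * (C * (exp (1 / 8) * majorant x))"
        using C(1) by (intro mult_left_mono) auto
      finally show ?thesis by (simp add: mult_ac)
    qed
    have l: "edge_log v \<ge> 0" "edge_log (1 - v) \<ge> 0" using v by (auto intro: edge_log_nonneg)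
    have "(1 + edge_log v + edge_log (1 - v)) ^ n \<le> (1 + 2 * edge_log v) ^ n + (1 + 2 * edge_log (1 - v)) ^ n"
    proof (cases "edge_log v \<le> edge_log (1 - v)")
      case True
      hence "(1 + edge_log v + edge_log (1 - v)) ^ n \<le> (1 + 2 * edge_log (1 - v)) ^ n"
        using l by (intro power_mono) auto
      thus ?thesis using l by (intro order_trans[OF _ add_increasing[OF _ order.refl]]) auto
    next
      case False
      hence "(1 + edge_log v + edge_log (1 - v)) ^ n \<le> (1 + 2 * edge_log v) ^ n"
        using l by (intro power_mono) auto
      thus ?thesis using l by (intro order_trans[OF _ add_increasing2[OF _ order.refl]]) auto
    qed
    also have "\<dots> \<le> ?w v" using one[of v] one[of "1 - v"] v by (simp add: algebra_simps)
    finally show "\<bar>(1 + edge_log (fst p) + edge_log (1 - fst p)) ^ n\<bar> \<le> ?w (fst p)"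
      using l by (simp add: p)
  qed auto
qed

text \<open>The error is \<open>exp (- 5 K / 8)\<close>, which is better than \<open>exp (- K / 2)\<close>. This matters in the open case, where
\<open>K = 2 T\<close> and the Laurent polynomial is defined by an error of size \<open>exp (- T)\<close>. The constant depends on neither the
function \<open>F\<close> nor the translation \<open>c\<close>, since in the closed case both depend on \<open>Re \<tau>\<close>.\<close>

lemma two_ended_asymptotics:
  obtains C where "C \<ge> 0"
    "\<And>K c0 c F. K \<ge> 1 \<Longrightarrow> \<bar>c0\<bar> \<le> C0 * K \<Longrightarrow> F \<in> borel_measurable borel \<Longrightarrow>
       (\<And>v y. 0 < v \<Longrightarrow> v < 1 \<Longrightarrow>
          \<bar>F (v, y) - (worldline K c0 v + f (K * v) y + f (K * (1 - v)) (c - y))\<bar> \<le> C1 * exp (- K)) \<Longrightarrow>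
       set_integrable lborel unit_box (\<lambda>p. F p ^ l) \<and>
       \<bar>(LINT p:unit_box|lborel. F p ^ l) -
          ((LINT v:{0<..<1}|lborel. worldline K c0 v ^ l) + 2 * moment_sum l K c0 / K)\<bar> \<le> C * exp (- (5 * K / 8))"
proof -
  obtain Ca where Ca: "Ca \<ge> 0"
    "\<And>K c0. K \<ge> 1 \<Longrightarrow> \<bar>c0\<bar> \<le> C0 * K \<Longrightarrow>
       set_integrable lborel unit_box (\<lambda>p. excess l K c0 (K * fst p, snd p)) \<and>
       \<bar>(LINT p:unit_box|lborel. excess l K c0 (K * fst p, snd p)) - moment_sum l K c0 / K\<bar> \<le> Ca * exp (- (5 * K / 8))"
    by (rule one_end_asymptotics[of C0 l]) blast
  obtain C3 :: real where C3: "C3 \<ge> 0" "\<And>K. K \<ge> 1 \<Longrightarrow> K ^ (l + 2) \<le> C3 * exp (K / 8)"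
    by (rule power_le_exp_eighth[of "l + 2"]) blast
  define c' where "c' = \<bar>C0\<bar> + \<bar>C1\<bar> + 4"
  define C2 where "C2 = real l * \<bar>C1\<bar> + 4 * (real l)\<^sup>2"
  let ?W = "\<lambda>p::real\<times>real. (1 + edge_log (fst p) + edge_log (1 - fst p)) ^ (l + 2)"
  let ?M = "LINT p:unit_box|lborel. ?W p"
  define C where "C = 2 * Ca + C2 * c' ^ (l + 2) * C3 * ?M"
  have M: "?M \<ge> 0" unfolding set_lebesgue_integral_def
    by (intro Bochner_Integration.integral_nonneg)
       (auto simp: indicator_def simp del: power_Suc intro!: zero_le_power add_nonneg_nonneg edge_log_nonneg)
  have main: "set_integrable lborel unit_box (\<lambda>p. F p ^ l) \<and>
       \<bar>(LINT p:unit_box|lborel. F p ^ l) -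
          ((LINT v:{0<..<1}|lborel. worldline K c0 v ^ l) + 2 * moment_sum l K c0 / K)\<bar> \<le> C * exp (- (5 * K / 8))"
    if K: "K \<ge> 1" and c0: "\<bar>c0\<bar> \<le> C0 * K" and [measurable]: "F \<in> borel_measurable borel"
      and F: "\<And>v y. 0 < v \<Longrightarrow> v < 1 \<Longrightarrow>
          \<bar>F (v, y) - (worldline K c0 v + f (K * v) y + f (K * (1 - v)) (c - y))\<bar> \<le> C1 * exp (- K)"
      for K c0 c and F :: "real \<times> real \<Rightarrow> real"
  proof -
    let ?P = "\<lambda>p::real\<times>real. worldline K c0 (fst p) ^ l"
    let ?A = "\<lambda>p. excess l K c0 (K * fst p, snd p)"
    let ?B = "\<lambda>p. excess l K c0 (K * (1 - fst p), c - snd p)"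
    let ?E = "\<lambda>p. F p ^ l - ?A p - ?B p - ?P p"
    note A = Ca(2)[OF K c0]
    note B = excess_reflected_end[OF K A[THEN conjunct1], of c]
    have wl: "set_integrable lborel {0<..<1} (\<lambda>v. worldline K c0 v ^ l)"
      by (rule set_integrable_subset[of _ "{0..1}"])
         (auto intro!: borel_integrable_atLeastAtMost' continuous_intros simp: worldline_def[abs_def])
    have "(\<lambda>v. worldline K c0 v ^ l) \<in> borel_measurable borel" by measurable
    note P = set_integrable_strip[OF wl _ this, simplified]
    let ?w = "C2 * c' ^ (l + 2) * (exp (- K) * K ^ (l + 2))"
    have w: "set_integrable lborel unit_box (\<lambda>p. ?w * ?W p)"
      by (intro set_integrable_mult_right edge_weight_integrable)
    have le: "\<bar>?E p\<bar> \<le> ?w * ?W p" if pb: "p \<in> unit_box" for p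
    proof -
      obtain v y where p: "p = (v, y)" and v: "0 < v" "v < 1" using pb by auto
      have pos: "K * v > 0" "K * (1 - v) > 0" using K v by auto
      define P where "P = worldline K c0 v"
      define a where "a = f (K * v) y"
      define b where "b = f (K * (1 - v)) (c - y)"
      define R where "R = F (v, y) - (P + a + b)"
      define \<alpha> where "\<alpha> = edge_log (K * v)"
      define \<beta> where "\<beta> = edge_log (K * (1 - v))"
      define D where "D = 1 + \<bar>P\<bar> + 2 * \<alpha> + 2 * \<beta> + \<bar>C1\<bar>"
      have nn: "\<alpha> \<ge> 0" "\<beta> \<ge> 0" using pos by (auto simp: \<alpha>_def \<beta>_def intro: edge_log_nonneg)
      have ab: "\<bar>a\<bar> \<le> 2 * \<alpha>" "\<bar>b\<bar> \<le> 2 * \<beta>"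
        using kernel_bound pos by (auto simp: a_def b_def \<alpha>_def \<beta>_def)
      have R: "\<bar>R\<bar> \<le> \<bar>C1\<bar> * exp (- K)"
      proof -
        have "\<bar>R\<bar> \<le> C1 * exp (- K)" using F[OF v, of y] by (simp add: R_def P_def a_def b_def)
        also have "\<dots> \<le> \<bar>C1\<bar> * exp (- K)" by (intro mult_right_mono) auto
        finally show ?thesis .
      qed
      have "\<bar>C1\<bar> * exp (- K) \<le> \<bar>C1\<bar> * 1" using K by (intro mult_left_mono) auto
      with R have R': "\<bar>R\<bar> \<le> \<bar>C1\<bar>" by simp
      have D1: "D \<ge> 1" using nn by (simp add: D_def)
      \<comment> \<open>the remainder of the propagator, and then the interaction of the two ends\<close>
      have E: "?E p = ((P + a + b + R) ^ l - (P + a + b) ^ l)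
          + ((P + a + b) ^ l - (P + a) ^ l - (P + b) ^ l + P ^ l)"
        using K by (simp add: p excess_scaled worldline_reflect R_def P_def a_def b_def)
      have e1: "\<bar>(P + a + b + R) ^ l - (P + a + b) ^ l\<bar> \<le> real l * \<bar>R\<bar> * D ^ l"
        by (rule abs_power_diff_le) (use ab R' D1 in \<open>auto simp: D_def\<close>)
      have e2: "\<bar>(P + a + b) ^ l - (P + a) ^ l - (P + b) ^ l + P ^ l\<bar> \<le> (real l)\<^sup>2 * (\<bar>a\<bar> * \<bar>b\<bar>) * D ^ l"
        by (rule abs_power_cross_le) (use ab D1 in \<open>auto simp: D_def\<close>)
      \<comment> \<open>the two decay rates add up to \<open>exp (- K)\<close>, wherever \<open>v\<close> lies\<close>
      have "\<alpha> * \<beta> \<le> (exp (- (K * v)) * (1 + \<alpha>)) * (exp (- (K * (1 - v))) * (1 + \<beta>))"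
        using edge_log_le_exp pos nn unfolding \<alpha>_def \<beta>_def by (intro mult_mono) auto
      also have "\<dots> = exp (- K) * ((1 + \<alpha>) * (1 + \<beta>))"
        by (simp add: mult_ac flip: exp_add) (simp add: algebra_simps)
      also have "(1 + \<alpha>) * (1 + \<beta>) \<le> D * D"
        using nn by (intro mult_mono) (auto simp: D_def)
      finally have "\<alpha> * \<beta> \<le> exp (- K) * (D * D)" by simp
      moreover have "\<bar>a\<bar> * \<bar>b\<bar> \<le> (2 * \<alpha>) * (2 * \<beta>)" using ab nn by (intro mult_mono) auto
      ultimately have ab2: "\<bar>a\<bar> * \<bar>b\<bar> \<le> 4 * (exp (- K) * (D * D))" by simp
      have "\<bar>?E p\<bar> \<le> real l * \<bar>R\<bar> * D ^ l + (real l)\<^sup>2 * (\<bar>a\<bar> * \<bar>b\<bar>) * D ^ l"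
        unfolding E using e1 e2 by linarith
      also have "\<dots> \<le> real l * (\<bar>C1\<bar> * exp (- K)) * D ^ (l + 2)
          + (real l)\<^sup>2 * (4 * (exp (- K) * (D * D))) * D ^ l"
      proof (rule add_mono)
        have "real l * \<bar>R\<bar> \<le> real l * (\<bar>C1\<bar> * exp (- K))" using R by (intro mult_left_mono) auto
        moreover have "D ^ l \<le> D ^ (l + 2)" using D1 by (intro power_increasing) auto
        ultimately show "real l * \<bar>R\<bar> * D ^ l \<le> real l * (\<bar>C1\<bar> * exp (- K)) * D ^ (l + 2)"
          by (rule mult_mono) (use D1 in auto)
        show "(real l)\<^sup>2 * (\<bar>a\<bar> * \<bar>b\<bar>) * D ^ l \<le> (real l)\<^sup>2 * (4 * (exp (- K) * (D * D))) * D ^ l"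
          using D1 by (intro mult_right_mono[OF mult_left_mono[OF ab2]]) auto
      qed
      also have "\<dots> = C2 * exp (- K) * D ^ (l + 2)"
        by (simp add: C2_def algebra_simps)
      also have "\<dots> \<le> C2 * exp (- K) * (c' * K * (1 + edge_log v + edge_log (1 - v))) ^ (l + 2)"
      proof (intro mult_left_mono power_mono)
        have l: "edge_log v \<ge> 0" "edge_log (1 - v) \<ge> 0" using v by (auto intro: edge_log_nonneg)
        have "\<alpha> \<le> edge_log v" "\<beta> \<le> edge_log (1 - v)"
          unfolding \<alpha>_def \<beta>_def using v K
          by (intro edge_log_antimono; simp add: mult_le_cancel_right1)+
        moreover have "\<bar>P\<bar> \<le> \<bar>C0\<bar> * K + K"
        proof -
          have "C0 * K \<le> \<bar>C0\<bar> * K" using K by (intro mult_right_mono) auto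
          thus ?thesis using abs_worldline_le[OF v K, of c0] c0 unfolding P_def by linarith
        qed
        ultimately have "D \<le> 1 + \<bar>C0\<bar> * K + K + 2 * edge_log v + 2 * edge_log (1 - v) + \<bar>C1\<bar>"
          by (simp add: D_def)
        also have "\<dots> \<le> K + \<bar>C0\<bar> * K + K + 2 * K * edge_log v + 2 * K * edge_log (1 - v) + \<bar>C1\<bar> * K"
          using K l by (intro add_mono mult_right_mono order.refl) (auto simp: mult_le_cancel_left1)
        also have "\<dots> \<le> c' * K * (1 + edge_log v + edge_log (1 - v))"
        proof -
          have "0 \<le> K * (2 + (\<bar>C0\<bar> + \<bar>C1\<bar> + 2) * (edge_log v + edge_log (1 - v)))"
            using K l by (intro mult_nonneg_nonneg add_nonneg_nonneg) auto
          thus ?thesis by (simp add: c'_def algebra_simps)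
        qed
        finally show "D \<le> c' * K * (1 + edge_log v + edge_log (1 - v))" .
      qed (use D1 in \<open>auto simp: C2_def\<close>)
      also have "\<dots> = ?w * ?W p" by (simp only: p fst_conv power_mult_distrib mult_ac)
      finally show ?thesis .
    qed
    have Em: "?E \<in> borel_measurable borel" by (intro borel_measurable_diff) (simp_all add: excess_def)
    note E = set_integrable_bound[OF w _ Em le]
    have E1: "set_integrable lborel unit_box ?E" by (rule E(1)) auto
    have "\<bar>LINT p:unit_box|lborel. ?E p\<bar> \<le> (LINT p:unit_box|lborel. ?w * ?W p)" by (rule E(2)) auto
    also have "\<dots> = C2 * c' ^ (l + 2) * (exp (- K) * K ^ (l + 2)) * ?M" by simp
    also have "\<dots> \<le> C2 * c' ^ (l + 2) * (exp (- K) * (C3 * exp (K / 8))) * ?M"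
      using C3(2)[OF K] M by (intro mult_right_mono mult_left_mono) (auto simp: c'_def C2_def)
    also have "\<dots> = C2 * c' ^ (l + 2) * C3 * ?M * exp (- (7 * K / 8))"
      by (simp add: mult_ac flip: exp_add)
    also have "\<dots> \<le> C2 * c' ^ (l + 2) * C3 * ?M * exp (- (5 * K / 8))"
      using M C3(1) K by (intro mult_left_mono) (auto simp: c'_def C2_def)
    finally have Ele: "\<bar>LINT p:unit_box|lborel. ?E p\<bar> \<le> C2 * c' ^ (l + 2) * C3 * ?M * exp (- (5 * K / 8))" .
    have eq: "(\<lambda>p. F p ^ l) = (\<lambda>p. ((?E p + ?A p) + ?B p) + ?P p)" by auto
    note i = set_integral_add[OF set_integral_add(1)[OF set_integral_add(1)[OF E1 A[THEN conjunct1]] B(1)] P(1)]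
      set_integral_add[OF set_integral_add(1)[OF E1 A[THEN conjunct1]] B(1)]
      set_integral_add[OF E1 A[THEN conjunct1]]
    have "set_integrable lborel unit_box (\<lambda>p. F p ^ l)" unfolding eq by (rule i)
    moreover have "(LINT p:unit_box|lborel. F p ^ l) = (LINT p:unit_box|lborel. ?E p) + 2 * (LINT p:unit_box|lborel. ?A p)
        + (LINT v:{0<..<1}|lborel. worldline K c0 v ^ l)"
      unfolding eq i(2) i(4) i(6) B(2) P(2) by simp
    ultimately show ?thesis using Ele A[THEN conjunct2]
      by (simp add: C_def distrib_right)
  qed
  have "C \<ge> 0" using Ca(1) C3(1) M by (simp add: C_def C2_def c'_def)
  thus thesis using that main by blast
qed

end

section \<open>The generating function of the moments\<close>

context torus_kernel
begin

text \<open>The parameter \<open>e\<close> plays the role of a slope: \<open>gen_coeff N\<close> is a polynomial in \<open>e\<close> whose coefficients are the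
moments of total weight \<open>N\<close> (\<open>gen_coeff_moments\<close>).\<close>

definition gen_coeff :: "nat \<Rightarrow> real \<Rightarrow> real" where
  "gen_coeff N e = (LINT p:half_cylinder|lborel. ((f (fst p) (snd p) - \<rho> * fst p + e * fst p) ^ N
      - (- (\<rho> * fst p) + e * fst p) ^ N)) / fact N"

lemma gen_coeff_expand:
  "(f x y - \<rho> * x + e * x) ^ N - (- (\<rho> * x) + e * x) ^ N =
   (\<Sum>k\<le>N. real (N choose k) * e ^ k * (x ^ k * ((f x y - \<rho> * x) ^ (N - k) - (- (\<rho> * x)) ^ (N - k))))"
proof -
  let ?S = "f x y - \<rho> * x" and ?U = "- (\<rho> * x)"
  have "(?S + e * x) ^ N - (?U + e * x) ^ N = (e * x + ?S) ^ N - (e * x + ?U) ^ N"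
    by (simp only: add.commute)
  also have "\<dots> = (\<Sum>k\<le>N. real (N choose k) * e ^ k * (x ^ k * (?S ^ (N - k) - ?U ^ (N - k))))"
    unfolding binomial_ring sum_subtractf[symmetric] power_mult_distrib
    by (intro sum.cong refl) (simp only: right_diff_distrib mult_ac)
  finally show ?thesis .
qed

lemma gen_coeff_moments:
  "gen_coeff N e = (\<Sum>k\<le>N. real (N choose k) / fact N * moment k (N - k) * e ^ k)"
proof -
  have i: "set_integrable lborel half_cylinder (\<lambda>p. real (N choose k) * e ^ k *
      (fst p ^ k * ((f (fst p) (snd p) - \<rho> * fst p) ^ (N - k) - (- (\<rho> * fst p)) ^ (N - k))))" for k
    by (intro set_integrable_mult_right moment_integrable)
  have "gen_coeff N e = (\<Sum>k\<le>N. real (N choose k) * e ^ k * moment k (N - k)) / fact N"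
    unfolding gen_coeff_def gen_coeff_expand set_integral_sum_fun(2)[OF i] set_integral_mult_right moment_def ..
  thus ?thesis by (simp add: sum_divide_distrib mult_ac)
qed

text \<open>The domination that allows to sum the moments under the integral sign. The bound \<open>t \<le> 1/64\<close> makes the
growth of the exponentials small against the decay of \<open>f\<close>, so that the product stays below \<open>majorant\<close>.\<close>

lemma partial_exp_diff_le:
  assumes t: "0 < t" "t \<le> 1/64" and e: "\<bar>e\<bar> \<le> 1" and x: "x > 0"
  shows "\<bar>\<Sum>N<n. t ^ N / fact N * ((f x y - \<rho> * x + e * x) ^ N - (- (\<rho> * x) + e * x) ^ N)\<bar>
    \<le> 32 * exp (1 / 32) * majorant x"
proof -
  let ?U = "- (\<rho> * x) + e * x"
  define D where "D = 1 + 2 * x + 2 * edge_log x"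
  have l: "edge_log x \<ge> 0" by (rule edge_log_nonneg[OF x])
  have "?U = (e - \<rho>) * x" by (simp add: algebra_simps)
  moreover have "\<bar>e - \<rho>\<bar> \<le> 2" using e slope by linarith
  ultimately have U: "\<bar>?U\<bar> \<le> 2 * x" using x by (simp add: abs_mult)
  have fb: "\<bar>f x y\<bar> \<le> 2 * edge_log x" by (rule kernel_bound[OF x])
  have D: "\<bar>?U\<bar> + \<bar>f x y\<bar> \<le> D" "D \<ge> 1" using U fb l x by (auto simp: D_def)
  have "\<bar>\<Sum>N<n. t ^ N / fact N * ((f x y - \<rho> * x + e * x) ^ N - ?U ^ N)\<bar>
      \<le> (\<Sum>N<n. \<bar>t ^ N / fact N * ((f x y - \<rho> * x + e * x) ^ N - ?U ^ N)\<bar>)"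
    by (rule sum_abs)
  also have "\<dots> \<le> (\<Sum>N<n. \<bar>f x y\<bar> * ((2 * t * D) ^ N / fact N))"
  proof (intro sum_mono)
    fix N
    have "\<bar>(?U + f x y) ^ N - ?U ^ N\<bar> \<le> real N * \<bar>f x y\<bar> * D ^ N"
      by (rule abs_power_diff_le[OF D])
    also have "\<dots> \<le> 2 ^ N * \<bar>f x y\<bar> * D ^ N"
      using D of_nat_less_two_power[of N, where 'a = real] by (intro mult_right_mono) auto
    finally have "t ^ N / fact N * \<bar>(?U + f x y) ^ N - ?U ^ N\<bar> \<le> t ^ N / fact N * (2 ^ N * \<bar>f x y\<bar> * D ^ N)"
      using t by (intro mult_left_mono) auto
    also have "?U + f x y = f x y - \<rho> * x + e * x" by simp
    finally show "\<bar>t ^ N / fact N * ((f x y - \<rho> * x + e * x) ^ N - ?U ^ N)\<bar> \<le> \<bar>f x y\<bar> * ((2 * t * D) ^ N / fact N)"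
      using t by (simp add: abs_mult power_mult_distrib mult_ac)
  qed
  also have "\<dots> = \<bar>f x y\<bar> * (\<Sum>N<n. (2 * t * D) ^ N / fact N)" by (simp add: sum_distrib_left)
  also have "(\<Sum>N<n. (2 * t * D) ^ N / fact N) \<le> exp (2 * t * D)"
  proof -
    have "(\<lambda>N. (2 * t * D) ^ N / fact N) sums exp (2 * t * D)"
      using exp_converges[of "2 * t * D"] by (simp add: field_simps)
    thus ?thesis using t D by (intro sum_le_suminf[of _ "{..<n}", THEN order_trans]) (auto simp: sums_iff)
  qed
  hence "\<bar>f x y\<bar> * (\<Sum>N<n. (2 * t * D) ^ N / fact N) \<le> \<bar>f x y\<bar> * exp (2 * t * D)"
    by (intro mult_left_mono) auto
  also have "\<dots> \<le> (2 * edge_log x) * (exp (1 / 32) * exp ((x + edge_log x) / 16))"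
  proof (intro mult_mono fb)
    have "2 * t * D \<le> 1 / 32 * D" using t D by (intro mult_right_mono) auto
    also have "\<dots> = 1 / 32 + (x + edge_log x) / 16" by (simp add: D_def field_simps)
    finally show "exp (2 * t * D) \<le> exp (1 / 32) * exp ((x + edge_log x) / 16)"
      by (simp flip: exp_add)
  qed (use l in auto)
  also have "\<dots> \<le> (2 * (exp (- x) * (16 * exp (edge_log x / 16)))) * (exp (1 / 32) * exp ((x + edge_log x) / 16))"
  proof (intro mult_right_mono mult_left_mono)
    have "1 + edge_log x \<le> 16 * exp (edge_log x / 16)"
      using exp_ge_add_one_self[of "edge_log x / 16"] l by linarith
    hence "exp (- x) * (1 + edge_log x) \<le> exp (- x) * (16 * exp (edge_log x / 16))"
      by (intro mult_left_mono) auto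
    thus "edge_log x \<le> exp (- x) * (16 * exp (edge_log x / 16))" using edge_log_le_exp[OF x] by linarith
  qed auto
  also have "\<dots> = 32 * exp (1 / 32) * exp (- x + edge_log x / 16 + (x + edge_log x) / 16)"
    by (simp only: exp_add) simp
  also have "\<dots> \<le> 32 * exp (1 / 32) * majorant x"
    using x unfolding majorant_def by (intro mult_left_mono) (auto simp: field_simps)
  finally show ?thesis .
qed

lemma gen_coeff_sums:
  assumes t: "0 < t" "t \<le> 1/64" and e: "\<bar>e\<bar> \<le> 1"
  shows "set_integrable lborel half_cylinder (\<lambda>p. exp (t * (f (fst p) (snd p) - \<rho> * fst p + e * fst p))
           - exp (t * (- (\<rho> * fst p) + e * fst p)))" (is ?I)
    and "(\<lambda>N. gen_coeff N e * t ^ N) sums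
         (LINT p:half_cylinder|lborel. exp (t * (f (fst p) (snd p) - \<rho> * fst p + e * fst p))
           - exp (t * (- (\<rho> * fst p) + e * fst p)))" (is ?S)
proof -
  let ?d = "\<lambda>N p. (f (fst p) (snd p) - \<rho> * fst p + e * fst p) ^ N - (- (\<rho> * fst p) + e * fst p) ^ N"
  let ?g = "\<lambda>p. exp (t * (f (fst p) (snd p) - \<rho> * fst p + e * fst p)) - exp (t * (- (\<rho> * fst p) + e * fst p))"
  let ?s = "\<lambda>n p. indicat_real half_cylinder p *\<^sub>R (\<Sum>N<n. t ^ N / fact N * ?d N p)"
  have di: "set_integrable lborel half_cylinder (?d N)" for N
    unfolding gen_coeff_expand by (intro set_integral_sum_fun(1) set_integrable_mult_right moment_integrable)
  have lim: "(\<lambda>n. \<Sum>N<n. t ^ N / fact N * ?d N p) \<longlonglongrightarrow> ?g p" for p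
  proof -
    have "(\<lambda>N. (t * z) ^ N / fact N) sums exp (t * z)" for z :: real
      using exp_converges[of "t * z"] by (simp add: field_simps)
    from sums_diff[OF this[of "f (fst p) (snd p) - \<rho> * fst p + e * fst p"] this[of "- (\<rho> * fst p) + e * fst p"]]
    have "(\<lambda>N. (t * (f (fst p) (snd p) - \<rho> * fst p + e * fst p)) ^ N / fact N
        - (t * (- (\<rho> * fst p) + e * fst p)) ^ N / fact N) sums ?g p" .
    also have "(\<lambda>N. (t * (f (fst p) (snd p) - \<rho> * fst p + e * fst p)) ^ N / fact N
        - (t * (- (\<rho> * fst p) + e * fst p)) ^ N / fact N) = (\<lambda>N. t ^ N / fact N * ?d N p)"
      by (simp only: power_mult_distrib right_diff_distrib times_divide_eq_left)
    finally show ?thesis unfolding sums_def .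
  qed
  have dom: "AE p in lborel. norm (?s n p) \<le> indicat_real half_cylinder p *\<^sub>R (32 * exp (1 / 32) * majorant (fst p))" for n
  proof (rule AE_I2)
    fix p show "norm (?s n p) \<le> indicat_real half_cylinder p *\<^sub>R (32 * exp (1 / 32) * majorant (fst p))"
      using partial_exp_diff_le[OF t e, of "fst p" "snd p" n] by (cases p) (auto simp: indicator_def)
  qed
  have w: "integrable lborel (\<lambda>p. indicat_real half_cylinder p *\<^sub>R (32 * exp (1 / 32) * majorant (fst p)))"
    unfolding set_integrable_def[symmetric]
    by (intro set_integrable_mult_right set_integrable_strip majorant_integrable) auto
  have l: "AE p in lborel. (\<lambda>n. ?s n p) \<longlonglongrightarrow> indicat_real half_cylinder p *\<^sub>R ?g p"
    by (intro AE_I2 tendsto_scaleR tendsto_const lim)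
  have m1: "(\<lambda>p. indicat_real half_cylinder p *\<^sub>R ?g p) \<in> borel_measurable lborel" by measurable
  have m2: "?s n \<in> borel_measurable lborel" for n by measurable
  note dc = integrable_dominated_convergence[OF m1 m2 w l dom] integral_dominated_convergence[OF m1 m2 w l dom]
  from dc(1) show ?I by (simp only: set_integrable_def)
  have "(LINT p|lborel. ?s n p) = (\<Sum>N<n. gen_coeff N e * t ^ N)" for n
  proof -
    have "(LINT p|lborel. ?s n p) = (LINT p:half_cylinder|lborel. \<Sum>N<n. t ^ N / fact N * ?d N p)"
      by (simp only: set_lebesgue_integral_def)
    also have "\<dots> = (\<Sum>N<n. gen_coeff N e * t ^ N)"
      by (subst set_integral_sum_fun(2), intro set_integrable_mult_right di)
         (simp only: set_integral_mult_right gen_coeff_def times_divide_eq_left times_divide_eq_right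
            set_integral_divide_zero mult.commute)
    finally show ?thesis .
  qed
  with dc(2) show ?S by (simp add: sums_def set_lebesgue_integral_def)
qed

end

section \<open>Power series of products of Gamma functions\<close>

text \<open>The coefficients are zeta values up to sign, because the polygamma functions at \<open>1\<close> are
(\<open>Polygamma_one_zeta\<close>). The constant coefficient is minus the Euler-Mascheroni constant; it will cancel.\<close>

lemma Digamma_fps:
  "(\<lambda>z. Digamma (1 + c * z)) has_fps_expansion Abs_fps (\<lambda>n. c ^ n * (Polygamma n 1 / fact n :: complex))"
proof -
  let ?F = "Abs_fps (\<lambda>n. Polygamma n 1 / fact n :: complex)"
  have "(\<lambda>z. Digamma (1 + z)) analytic_on {0 :: complex}"
    by (auto intro!: analytic_intros)
  hence "(\<lambda>z. Digamma (1 + z)) has_fps_expansion fps_expansion (\<lambda>z. Digamma (1 + z)) (0 :: complex)"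
    by (rule analytic_at_imp_has_fps_expansion_0)
  moreover have "fps_expansion (\<lambda>z. Digamma (1 + z)) (0 :: complex) = ?F"
  proof (rule fps_ext)
    fix n
    have "(deriv ^^ n) (\<lambda>z. Digamma (1 + z)) (0 :: complex) = (deriv ^^ n) Digamma (1 + 0)"
      using higher_deriv_shift_0[of n Digamma "1::complex"] by (simp add: o_def)
    also have "\<dots> = Polygamma n 1" using higher_deriv_Polygamma[of "1::complex" n 0] by simp
    finally show "fps_nth (fps_expansion (\<lambda>z. Digamma (1 + z)) 0) n = fps_nth ?F n"
      by (simp add: fps_expansion_def)
  qed
  ultimately have "(\<lambda>z. Digamma (1 + z)) has_fps_expansion ?F" by simp
  moreover have "(\<lambda>z. c * z) has_fps_expansion fps_const c * fps_X"
    by (intro fps_expansion_intros)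
  ultimately have "((\<lambda>z. Digamma (1 + z)) \<circ> (\<lambda>z. c * z)) has_fps_expansion (?F oo (fps_const c * fps_X))"
    by (intro has_fps_expansion_compose) auto
  thus ?thesis by (simp add: o_def fps_compose_linear)
qed

definition zeta_nat :: "nat \<Rightarrow> real" where
  "zeta_nat k = suminf (\<lambda>m. 1 / real (Suc m) ^ k)"

lemma Polygamma_one_zeta:
  assumes "n \<ge> 1"
  shows "Polygamma n (1 :: complex) / fact n = of_real ((-1) ^ Suc n * zeta_nat (Suc n))"
proof -
  have "Polygamma n (1 :: real) / fact n = (-1) ^ Suc n * suminf (\<lambda>k. inverse ((1 + real k) ^ Suc n))"
    using assms by (simp add: Polygamma_def)
  also have "suminf (\<lambda>k. inverse ((1 + real k) ^ Suc n)) = zeta_nat (Suc n)"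
    by (simp add: zeta_nat_def field_simps del: power_Suc)
  finally have "of_real (Polygamma n (1 :: real) / fact n) = (of_real ((-1) ^ Suc n * zeta_nat (Suc n)) :: complex)"
    by simp
  thus ?thesis using Polygamma_of_real[of 1 n, where 'a = complex] by simp
qed

text \<open>Reading off coefficients from \<open>f' = f D\<close>. This replaces the exponential of a power series in two variables: the
coefficients of \<open>f\<close> are determined by those of \<open>D\<close> through a recurrence with rational weights, to
which \<open>sv\<close> can be applied step by step.\<close>

lemma log_derivative_fps_recurrence:
  fixes F d :: "complex fps" and f D :: "complex \<Rightarrow> complex"
  assumes "f has_fps_expansion F" "D has_fps_expansion d"
    and ev: "eventually (\<lambda>z. (f has_field_derivative f z * D z) (at z)) (nhds 0)"
  shows "of_nat (Suc n) * fps_nth F (Suc n) = (\<Sum>i\<le>n. fps_nth F i * fps_nth d (n - i))"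
proof -
  have 1: "deriv f has_fps_expansion fps_deriv F" by (rule has_fps_expansion_deriv[OF assms(1)])
  have "(\<lambda>z. f z * D z) has_fps_expansion F * d" by (intro fps_expansion_intros assms)
  moreover have "eventually (\<lambda>z. deriv f z = f z * D z) (nhds 0)"
    using ev by eventually_elim (rule DERIV_imp_deriv)
  ultimately have 2: "deriv f has_fps_expansion F * d"
    using has_fps_expansion_cong[OF _ refl, of "deriv f" "\<lambda>z. f z * D z" "F * d"] by simp
  have "fps_deriv F = F * d" by (rule fps_expansion_unique_complex[OF 1 2])
  hence "fps_nth (fps_deriv F) n = fps_nth (F * d) n" by simp
  thus ?thesis by (simp add: fps_mult_nth atMost_atLeast0)
qed

text \<open>The ratios \<open>a / t\<close> and \<open>b / t\<close> as polynomials in the parameter \<open>e\<close>.\<close>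

definition half_plus :: "real poly" where "half_plus = [:1/2, 1:]"
definition half_minus :: "real poly" where "half_minus = [:1/2, -1:]"

definition power_sum_poly :: "nat \<Rightarrow> real poly" where
  "power_sum_poly k = 1 + smult ((-1) ^ k) (half_plus ^ k + half_minus ^ k)"

text \<open>The coefficients of the power series in \<open>t\<close> of the exponential of the sum over \<open>k\<close> of
\<open>c k / k \<cdot> (t\<^bsup>k\<^esup> + (- a)\<^bsup>k\<^esup> + (- b)\<^bsup>k\<^esup>)\<close>, as polynomials in \<open>e\<close>.\<close>

fun exp_series_poly :: "(nat \<Rightarrow> real) \<Rightarrow> nat \<Rightarrow> real poly" where
  "exp_series_poly c 0 = 1"
| "exp_series_poly c (Suc n) = smult (1 / real (Suc n))
     (\<Sum>i\<le>n. exp_series_poly c i * smult (c (Suc (n - i))) (power_sum_poly (Suc (n - i))))"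

lemma poly_half: "poly half_plus e = 1/2 + e" "poly half_minus e = 1/2 - e"
  by (simp_all add: half_plus_def half_minus_def)

lemma exp_series_poly_coeffs:
  fixes F d :: "complex fps"
  assumes "fps_nth F 0 = 1"
    and rec: "\<And>n. of_nat (Suc n) * fps_nth F (Suc n) = (\<Sum>i\<le>n. fps_nth F i * fps_nth d (n - i))"
    and d: "\<And>n. fps_nth d n = of_real (c (Suc n) * poly (power_sum_poly (Suc n)) e)"
  shows "fps_nth F n = of_real (poly (exp_series_poly c n) e)"
proof (induction n rule: less_induct)
  case (less n)
  show ?case
  proof (cases n)
    case 0 thus ?thesis using assms(1) by simp
  next
    case (Suc m)
    have "of_nat (Suc m) * fps_nth F (Suc m) = (\<Sum>i\<le>m. of_real (poly (exp_series_poly c i) e) *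
        of_real (c (Suc (m - i)) * poly (power_sum_poly (Suc (m - i))) e))"
      unfolding rec by (intro sum.cong refl arg_cong2[of _ _ _ _ "(*)"] less.IH d) (auto simp: Suc)
    also have "\<dots> = of_nat (Suc m) * (of_real (poly (exp_series_poly c (Suc m)) e) :: complex)"
      by (simp add: poly_sum mult_ac del: of_nat_Suc)
    finally show ?thesis unfolding Suc by (simp del: of_nat_Suc exp_series_poly.simps)
  qed
qed

definition gamma_triple :: "real \<Rightarrow> complex \<Rightarrow> complex" where
  "gamma_triple e z = Gamma (1 + of_real (1/2 + e) * z) * Gamma (1 + of_real (1/2 - e) * z) * Gamma (1 - z)"

definition digamma_triple :: "real \<Rightarrow> complex \<Rightarrow> complex" where
  "digamma_triple e z = of_real (1/2 + e) * Digamma (1 + of_real (1/2 + e) * z)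
     + of_real (1/2 - e) * Digamma (1 + of_real (1/2 - e) * z) - Digamma (1 + (-1) * z)"

lemma eventually_no_pole:
  "eventually (\<lambda>z. 1 + c * z \<notin> (\<int>\<^sub>\<le>\<^sub>0 :: complex set)) (nhds 0)"
proof -
  have "((\<lambda>z. 1 + c * z) \<longlongrightarrow> 1 + c * 0) (nhds 0)" by (intro tendsto_intros filterlim_ident)
  moreover have "open (- \<int>\<^sub>\<le>\<^sub>0 :: complex set)" by (simp add: open_Compl)
  ultimately have "eventually (\<lambda>z. 1 + c * z \<in> - \<int>\<^sub>\<le>\<^sub>0) (nhds 0)"
    by (intro topological_tendstoD) auto
  thus ?thesis by simp
qed

lemma gamma_triple_deriv:
  "eventually (\<lambda>z. gamma_triple e z \<noteq> 0 \<and>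
     (gamma_triple e has_field_derivative gamma_triple e z * digamma_triple e z) (at z)) (nhds 0)"
  using eventually_no_pole[of "of_real (1/2 + e)"] eventually_no_pole[of "of_real (1/2 - e)"] eventually_no_pole[of "-1"]
proof eventually_elim
  case (elim z)
  thus ?case unfolding gamma_triple_def[abs_def] digamma_triple_def
    by (auto intro!: derivative_eq_intros simp: Gamma_eq_zero_iff algebra_simps)
qed

text \<open>At \<open>n = 0\<close> the three Euler-Mascheroni constants cancel, because \<open>a + b = t\<close>.\<close>

definition digamma_coeff :: "real \<Rightarrow> nat \<Rightarrow> complex" where
  "digamma_coeff e n = of_real (if n = 0 then 0 else zeta_nat (Suc n) * poly (power_sum_poly (Suc n)) e)"

lemma digamma_triple_fps: "digamma_triple e has_fps_expansion Abs_fps (digamma_coeff e)"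
proof -
  let ?a = "of_real (1/2 + e) :: complex" and ?b = "of_real (1/2 - e) :: complex"
  let ?F = "\<lambda>c. Abs_fps (\<lambda>n. c ^ n * (Polygamma n 1 / fact n :: complex))"
  have "digamma_triple e has_fps_expansion fps_const ?a * ?F ?a + fps_const ?b * ?F ?b - ?F (- 1)"
    unfolding digamma_triple_def[abs_def] by (intro fps_expansion_intros Digamma_fps)
  also have "fps_const ?a * ?F ?a + fps_const ?b * ?F ?b - ?F (- 1) = Abs_fps (digamma_coeff e)"
  proof (rule fps_ext)
    fix n
    have "fps_nth (fps_const ?a * ?F ?a + fps_const ?b * ?F ?b - ?F (- 1)) n =
        (?a ^ Suc n + ?b ^ Suc n - (-1) ^ n) * (Polygamma n 1 / fact n)"
      by (simp add: algebra_simps add_divide_distrib diff_divide_distrib)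
    also have "\<dots> = digamma_coeff e n"
    proof (cases "n = 0")
      case True
      have "?a + ?b = of_real ((1/2 + e) + (1/2 - e))" by (simp only: of_real_add)
      hence "?a + ?b = 1" by simp
      thus ?thesis using True by (simp add: digamma_coeff_def)
    next
      case False
      have sq: "(-1) ^ n * (-1) ^ n = (1 :: complex)" by (simp flip: power_mult_distrib)
      have n1: "1 \<le> n" using False by simp
      show ?thesis using False unfolding Polygamma_one_zeta[OF n1]
        by (simp add: digamma_coeff_def power_sum_poly_def poly_half poly_power algebra_simps sq)
    qed
    finally show "fps_nth (fps_const ?a * ?F ?a + fps_const ?b * ?F ?b - ?F (- 1)) n = fps_nth (Abs_fps (digamma_coeff e)) n"
      by simp
  qed
  finally show ?thesis .
qed

text \<open>The value \<open>0\<close> at \<open>k = 1\<close> replaces a divergent zeta series; it stands in front of \<open>power_sum_poly 1 = 0\<close>.\<close>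

definition open_weight :: "nat \<Rightarrow> real" where
  "open_weight k = (if k \<le> 1 then 0 else zeta_nat k)"

definition closed_weight :: "nat \<Rightarrow> real" where
  "closed_weight k = (if odd k \<and> k > 1 then 2 * zeta_nat k else 0)"

lemma gamma_triple_fps:
  "gamma_triple e has_fps_expansion Abs_fps (\<lambda>n. of_real (poly (exp_series_poly open_weight n) e))"
proof -
  have "gamma_triple e analytic_on {0}"
    unfolding gamma_triple_def[abs_def] by (auto intro!: analytic_intros)
  hence F: "gamma_triple e has_fps_expansion fps_expansion (gamma_triple e) 0" (is "_ has_fps_expansion ?F")
    by (rule analytic_at_imp_has_fps_expansion_0)
  have "fps_nth ?F n = of_real (poly (exp_series_poly open_weight n) e)" for n
  proof (rule exp_series_poly_coeffs[where d = "Abs_fps (digamma_coeff e)"])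
    show "fps_nth ?F 0 = 1"
      using has_fps_expansion_imp_0_eq_fps_nth_0[OF F] by (simp add: gamma_triple_def)
    show "of_nat (Suc n) * fps_nth ?F (Suc n) = (\<Sum>i\<le>n. fps_nth ?F i * fps_nth (Abs_fps (digamma_coeff e)) (n - i))" for n
      by (rule log_derivative_fps_recurrence[OF F digamma_triple_fps])
         (use gamma_triple_deriv in \<open>rule eventually_mono\<close>, blast)
  qed (auto simp: digamma_coeff_def open_weight_def)
  hence "?F = Abs_fps (\<lambda>n. of_real (poly (exp_series_poly open_weight n) e))" by (simp add: fps_eq_iff)
  with F show ?thesis by simp
qed

definition gamma_ratio :: "real \<Rightarrow> complex \<Rightarrow> complex" where
  "gamma_ratio e z = gamma_triple e z / gamma_triple e (- z)"

text \<open>Replacing \<open>t\<close> by \<open>- t\<close> in the logarithmic derivative and adding doubles its even coefficients, which carry the odd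
zeta values, and cancels the others. This is the effect of the single-valued map.\<close>

lemma gamma_ratio_fps:
  "gamma_ratio e has_fps_expansion Abs_fps (\<lambda>n. of_real (poly (exp_series_poly closed_weight n) e))"
proof -
  have "gamma_triple e analytic_on {0}" "(\<lambda>z. gamma_triple e (- z)) analytic_on {0}"
    unfolding gamma_triple_def[abs_def] by (auto intro!: analytic_intros)
  hence "gamma_ratio e analytic_on {0}"
    unfolding gamma_ratio_def[abs_def] by (auto intro!: analytic_intros simp: gamma_triple_def)
  hence F: "gamma_ratio e has_fps_expansion fps_expansion (gamma_ratio e) 0" (is "_ has_fps_expansion ?F")
    by (rule analytic_at_imp_has_fps_expansion_0)
  let ?d = "Abs_fps (digamma_coeff e) + Abs_fps (\<lambda>n. (-1) ^ n * digamma_coeff e n)"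
  have "(\<lambda>z::complex. (-1) * z) has_fps_expansion fps_const (-1) * fps_X"
    by (intro fps_expansion_intros)
  hence "(digamma_triple e \<circ> (\<lambda>z. (-1) * z)) has_fps_expansion (Abs_fps (digamma_coeff e) oo (fps_const (-1) * fps_X))"
    by (intro has_fps_expansion_compose digamma_triple_fps) auto
  hence "(\<lambda>z. digamma_triple e (- z)) has_fps_expansion Abs_fps (\<lambda>n. (-1) ^ n * digamma_coeff e n)"
    by (simp add: o_def fps_compose_linear del: fps_const_neg)
  from has_fps_expansion_add[OF digamma_triple_fps this]
  have D: "(\<lambda>z. digamma_triple e z + digamma_triple e (- z)) has_fps_expansion ?d" .
  have "filterlim uminus (nhds 0) (nhds (0::complex))"
    using tendsto_minus[OF filterlim_ident, of "0::complex"] by simp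
  from eventually_compose_filterlim[OF gamma_triple_deriv this]
  have neg: "eventually (\<lambda>z. gamma_triple e (- z) \<noteq> 0 \<and>
     (gamma_triple e has_field_derivative gamma_triple e (- z) * digamma_triple e (- z)) (at (- z))) (nhds 0)" .
  have deriv: "eventually (\<lambda>z. (gamma_ratio e has_field_derivative
      gamma_ratio e z * (digamma_triple e z + digamma_triple e (- z))) (at z)) (nhds 0)"
    using gamma_triple_deriv[of e] neg
  proof eventually_elim
    case (elim z)
    have "((\<lambda>w. gamma_triple e (- w)) has_field_derivative
        gamma_triple e (- z) * digamma_triple e (- z) * (-1)) (at z)"
      by (rule DERIV_chain2[of "gamma_triple e"]) (use elim in \<open>auto intro!: derivative_eq_intros\<close>)
    with elim show ?case unfolding gamma_ratio_def[abs_def]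
      by (auto intro!: derivative_eq_intros simp: field_simps)
  qed
  have "fps_nth ?F n = of_real (poly (exp_series_poly closed_weight n) e)" for n
  proof (rule exp_series_poly_coeffs[where d = ?d])
    show "fps_nth ?F 0 = 1"
      using has_fps_expansion_imp_0_eq_fps_nth_0[OF F] by (simp add: gamma_triple_def gamma_ratio_def)
    show "of_nat (Suc n) * fps_nth ?F (Suc n) = (\<Sum>i\<le>n. fps_nth ?F i * fps_nth ?d (n - i))" for n
      by (rule log_derivative_fps_recurrence[OF F D deriv])
    show "fps_nth ?d n = of_real (closed_weight (Suc n) * poly (power_sum_poly (Suc n)) e)" for n
      by (cases "even n") (auto simp: digamma_coeff_def closed_weight_def)
  qed
  hence "?F = Abs_fps (\<lambda>n. of_real (poly (exp_series_poly closed_weight n) e))" by (simp add: fps_eq_iff)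
  with F show ?thesis by simp
qed

text \<open>The coefficients of \<open>(sin (\<pi> a) + sin (\<pi> b)) / \<pi>\<close>.\<close>

definition sine_poly :: "nat \<Rightarrow> real poly" where
  "sine_poly n = (if even n then 0
     else smult ((-1) ^ (n div 2) * pi ^ (n - 1) / fact n) (half_plus ^ n + half_minus ^ n))"

definition open_series_poly :: "nat \<Rightarrow> real poly" where
  "open_series_poly n = (\<Sum>i\<le>n. exp_series_poly open_weight i * sine_poly (n - i))"

lemma open_series_fps:
  "(\<lambda>z. gamma_triple e z * ((sin (of_real (pi * (1/2 + e)) * z) + sin (of_real (pi * (1/2 - e)) * z)) / of_real pi))
     has_fps_expansion Abs_fps (\<lambda>n. of_real (poly (open_series_poly n) e))"
proof -
  let ?s = "fps_sin (of_real (pi * (1/2 + e))) + fps_sin (of_real (pi * (1/2 - e)) :: complex)"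
  let ?E = "Abs_fps (\<lambda>n. of_real (poly (exp_series_poly open_weight n) e) :: complex)"
  let ?S = "Abs_fps (\<lambda>n. of_real (poly (sine_poly n) e) :: complex)"
  have "(\<lambda>z. (sin (of_real (pi * (1/2 + e)) * z) + sin (of_real (pi * (1/2 - e)) * z)) * of_real (1 / pi))
     has_fps_expansion ?s * fps_const (of_real (1 / pi) :: complex)"
    by (intro fps_expansion_intros)
  also have "?s * fps_const (of_real (1 / pi)) = ?S"
  proof (rule fps_ext)
    fix n
    show "fps_nth (?s * fps_const (of_real (1 / pi))) n = fps_nth ?S n"
    proof (cases "even n")
      case False
      then obtain k where n: "n = Suc (2 * k)" by (auto elim: oddE)
      define a b where "a = 1/2 + e" and "b = 1/2 - e"
      have "fps_nth ((fps_sin (of_real (pi * a)) + fps_sin (of_real (pi * b))) * fps_const (of_real (1 / pi) :: complex)) n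
          = of_real (((-1) ^ k * (pi * a) ^ n / fact n + (-1) ^ k * (pi * b) ^ n / fact n) * (1 / pi))"
        by (simp add: n fps_sin_def del: fact_Suc power_Suc)
      also have "((-1) ^ k * (pi * a) ^ n / fact n + (-1) ^ k * (pi * b) ^ n / fact n) * (1 / pi)
          = (-1) ^ k * pi ^ (n - 1) / fact n * (a ^ n + b ^ n)"
        unfolding power_mult_distrib by (simp add: n field_simps del: fact_Suc)
      finally show ?thesis
        by (simp add: n sine_poly_def poly_half poly_power a_def b_def)
    qed (auto simp: fps_sin_def sine_poly_def)
  qed
  finally have "(\<lambda>z. gamma_triple e z * ((sin (of_real (pi * (1/2 + e)) * z) + sin (of_real (pi * (1/2 - e)) * z)) * of_real (1 / pi)))
     has_fps_expansion ?E * ?S" by (intro has_fps_expansion_mult gamma_triple_fps)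
  also have "?E * ?S = Abs_fps (\<lambda>n. of_real (poly (open_series_poly n) e))"
    by (rule fps_ext) (simp add: fps_mult_nth open_series_poly_def poly_sum atMost_atLeast0)
  finally show ?thesis by (simp add: field_simps)
qed

lemma has_fps_expansion_real_sums:
  fixes f :: "complex \<Rightarrow> complex"
  assumes "f has_fps_expansion Abs_fps (\<lambda>n. of_real (c n))"
    and real: "\<And>t. t > 0 \<Longrightarrow> t < 1 \<Longrightarrow> f (of_real t) = of_real (g t)"
  obtains r :: real where "0 < r" "\<And>t. 0 < t \<Longrightarrow> t < r \<Longrightarrow> (\<lambda>n. c n * t ^ n) sums g t"
proof -
  let ?F = "Abs_fps (\<lambda>n. of_real (c n) :: complex)"
  from assms(1) have R: "fps_conv_radius ?F > 0" and ev: "eventually (\<lambda>z. eval_fps ?F z = f z) (nhds 0)"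
    by (auto simp: has_fps_expansion_def)
  from ev obtain d where d: "d > 0" "\<And>z. dist z 0 < d \<Longrightarrow> eval_fps ?F z = f z"
    unfolding eventually_nhds_metric by blast
  obtain R' :: real where R': "R' > 0" "ereal R' < fps_conv_radius ?F"
    using R ereal_dense2[of 0 "fps_conv_radius ?F"] by (auto simp: zero_ereal_def)
  have "(\<lambda>n. c n * t ^ n) sums g t" if t: "0 < t" "t < min 1 (min d R')" for t
  proof -
    have "ereal (norm (of_real t :: complex)) < fps_conv_radius ?F"
      using R'(2) t by (simp add: less_trans[of "ereal t" "ereal R'"])
    hence "(\<lambda>n. fps_nth ?F n * of_real t ^ n) sums eval_fps ?F (of_real t)" by (rule sums_eval_fps)
    also have "eval_fps ?F (of_real t) = of_real (g t)" using d(2)[of "of_real t"] real[of t] t by simp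
    finally have "(\<lambda>n. of_real (c n * t ^ n) :: complex) sums of_real (g t)" by simp
    thus ?thesis by (simp only: sums_of_real_iff)
  qed
  thus thesis using that[of "min 1 (min d R')"] d(1) R'(1) by auto
qed

section \<open>The single-valued map on power series coefficients\<close>

lemma mzv_single: "mzv [k] = suminf (\<lambda>m. 1 / real (Suc m) ^ k)" if k: "k \<ge> 2"
proof -
  have "mzv [k] = (\<Sum>\<^sub>\<infinity>ns\<in>{ns. length ns = 1 \<and> sorted_wrt (<) ns \<and> (\<forall>n\<in>set ns. 0 < n)}. 1 / real (ns ! 0) ^ k)"
    by (simp add: mzv_def)
  also have "\<dots> = (\<Sum>\<^sub>\<infinity>m\<in>UNIV. 1 / real (Suc m) ^ k)"
  proof (rule infsum_reindex_bij_betw[symmetric, where g = "\<lambda>m. [Suc m]" and f = "\<lambda>ns. 1 / real (ns ! 0) ^ k", simplified nth_Cons_0])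
    show "bij_betw (\<lambda>m. [Suc m]) UNIV {ns. length ns = 1 \<and> sorted_wrt (<) ns \<and> (\<forall>n\<in>set ns. 0 < n)}"
    proof (rule bij_betw_imageI)
      show "range (\<lambda>m. [Suc m]) = {ns. length ns = 1 \<and> sorted_wrt (<) ns \<and> (\<forall>n\<in>set ns. 0 < n)}"
      proof (intro set_eqI iffI)
        fix ns :: "nat list" assume "ns \<in> {ns. length ns = 1 \<and> sorted_wrt (<) ns \<and> (\<forall>n\<in>set ns. 0 < n)}"
        then obtain n where "ns = [n]" "n > 0" by (auto simp: length_Suc_conv)
        thus "ns \<in> range (\<lambda>m. [Suc m])" by (auto simp: image_iff intro!: exI[of _ "n - 1"])
      qed auto
    qed (auto simp: inj_on_def)
  qed
  also have "\<dots> = suminf (\<lambda>m. 1 / real (Suc m) ^ k)"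
  proof -
    have "summable (\<lambda>m. 1 / real (Suc m) ^ k)"
      using inverse_power_summable[OF k, where 'a = real] summable_Suc_iff[of "\<lambda>n. inverse (real n ^ k)"]
      by (simp add: field_simps)
    hence "((\<lambda>m. 1 / real (Suc m) ^ k) has_sum suminf (\<lambda>m. 1 / real (Suc m) ^ k)) UNIV"
      by (intro norm_summable_imp_has_sum summable_sums) auto
    thus ?thesis by (rule infsumI)
  qed
  finally show ?thesis .
qed

lemma zeta_nat_eq_mzv: "k \<ge> 2 \<Longrightarrow> zeta_nat k = mzv [k]"
  by (simp add: mzv_single zeta_nat_def)

lemma zeta_nat_2: "zeta_nat 2 = pi\<^sup>2 / 6"
  using inverse_squares_sums unfolding zeta_nat_def sums_iff by (simp add: add.commute)

context
  fixes sv :: "real \<Rightarrow> real"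
  assumes sv: "single_valued_projection sv"
begin

text \<open>Membership in the algebra is part of the relation, since \<open>sv\<close> is only constrained there. Stated as
a relation, compatibility with sums and products can be used as introduction rules.\<close>

definition sv_maps :: "real \<Rightarrow> real \<Rightarrow> bool" where
  "sv_maps x y \<longleftrightarrow> x \<in> mzv_algebra \<and> sv x = y"

lemma sv_maps_rat: "sv_maps (of_rat r) (of_rat r)"
proof -
  have 1: "1 \<in> mzv_algebra" using mzv_algebra.rat[of 1] by simp
  have "sv (of_rat r * 1) = of_rat r * sv 1" using sv 1 unfolding single_valued_projection_def by blast
  moreover have "sv 1 = 1" using sv unfolding single_valued_projection_def by blast
  ultimately show ?thesis by (simp add: sv_maps_def mzv_algebra.rat)
qed

lemma sv_maps_Rats: "x \<in> \<rat> \<Longrightarrow> sv_maps x x"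
  using sv_maps_rat by (auto elim!: Rats_cases)

lemma sv_maps_add: "sv_maps x y \<Longrightarrow> sv_maps x' y' \<Longrightarrow> sv_maps (x + x') (y + y')"
  using sv unfolding single_valued_projection_def sv_maps_def by (auto intro: mzv_algebra.add)

lemma sv_maps_mult: "sv_maps x y \<Longrightarrow> sv_maps x' y' \<Longrightarrow> sv_maps (x * x') (y * y')"
  using sv unfolding single_valued_projection_def sv_maps_def by (auto intro: mzv_algebra.mult)

lemma sv_maps_0: "sv_maps 0 0" and sv_maps_1: "sv_maps 1 1"
  by (auto intro: sv_maps_Rats)

lemma sv_maps_sum: "(\<And>i. i \<in> I \<Longrightarrow> sv_maps (x i) (y i)) \<Longrightarrow> sv_maps (sum x I) (sum y I)"
  by (induction I rule: infinite_finite_induct) (auto intro: sv_maps_0 sv_maps_add)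

lemma sv_maps_power: "sv_maps x y \<Longrightarrow> sv_maps (x ^ n) (y ^ n)"
  by (induction n) (auto intro: sv_maps_1 sv_maps_mult)

lemma sv_maps_cmult: "c \<in> \<rat> \<Longrightarrow> sv_maps x y \<Longrightarrow> sv_maps (c * x) (c * y)"
  by (intro sv_maps_mult sv_maps_Rats)

lemma sv_maps_zeta:
  assumes "k \<ge> 2"
  shows "sv_maps (zeta_nat k) (if odd k then 2 * zeta_nat k else 0)"
proof -
  have "mzv [k] \<in> mzv_algebra" using assms by (intro mzv_algebra.mzv) (auto simp: admissible_def)
  moreover have "sv (mzv [k]) = (if odd k then 2 * mzv [k] else 0)"
  proof (cases "odd k")
    case True
    then obtain j where "k = 2 * j + 1" by (elim oddE)
    with assms sv True show ?thesis unfolding single_valued_projection_def by (cases j) auto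
  next
    case False
    then obtain j where "k = 2 * j" by (auto elim: evenE)
    with assms sv False show ?thesis unfolding single_valued_projection_def by (cases j) auto
  qed
  ultimately show ?thesis using assms by (simp add: sv_maps_def zeta_nat_eq_mzv)
qed

lemma sv_maps_weight: "sv_maps (open_weight k) (closed_weight k)"
  using sv_maps_zeta[of k] by (auto simp: open_weight_def closed_weight_def sv_maps_0)

text \<open>\<open>\<pi>\<^sup>2\<close> is \<open>6 \<zeta>(2)\<close>.\<close>

lemma sv_maps_pi_power: "sv_maps (pi ^ (2 * j)) (if j = 0 then 1 else 0)"
proof -
  have "sv_maps (6 * zeta_nat 2) (6 * (if odd (2::nat) then 2 * zeta_nat 2 else 0))"
    by (intro sv_maps_cmult sv_maps_zeta) auto
  hence "sv_maps (pi\<^sup>2) 0" by (simp add: zeta_nat_2)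
  from sv_maps_power[OF this, of j] show ?thesis
    by (cases "j = 0") (auto simp: power_mult sv_maps_1 zero_power)
qed

definition sv_maps_poly :: "real poly \<Rightarrow> real poly \<Rightarrow> bool" where
  "sv_maps_poly p q \<longleftrightarrow> (\<forall>i. sv_maps (coeff p i) (coeff q i))"

lemma sv_maps_poly_add: "sv_maps_poly p q \<Longrightarrow> sv_maps_poly p' q' \<Longrightarrow> sv_maps_poly (p + p') (q + q')"
  by (auto simp: sv_maps_poly_def intro: sv_maps_add)

lemma sv_maps_poly_mult: "sv_maps_poly p q \<Longrightarrow> sv_maps_poly p' q' \<Longrightarrow> sv_maps_poly (p * p') (q * q')"
  by (auto simp: sv_maps_poly_def coeff_mult intro!: sv_maps_sum sv_maps_mult)

lemma sv_maps_poly_smult: "sv_maps c d \<Longrightarrow> sv_maps_poly p q \<Longrightarrow> sv_maps_poly (smult c p) (smult d q)"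
  by (auto simp: sv_maps_poly_def intro!: sv_maps_mult)

lemma sv_maps_poly_rat: "(\<And>i. coeff p i \<in> \<rat>) \<Longrightarrow> sv_maps_poly p p"
  by (auto simp: sv_maps_poly_def intro!: sv_maps_Rats)

lemma sv_maps_poly_0: "sv_maps_poly 0 0" and sv_maps_poly_1: "sv_maps_poly 1 1"
  by (auto intro!: sv_maps_poly_rat simp: one_pCons coeff_pCons split: nat.splits)

lemma sv_maps_poly_sum:
  "(\<And>i. i \<in> I \<Longrightarrow> sv_maps_poly (p i) (q i)) \<Longrightarrow> sv_maps_poly (sum p I) (sum q I)"
  by (induction I rule: infinite_finite_induct) (auto intro: sv_maps_poly_0 sv_maps_poly_add)

lemma sv_maps_poly_power: "sv_maps_poly p q \<Longrightarrow> sv_maps_poly (p ^ n) (q ^ n)"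
  by (induction n) (auto intro: sv_maps_poly_1 sv_maps_poly_mult)

lemma sv_maps_poly_half: "sv_maps_poly half_plus half_plus" "sv_maps_poly half_minus half_minus"
  by (auto intro!: sv_maps_poly_rat simp: half_plus_def half_minus_def coeff_pCons split: nat.splits)

lemma sv_maps_power_sum_poly: "sv_maps_poly (power_sum_poly k) (power_sum_poly k)"
  unfolding power_sum_poly_def
  by (intro sv_maps_poly_add sv_maps_poly_1 sv_maps_poly_smult sv_maps_poly_power sv_maps_poly_half sv_maps_Rats) auto

lemma sv_maps_exp_series:
  "sv_maps_poly (exp_series_poly open_weight n) (exp_series_poly closed_weight n)"
proof (induction n rule: less_induct)
  case (less n)
  show ?case
  proof (cases n)
    case 0 thus ?thesis by (simp add: sv_maps_poly_1)
  next
    case (Suc m)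
    show ?thesis unfolding Suc exp_series_poly.simps
      by (intro sv_maps_poly_smult sv_maps_poly_sum sv_maps_poly_mult less.IH sv_maps_weight
          sv_maps_power_sum_poly sv_maps_Rats) (auto simp: Suc)
  qed
qed

lemma sv_maps_sine_poly: "sv_maps_poly (sine_poly n) (if n = 1 then 1 else 0)"
proof (cases "even n")
  case True thus ?thesis by (auto simp: sine_poly_def sv_maps_poly_0)
next
  case False
  then obtain j where n: "n = 2 * j + 1" by (elim oddE)
  have "(-1) ^ j / fact n \<in> (\<rat> :: real set)"
    by (subst of_nat_fact[symmetric]) (intro Rats_divide Rats_power Rats_of_nat, simp)
  hence "sv_maps ((-1) ^ j / fact n * pi ^ (2 * j)) ((-1) ^ j / fact n * (if j = 0 then 1 else 0))"
    by (intro sv_maps_cmult sv_maps_pi_power)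
  hence "sv_maps_poly (smult ((-1) ^ j / fact n * pi ^ (2 * j)) (half_plus ^ n + half_minus ^ n))
     (smult ((-1) ^ j / fact n * (if j = 0 then 1 else 0)) (half_plus ^ n + half_minus ^ n))"
    by (intro sv_maps_poly_smult sv_maps_poly_add sv_maps_poly_power sv_maps_poly_half)
  also have "smult ((-1) ^ j / fact n * pi ^ (2 * j)) (half_plus ^ n + half_minus ^ n) = sine_poly n"
    by (simp add: sine_poly_def n)
  also have "smult ((-1) ^ j / fact n * (if j = 0 then 1 else 0)) (half_plus ^ n + half_minus ^ n)
      = (if n = 1 then 1 else 0)"
    by (auto simp: n half_plus_def half_minus_def one_pCons)
  finally show ?thesis .
qed

text \<open>Under \<open>sv\<close> the sine factor becomes \<open>t\<close>, whence the shift of the index by one.\<close>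

lemma sv_maps_open_series: "sv_maps_poly (open_series_poly (Suc n)) (exp_series_poly closed_weight n)"
proof -
  have "sv_maps_poly (open_series_poly (Suc n))
     (\<Sum>i\<le>Suc n. exp_series_poly closed_weight i * (if Suc n - i = 1 then 1 else 0))"
    unfolding open_series_poly_def
    by (intro sv_maps_poly_sum sv_maps_poly_mult sv_maps_exp_series sv_maps_sine_poly)
  also have "(\<Sum>i\<le>Suc n. exp_series_poly closed_weight i * (if Suc n - i = 1 then 1 else 0)) =
      (\<Sum>i\<in>{n}. exp_series_poly closed_weight i * (if Suc n - i = 1 then 1 else 0))"
    by (intro sum.mono_neutral_right) auto
  finally show ?thesis by simp
qed

text \<open>Division by \<open>1/4 - e\<^sup>2\<close> is possible without leaving the algebra: the coefficients of the quotient follow from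
those of the product by a recurrence over the rational numbers.\<close>

lemma sv_maps_poly_cancel:
  assumes "sv_maps_poly ([:1/4, 0, -1:] * p) ([:1/4, 0, -1:] * q)"
  shows "sv_maps_poly p q"
proof -
  have rec: "coeff r i = 4 * (coeff ([:1/4, 0, -1:] * r) i + (if i < 2 then 0 else coeff r (i - 2)))"
    for r :: "real poly" and i
    by (cases i; cases "i - 1") (auto simp: coeff_pCons)
  have "sv_maps (coeff p i) (coeff q i)" for i
  proof (induction i rule: less_induct)
    case (less i)
    have "sv_maps (4 * (coeff ([:1/4, 0, -1:] * p) i + (if i < 2 then 0 else coeff p (i - 2))))
      (4 * (coeff ([:1/4, 0, -1:] * q) i + (if i < 2 then 0 else coeff q (i - 2))))"
      using assms less.IH by (intro sv_maps_cmult sv_maps_add) (auto simp: sv_maps_poly_def sv_maps_0)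
    thus ?case by (simp only: rec[symmetric])
  qed
  thus ?thesis by (simp add: sv_maps_poly_def)
qed

text \<open>Identities for real numbers \<open>e\<close> become identities of polynomials, to which \<open>sv\<close> can be applied
coefficientwise. It could not be applied to the values at \<open>e\<close>.\<close>

lemma sv_maps_coefficients:
  fixes c c' :: "nat \<Rightarrow> real"
  assumes c: "\<And>e. 0 < e \<Longrightarrow> e < 1/2 \<Longrightarrow> (1/4 - e\<^sup>2) * (\<Sum>k\<le>N. c k * e ^ k) = poly (open_series_poly (Suc n)) e"
    and c': "\<And>e. 0 < e \<Longrightarrow> e < 1/2 \<Longrightarrow> (1/4 - e\<^sup>2) * (\<Sum>k\<le>N. c' k * e ^ k) = poly (exp_series_poly closed_weight n) e"
    and k: "k \<le> N"
  shows "sv_maps (c k) (c' k)"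
proof -
  define p where "p = (\<lambda>c::nat \<Rightarrow> real. \<Sum>k\<le>N. monom (c k) k)"
  have poly_p: "poly ([:1/4, 0, -1:] * p c) e = (1/4 - e\<^sup>2) * (\<Sum>k\<le>N. c k * e ^ k)" for c e
    by (simp add: p_def poly_sum poly_monom power2_eq_square algebra_simps)
  have eq: "[:1/4, 0, -1:] * p c = q"
    if "\<And>e. 0 < e \<Longrightarrow> e < 1/2 \<Longrightarrow> (1/4 - e\<^sup>2) * (\<Sum>k\<le>N. c k * e ^ k) = poly q e" for c q
  proof (rule ccontr)
    assume "[:1/4, 0, -1:] * p c \<noteq> q"
    hence "finite {e. poly ([:1/4, 0, -1:] * p c - q) e = 0}" by (intro poly_roots_finite) simp
    moreover have "{0<..<1/2} \<subseteq> {e. poly ([:1/4, 0, -1:] * p c - q) e = 0}"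
      using that unfolding poly_diff poly_p by auto
    ultimately have "finite {0<..<1/2::real}" by (rule finite_subset[rotated])
    thus False by (simp add: infinite_Ioo)
  qed
  have "sv_maps_poly ([:1/4, 0, -1:] * p c) ([:1/4, 0, -1:] * p c')"
  proof -
    have "[:1/4, 0, -1:] * p c = open_series_poly (Suc n)" by (rule eq) (rule c)
    moreover have "[:1/4, 0, -1:] * p c' = exp_series_poly closed_weight n" by (rule eq) (rule c')
    ultimately show ?thesis using sv_maps_open_series by simp
  qed
  hence "sv_maps (coeff (p c) k) (coeff (p c') k)"
    using sv_maps_poly_cancel by (auto simp: sv_maps_poly_def)
  thus ?thesis using k by (simp add: p_def coeff_sum)
qed

end

section \<open>The closed kernel and its circle averages\<close>

text \<open>The generating functions are known only for small positive \<open>t\<close>, but zeros of a power series do not accumulate at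
the origin from one side either.\<close>

lemma power_series_unique_right:
  fixes c d :: "nat \<Rightarrow> real"
  assumes r: "r > 0"
    and c: "\<And>t. 0 < t \<Longrightarrow> t < r \<Longrightarrow> (\<lambda>n. c n * t ^ n) sums g t"
    and d: "\<And>t. 0 < t \<Longrightarrow> t < r \<Longrightarrow> (\<lambda>n. d n * t ^ n) sums g t"
  shows "c = d"
proof (rule ccontr)
  assume "c \<noteq> d"
  then obtain m where m: "c m \<noteq> d m" by auto
  \<comment> \<open>the difference series is multiplied by \<open>t\<close>, so that it vanishes at \<open>0\<close>\<close>
  define a where "a = (\<lambda>n. if n = 0 then 0 else c (n - 1) - d (n - 1))"
  have zero: "(\<lambda>n. a n * t ^ n) sums 0" if t: "0 < t" "t < r" for t
  proof -
    have "(\<lambda>n. (c n * t ^ n - d n * t ^ n) * t) sums ((g t - g t) * t)"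
      by (intro sums_mult2 sums_diff c d t)
    hence "(\<lambda>n. a (Suc n) * t ^ Suc n) sums 0"
      by (simp add: a_def algebra_simps)
    thus ?thesis by (subst (asm) sums_Suc_iff) (simp add: a_def)
  qed
  define f where "f = (\<lambda>x. suminf (\<lambda>n. a n * x ^ n))"
  have sm: "(\<lambda>n. a n * (x - 0) ^ n) sums f x" if x: "norm (x - 0) < r / 2" for x
  proof -
    have "summable (\<lambda>n. a n * (r / 2) ^ n)" using zero[of "r / 2"] r by (simp add: sums_iff)
    hence "summable (\<lambda>n. a n * x ^ n)" by (rule powser_inside) (use x r in auto)
    thus ?thesis by (simp add: f_def summable_sums)
  qed
  have "f 0 = 0" using powser_zero[of a] by (simp add: f_def a_def)
  moreover have "a (Suc m) \<noteq> 0" using m by (simp add: a_def)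
  ultimately obtain s where s: "0 < s" "\<And>z. z \<in> cball 0 s - {0} \<Longrightarrow> f z \<noteq> 0"
    using powser_0_nonzero[of "r / 2" 0 a f "Suc m"] sm r by (metis half_gt_zero zero_less_Suc)
  define t where "t = min (s / 2) (r / 2)"
  have "0 < t" "t < r" "t \<le> s" using s(1) r by (auto simp: t_def)
  hence "f t = 0" using zero[of t] by (simp add: f_def sums_iff)
  moreover have "f t \<noteq> 0" using \<open>0 < t\<close> \<open>t \<le> s\<close> by (intro s(2)) auto
  ultimately show False by simp
qed

definition closed_kernel :: "real \<Rightarrow> real \<Rightarrow> real" where
  "closed_kernel x y = - 2 * ln (cmod (1 - of_real (exp (- x)) * cis (2 * pi * y)))"

text \<open>From \<open>1 - \<bar>w\<bar> \<le> \<bar>1 - w\<bar> \<le> 1 + \<bar>w\<bar> \<le> 1 / (1 - \<bar>w\<bar>)\<close>: the closed kernel is bounded by twice the open one,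
uniformly in the angle.\<close>

lemma closed_kernel_bound:
  assumes x: "x > 0"
  shows "\<bar>closed_kernel x y\<bar> \<le> 2 * edge_log x"
proof -
  define u where "u = exp (- x)"
  let ?w = "of_real u * cis (2 * pi * y)"
  have u: "0 < u" "u < 1" using x by (auto simp: u_def)
  have nw: "cmod ?w = u" using u by (simp add: norm_mult)
  have lo: "1 - u \<le> cmod (1 - ?w)" using norm_triangle_ineq2[of 1 ?w] nw by simp
  have "cmod (1 - ?w) \<le> 1 + u" using norm_triangle_ineq4[of 1 ?w] nw by simp
  also have "1 + u \<le> 1 / (1 - u)" using u by (simp add: field_simps)
  finally have hi: "cmod (1 - ?w) \<le> 1 / (1 - u)" .
  have "ln (1 - u) \<le> ln (cmod (1 - ?w))" using lo u by (intro ln_mono) auto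
  moreover have "ln (cmod (1 - ?w)) \<le> ln (1 / (1 - u))"
    by (rule ln_mono[OF hi]) (use lo u in linarith)
  hence "ln (cmod (1 - ?w)) \<le> - ln (1 - u)" using u by (simp add: ln_div)
  ultimately show ?thesis by (simp add: closed_kernel_def edge_log_def u_def)
qed

lemma closed_kernel_borel: "(\<lambda>p. closed_kernel (fst p) (snd p)) \<in> borel_measurable borel"
proof -
  have "(\<lambda>p::real\<times>real. cmod (1 - of_real (exp (- fst p)) * cis (2 * pi * snd p))) \<in> borel_measurable borel"
    by (intro borel_measurable_continuous_onI continuous_intros)
  thus ?thesis unfolding closed_kernel_def by measurable
qed

lemma closed_kernel_torus_kernel: "torus_kernel closed_kernel 1"
proof
  show "closed_kernel x (y + 1) = closed_kernel x y" for x y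
  proof -
    have "cis (2 * pi * (y + 1)) = cis (2 * pi * y)"
      by (simp add: distrib_left cis_mult[symmetric])
    thus ?thesis by (simp add: closed_kernel_def)
  qed
qed (auto simp: closed_kernel_borel closed_kernel_bound)

lemma open_kernel_torus_kernel: "torus_kernel (\<lambda>x y. edge_log x) (1/2)"
proof
  show "\<bar>edge_log x\<bar> \<le> 2 * edge_log x" if "x > 0" for x
    using edge_log_nonneg[OF that] by simp
  show "(\<lambda>p. edge_log (fst p)) \<in> borel_measurable (borel :: (real \<times> real) measure)" by measurable
qed auto

lemma integral_cos_period:
  "(LINT y:{0..1}|lborel. cos (2 * pi * of_int m * y)) = (if m = 0 then 1 else 0)"
proof (cases "m = 0")
  case True thus ?thesis by (simp add: set_integral_unit_const)
next
  case False
  let ?F = "\<lambda>y. sin (2 * pi * of_int m * y) / (2 * pi * of_int m)"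
  have "((\<lambda>y. cos (2 * pi * of_int m * y)) has_integral (?F 1 - ?F 0)) {0..1}"
    using False by (intro fundamental_theorem_of_calculus)
      (auto intro!: derivative_eq_intros simp flip: has_real_derivative_iff_has_vector_derivative)
  moreover have "?F 1 - ?F 0 = 0" by (simp add: sin_int_2pin)
  moreover have "set_integrable lborel {0..1} (\<lambda>y. cos (2 * pi * of_int m * y))"
    by (intro borel_integrable_atLeastAtMost' continuous_intros)
  ultimately show ?thesis using False by (simp add: set_borel_integral_eq_integral(2) integral_unique)
qed

lemma parseval_finite:
  fixes a :: "nat \<Rightarrow> real"
  shows "(LINT y:{0..1}|lborel. (cmod (\<Sum>k<n. of_real (a k) * cis (2 * pi * y) ^ k))\<^sup>2) = (\<Sum>k<n. (a k)\<^sup>2)"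
proof -
  have sq: "(cmod (\<Sum>k<n. of_real (a k) * cis (2 * pi * y) ^ k))\<^sup>2 =
      (\<Sum>j<n. \<Sum>k<n. a j * a k * cos (2 * pi * of_int (int j - int k) * y))" for y
  proof -
    let ?P = "\<Sum>k<n. of_real (a k) * cis (2 * pi * y) ^ k"
    have "?P * cnj ?P = (\<Sum>j<n. \<Sum>k<n. of_real (a j * a k) * cis (2 * pi * of_int (int j - int k) * y))"
      unfolding cnj_sum sum_product
      by (intro sum.cong refl) (simp add: Complex.DeMoivre cis_cnj cis_mult algebra_simps)
    hence "Re (?P * cnj ?P) = (\<Sum>j<n. \<Sum>k<n. a j * a k * cos (2 * pi * of_int (int j - int k) * y))"
      by (simp add: Re_sum)
    moreover have "?P * cnj ?P = of_real ((cmod ?P)\<^sup>2)" by (rule complex_norm_square[symmetric])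
    ultimately show ?thesis by (metis Re_complex_of_real)
  qed
  have i: "set_integrable lborel {0..1} (\<lambda>y. a j * a k * cos (2 * pi * of_int (int j - int k) * y))" for j k
    by (intro borel_integrable_atLeastAtMost' continuous_intros)
  have "(LINT y:{0..1}|lborel. (cmod (\<Sum>k<n. of_real (a k) * cis (2 * pi * y) ^ k))\<^sup>2) =
      (\<Sum>j<n. \<Sum>k<n. a j * a k * (if int j - int k = 0 then 1 else 0))"
    unfolding sq
    by (subst set_integral_sum_fun(2), intro set_integral_sum_fun(1) i,
        subst set_integral_sum_fun(2), rule i)
       (simp only: set_integral_mult_right integral_cos_period)
  also have "\<dots> = (\<Sum>j<n. \<Sum>k<n. if k = j then a j * a k else 0)"
    by (intro sum.cong refl) auto
  also have "\<dots> = (\<Sum>k<n. (a k)\<^sup>2)" by (simp add: sum.delta power2_eq_square)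
  finally show ?thesis .
qed

text \<open>Dominated convergence, starting from trigonometric polynomials.\<close>

lemma parseval_summable:
  fixes a :: "nat \<Rightarrow> real"
  assumes a: "summable (\<lambda>k. \<bar>a k\<bar>)"
    and F: "\<And>y. (\<lambda>k. of_real (a k) * cis (2 * pi * y) ^ k) sums F y"
  shows "(\<lambda>k. (a k)\<^sup>2) sums (LINT y:{0..1}|lborel. (cmod (F y))\<^sup>2)"
proof -
  let ?P = "\<lambda>n y. \<Sum>k<n. of_real (a k) * cis (2 * pi * y) ^ k"
  let ?S = "suminf (\<lambda>k. \<bar>a k\<bar>)"
  have bnd: "(cmod (?P n y))\<^sup>2 \<le> ?S\<^sup>2" for n y
  proof (rule power_mono)
    have "cmod (?P n y) \<le> (\<Sum>k<n. \<bar>a k\<bar>)"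
      by (rule order_trans[OF norm_sum]) (simp add: norm_mult norm_power)
    also have "\<dots> \<le> ?S" by (rule sum_le_suminf[OF a]) auto
    finally show "cmod (?P n y) \<le> ?S" .
  qed auto
  have Pm: "?P n \<in> borel_measurable borel" for n
    by (intro borel_measurable_continuous_onI continuous_intros)
  have lim: "(\<lambda>n. ?P n y) \<longlonglongrightarrow> F y" for y using F[of y] by (simp add: sums_def)
  have Fm: "F \<in> borel_measurable borel"
    by (rule borel_measurable_LIMSEQ_metric[OF Pm lim])
  have "(\<lambda>n. LINT y|lborel. indicat_real {0..1} y *\<^sub>R (cmod (?P n y))\<^sup>2)
      \<longlonglongrightarrow> (LINT y|lborel. indicat_real {0..1} y *\<^sub>R (cmod (F y))\<^sup>2)"
  proof (rule integral_dominated_convergence[where w = "\<lambda>y. indicat_real {0..1} y *\<^sub>R ?S\<^sup>2"])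
    show "integrable lborel (\<lambda>y. indicat_real {0..1::real} y *\<^sub>R ?S\<^sup>2)"
      unfolding set_integrable_def[symmetric] by (intro borel_integrable_atLeastAtMost' continuous_intros)
    show "AE y in lborel. (\<lambda>n. indicat_real {0..1} y *\<^sub>R (cmod (?P n y))\<^sup>2) \<longlonglongrightarrow> indicat_real {0..1} y *\<^sub>R (cmod (F y))\<^sup>2"
      by (intro AE_I2 tendsto_intros lim)
    show "AE y in lborel. norm (indicat_real {0..1} y *\<^sub>R (cmod (?P n y))\<^sup>2) \<le> indicat_real {0..1} y *\<^sub>R ?S\<^sup>2" for n
      using bnd by (intro AE_I2) (auto simp: indicator_def)
  qed (use Pm Fm in \<open>auto intro!: borel_measurable_scaleR borel_measurable_power\<close>)
  hence "(\<lambda>n. \<Sum>k<n. (a k)\<^sup>2) \<longlonglongrightarrow> (LINT y:{0..1}|lborel. (cmod (F y))\<^sup>2)"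
    unfolding set_lebesgue_integral_def[symmetric] parseval_finite .
  thus ?thesis by (simp add: sums_def)
qed

text \<open>The average of \<open>\<bar>1 - w\<bar>\<^bsup>- 2 t\<^esup>\<close> over the circle \<open>\<bar>w\<bar>\<^sup>2 = v\<close> (\<open>angular_mean_eq\<close>), written as an
Euler integral.\<close>

definition angular_mean :: "real \<Rightarrow> real \<Rightarrow> real" where
  "angular_mean t v = (LINT u:{0<..<1}|lborel. u powr (t - 1) * (1 - u) powr (- t) * (1 - v * u) powr (- t))
     / (Gamma t * Gamma (1 - t))"

lemma binomial_beta:
  assumes "0 < t" "t < (1::real)"
  shows "pochhammer t k / fact k * (Gamma t * Gamma (1 - t)) = Beta (t + real k) (1 - t)"
proof -
  have "t \<notin> \<int>\<^sub>\<le>\<^sub>0" using assms by (auto elim!: nonpos_Ints_cases)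
  hence "pochhammer t k = Gamma (t + real k) / Gamma t" by (rule pochhammer_Gamma)
  moreover have "Gamma t > 0" using assms by (intro Gamma_real_pos) auto
  ultimately show ?thesis by (simp add: Beta_def Gamma_fact field_simps)
qed

lemma binomial_series_neg:
  assumes "\<bar>v\<bar> < (1::real)"
  shows "(\<lambda>k. pochhammer t k / fact k * v ^ k) sums (1 - v) powr (- t)"
proof -
  have "(\<lambda>k. ((- t) gchoose k) * (- v) ^ k) sums (1 + (- v)) powr (- t)"
    by (rule gen_binomial_real) (use assms in auto)
  also have "(\<lambda>k. ((- t) gchoose k) * (- v) ^ k) = (\<lambda>k. pochhammer t k / fact k * v ^ k)"
  proof
    fix k
    have "(- 1) ^ k * ((- 1) ^ k * v ^ k) = v ^ k"
      by (simp add: mult.assoc[symmetric] flip: power_mult_distrib)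
    thus "((- t) gchoose k) * (- v) ^ k = pochhammer t k / fact k * v ^ k"
      by (simp add: gbinomial_pochhammer power_minus[of v] mult_ac)
  qed
  finally show ?thesis by simp
qed

text \<open>Expanding \<open>(1 - v u)\<^bsup>- t\<^esup>\<close> and integrating termwise gives one binomial coefficient from the
expansion and a second, equal one from the beta integral.\<close>

lemma angular_mean_series:
  assumes t: "0 < t" "t < 1" and v: "0 < v" "v < (1::real)"
  shows "(\<lambda>k. (pochhammer t k / fact k)\<^sup>2 * v ^ k) sums angular_mean t v"
proof -
  let ?b = "\<lambda>k. pochhammer t k / fact k"
  let ?w = "\<lambda>u::real. u powr (t - 1) * (1 - u) powr (- t)"
  let ?G = "Gamma t * Gamma (1 - t)"
  have G: "?G > 0" using t by (intro mult_pos_pos Gamma_real_pos) auto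
  have p0: "pochhammer t k \<ge> 0" for k using t by (simp add: pochhammer_nonneg)
  hence b0: "?b k \<ge> 0" for k by simp
  have wint: "set_integrable lborel {0<..<1} ?w"
    using beta_integral_open(1)[of t "1 - t"] t by simp
  have wk: "(LINT u:{0<..<1}|lborel. ?w u * u ^ k) = ?b k * ?G"
       "set_integrable lborel {0<..<1} (\<lambda>u. ?w u * u ^ k)" for k
  proof -
    have eq: "?w u * u ^ k = u powr (t + real k - 1) * (1 - u) powr (1 - t - 1)" if "u \<in> {0<..<1}" for u
      using that by (simp add: powr_add powr_diff powr_realpow field_simps)
    have "(LINT u:{0<..<1}|lborel. ?w u * u ^ k) = (LINT u:{0<..<1}|lborel. u powr (t + real k - 1) * (1 - u) powr (1 - t - 1))"
      by (rule set_lebesgue_integral_cong) (use eq in auto)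
    also have "\<dots> = Beta (t + real k) (1 - t)" by (rule beta_integral_open) (use t in auto)
    finally show "(LINT u:{0<..<1}|lborel. ?w u * u ^ k) = ?b k * ?G" using binomial_beta[OF t] by simp
    have "set_integrable lborel {0<..<1} (\<lambda>u. u powr (t + real k - 1) * (1 - u) powr (1 - t - 1))"
      by (rule beta_integral_open) (use t in auto)
    also have "?this \<longleftrightarrow> set_integrable lborel {0<..<1} (\<lambda>u. ?w u * u ^ k)"
      by (rule set_integrable_cong) (use eq in auto)
    finally show "set_integrable lborel {0<..<1} (\<lambda>u. ?w u * u ^ k)" .
  qed
  let ?s = "\<lambda>n u. \<Sum>k<n. ?b k * (v * u) ^ k"
  have vu: "\<bar>v * u\<bar> < 1" if "u \<in> {0<..<1}" for u
    using v that mult_strict_mono[of v 1 u 1] by (auto simp: abs_mult)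
  have lim: "(\<lambda>n. ?s n u) \<longlonglongrightarrow> (1 - v * u) powr (- t)" if "u \<in> {0<..<1}" for u
    using binomial_series_neg[OF vu[OF that], of t] by (simp add: sums_def)
  have bnd: "0 \<le> ?s n u \<and> ?s n u \<le> (1 - v) powr (- t)" if u: "u \<in> {0<..<1}" for n u
  proof
    show "0 \<le> ?s n u" using u v b0 by (intro sum_nonneg mult_nonneg_nonneg) auto
    have "?s n u \<le> (1 - v * u) powr (- t)"
    proof -
      have "0 \<le> ?b k * (v * u) ^ k" for k
        using u v b0[of k] by (intro mult_nonneg_nonneg zero_le_power) auto
      thus ?thesis using sum_le_suminf[of "\<lambda>k. ?b k * (v * u) ^ k" "{..<n}"]
          binomial_series_neg[OF vu[OF u], of t] by (simp only: sums_iff) auto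
    qed
    also have "\<dots> \<le> (1 - v) powr (- t)" using t u v by (intro powr_mono2') auto
    finally show "?s n u \<le> (1 - v) powr (- t)" .
  qed
  have "(\<lambda>n. LINT u|lborel. indicat_real {0<..<1} u *\<^sub>R (?w u * ?s n u))
     \<longlonglongrightarrow> (LINT u|lborel. indicat_real {0<..<1} u *\<^sub>R (?w u * (1 - v * u) powr (- t)))"
  proof (rule integral_dominated_convergence[where w = "\<lambda>u. indicat_real {0<..<1} u *\<^sub>R (?w u * (1 - v) powr (- t))"])
    show "integrable lborel (\<lambda>u. indicat_real {0<..<1} u *\<^sub>R (?w u * (1 - v) powr (- t)))"
      unfolding set_integrable_def[symmetric] by (intro set_integrable_mult_left wint)
    show "AE u in lborel. (\<lambda>n. indicat_real {0<..<1} u *\<^sub>R (?w u * ?s n u))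
        \<longlonglongrightarrow> indicat_real {0<..<1} u *\<^sub>R (?w u * (1 - v * u) powr (- t))"
    proof (rule AE_I2)
      fix u show "(\<lambda>n. indicat_real {0<..<1} u *\<^sub>R (?w u * ?s n u))
        \<longlonglongrightarrow> indicat_real {0<..<1} u *\<^sub>R (?w u * (1 - v * u) powr (- t))"
      proof (cases "u \<in> {0<..<1}")
        case True
        show ?thesis by (intro tendsto_scaleR tendsto_mult tendsto_const lim True)
      qed simp
    qed
    show "AE u in lborel. norm (indicat_real {0<..<1} u *\<^sub>R (?w u * ?s n u)) \<le>
        indicat_real {0<..<1} u *\<^sub>R (?w u * (1 - v) powr (- t))" for n
    proof (rule AE_I2)
      fix u show "norm (indicat_real {0<..<1} u *\<^sub>R (?w u * ?s n u)) \<le>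
        indicat_real {0<..<1} u *\<^sub>R (?w u * (1 - v) powr (- t))"
        using bnd[of u n] by (cases "u \<in> {0<..<1}") (auto simp: abs_mult intro!: mult_left_mono)
    qed
  qed measurable
  moreover have "(LINT u|lborel. indicat_real {0<..<1} u *\<^sub>R (?w u * ?s n u)) = (\<Sum>k<n. (?b k)\<^sup>2 * v ^ k) * ?G" for n
  proof -
    have "?w u * ?s n u = (\<Sum>k<n. ?b k * v ^ k * (?w u * u ^ k))" for u
      by (simp add: sum_distrib_left power_mult_distrib mult_ac)
    hence "(LINT u|lborel. indicat_real {0<..<1} u *\<^sub>R (?w u * ?s n u)) = (LINT u:{0<..<1}|lborel. \<Sum>k<n. ?b k * v ^ k * (?w u * u ^ k))"
      by (simp only: set_lebesgue_integral_def)
    also have "\<dots> = (\<Sum>k<n. ?b k * v ^ k * (?b k * ?G))"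
      by (subst set_integral_sum_fun(2), intro set_integrable_mult_right wk)
         (simp only: set_integral_mult_right wk)
    also have "\<dots> = (\<Sum>k<n. (?b k)\<^sup>2 * v ^ k) * ?G"
      unfolding sum_distrib_right by (intro sum.cong refl) (simp add: power2_eq_square mult_ac)
    finally show ?thesis .
  qed
  ultimately have "(\<lambda>n. (\<Sum>k<n. (?b k)\<^sup>2 * v ^ k) * ?G / ?G) \<longlonglongrightarrow> angular_mean t v"
    unfolding angular_mean_def set_lebesgue_integral_def using G by (intro tendsto_divide tendsto_const) (auto)
  moreover have "?G \<noteq> 0" using G by (rule less_imp_neq[symmetric])
  note nonzero_mult_div_cancel_right[OF this]
  ultimately show ?thesis unfolding sums_def by (simp only:)
qed

text \<open>Parseval applied to \<open>(1 - w)\<^bsup>- t\<^esup>\<close>, whose absolute square is the integrand.\<close>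

lemma angular_mean_eq:
  assumes t: "0 < t" "t < 1" and x: "x > 0"
  shows "(LINT y:{0..1}|lborel. exp (t * closed_kernel x y)) = angular_mean t (exp (- (2 * x)))"
proof -
  define r where "r = exp (- x)"
  have r: "0 < r" "r < 1" using x by (auto simp: r_def)
  let ?b = "\<lambda>k. pochhammer t k / fact k"
  let ?a = "\<lambda>k. ?b k * r ^ k"
  let ?F = "\<lambda>y. (1 - of_real r * cis (2 * pi * y)) powr (- of_real t :: complex)"
  have p0: "pochhammer t k \<ge> 0" for k using t by (simp add: pochhammer_nonneg)
  hence b0: "?b k \<ge> 0" for k by simp
  have "(\<lambda>k. (?a k)\<^sup>2) sums (LINT y:{0..1}|lborel. (cmod (?F y))\<^sup>2)"
  proof (rule parseval_summable)
    show "summable (\<lambda>k. \<bar>?a k\<bar>)"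
      using binomial_series_neg[of r t] r p0 by (simp add: sums_iff abs_mult)
    fix y
    let ?w = "of_real r * cis (2 * pi * y)"
    have "(\<lambda>k. ((- of_real t) gchoose k) * (- ?w) ^ k) sums (1 + (- ?w)) powr (- of_real t)"
      by (rule gen_binomial_complex) (use r in \<open>auto simp: norm_mult\<close>)
    also have "(\<lambda>k. ((- of_real t) gchoose k) * (- ?w) ^ k) = (\<lambda>k. of_real (?a k) * cis (2 * pi * y) ^ k)"
    proof
      fix k
      have "(- 1) ^ k * ((- 1) ^ k * ?w ^ k) = ?w ^ k"
        by (simp add: mult.assoc[symmetric] flip: power_mult_distrib)
      moreover have "((- of_real t) gchoose k) * (- ?w) ^ k =
          pochhammer (of_real t) k / fact k * ((- 1) ^ k * ((- 1) ^ k * ?w ^ k))"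
        unfolding gbinomial_pochhammer power_minus[of ?w] by simp
      ultimately show "((- of_real t) gchoose k) * (- ?w) ^ k = of_real (?a k) * cis (2 * pi * y) ^ k"
        by (simp add: power_mult_distrib pochhammer_of_real)
    qed
    finally show "(\<lambda>k. of_real (?a k) * cis (2 * pi * y) ^ k) sums ?F y" by simp
  qed
  moreover have "(\<lambda>k. (?a k)\<^sup>2) = (\<lambda>k. (?b k)\<^sup>2 * exp (- (2 * x)) ^ k)"
    by (simp add: fun_eq_iff power_mult_distrib r_def exp_double power2_eq_square mult_ac flip: exp_add exp_of_nat_mult)
  moreover have "(cmod (?F y))\<^sup>2 = exp (t * closed_kernel x y)" for y
  proof -
    have "cmod (of_real r * cis (2 * pi * y)) < 1" using r by (simp add: norm_mult)
    hence "1 - of_real r * cis (2 * pi * y) \<noteq> 0" by auto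
    thus ?thesis
      by (simp add: norm_powr_real_powr' closed_kernel_def r_def powr_def power2_eq_square flip: exp_add)
  qed
  ultimately show ?thesis
    using angular_mean_series[OF t, of "exp (- (2 * x))"] x sums_unique2 by auto
qed

section \<open>The complex beta integral\<close>

definition beta_weight :: "real \<Rightarrow> real \<Rightarrow> real \<Rightarrow> real" where
  "beta_weight t a s = s powr (a - 1) * (1 - s) powr (- t)"

lemma beta_weight_borel [measurable]: "beta_weight t a \<in> borel_measurable borel"
  unfolding beta_weight_def by measurable

lemma beta_weight_nonneg: "beta_weight t a s \<ge> 0"
  by (simp add: beta_weight_def)

lemma beta_weight_nn_integral:
  assumes "a > 0" "t < 1"
  shows "(\<integral>\<^sup>+s. ennreal (indicator {0<..<1} s * beta_weight t a s) \<partial>lborel) = ennreal (Beta a (1 - t))"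
proof -
  have "set_integrable lborel {0<..<1} (beta_weight t a)"
       "(LINT s:{0<..<1}|lborel. beta_weight t a s) = Beta a (1 - t)"
    using beta_integral_open[of a "1 - t"] assms by (simp_all add: beta_weight_def[abs_def])
  thus ?thesis
    by (subst nn_integral_eq_integral)
       (auto simp: set_integrable_def set_lebesgue_integral_def beta_weight_nonneg indicator_def)
qed

text \<open>Half of a product of two beta integrals: only the region \<open>s < u\<close> of the unit square.\<close>

definition ordered_beta :: "real \<Rightarrow> real \<Rightarrow> real \<Rightarrow> ennreal" where
  "ordered_beta t b a = (\<integral>\<^sup>+u. \<integral>\<^sup>+s. ennreal (indicator {0<..<1} s * beta_weight t b s) *
      (ennreal (indicator {0<..<1} u * beta_weight t a u) * indicator {p. fst p < snd p} (s, u)) \<partial>lborel \<partial>lborel)"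

lemma strict_order_borel [measurable]: "{p :: real \<times> real. fst p < snd p} \<in> sets borel"
  by (intro borel_open open_Collect_less continuous_intros)

text \<open>The regions \<open>s < u\<close> and \<open>u < s\<close> make up the square, on which the integrand factorizes.\<close>

lemma ordered_beta_add:
  assumes "a > 0" "b > 0" "t < 1"
  shows "ordered_beta t b a + ordered_beta t a b = ennreal (Beta a (1 - t) * Beta b (1 - t))"
proof -
  let ?w = "\<lambda>a s. ennreal (indicator {0<..<1} s * beta_weight t a s)"
  let ?L = "\<lambda>s u. indicator {p::real\<times>real. fst p < snd p} (s, u) :: ennreal"
  have B: "Beta a (1 - t) \<ge> 0" "Beta b (1 - t) \<ge> 0"
    using assms by (auto simp: Beta_def intro!: divide_nonneg_nonneg mult_nonneg_nonneg Gamma_real_nonneg)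
  have "ordered_beta t a b = (\<integral>\<^sup>+u. \<integral>\<^sup>+s. ?w a s * (?w b u * ?L s u) \<partial>lborel \<partial>lborel)"
    by (simp add: ordered_beta_def)
  also have "\<dots> = (\<integral>\<^sup>+s. \<integral>\<^sup>+u. ?w a s * (?w b u * ?L s u) \<partial>lborel \<partial>lborel)"
    by (rule lborel_pair.Fubini') measurable
  finally have swap: "ordered_beta t a b = (\<integral>\<^sup>+u. \<integral>\<^sup>+s. ?w a u * (?w b s * ?L u s) \<partial>lborel \<partial>lborel)" .
  have "ordered_beta t b a + ordered_beta t a b =
     (\<integral>\<^sup>+u. ((\<integral>\<^sup>+s. ?w b s * (?w a u * ?L s u) \<partial>lborel) + (\<integral>\<^sup>+s. ?w a u * (?w b s * ?L u s) \<partial>lborel)) \<partial>lborel)"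
    unfolding swap unfolding ordered_beta_def by (rule nn_integral_add[symmetric]) measurable
  also have "\<dots> = (\<integral>\<^sup>+u. (\<integral>\<^sup>+s. ?w b s * (?w a u * ?L s u) + ?w a u * (?w b s * ?L u s) \<partial>lborel) \<partial>lborel)"
    by (intro nn_integral_cong nn_integral_add[symmetric]) measurable
  also have "\<dots> = (\<integral>\<^sup>+u. (\<integral>\<^sup>+s. ?w a u * ?w b s \<partial>lborel) \<partial>lborel)"
  proof (rule nn_integral_cong, rule nn_integral_cong_AE)
    fix u
    show "AE s in lborel. ?w b s * (?w a u * ?L s u) + ?w a u * (?w b s * ?L u s) = ?w a u * ?w b s"
      using AE_lborel_singleton[of u]
    proof eventually_elim
      case (elim s)
      thus ?case by (cases "s < u") (auto simp: indicator_def mult_ac)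
    qed
  qed
  also have "\<dots> = ennreal (Beta a (1 - t)) * ennreal (Beta b (1 - t))"
    using assms by (simp add: nn_integral_cmult nn_integral_multc beta_weight_nn_integral)
  also have "\<dots> = ennreal (Beta a (1 - t) * Beta b (1 - t))" using B by (simp add: ennreal_mult)
  finally show ?thesis .
qed

lemma angular_mean_borel [measurable]: "angular_mean t \<in> borel_measurable borel"
proof -
  have "(\<lambda>v. LINT u|lborel. indicat_real {0<..<1} u *\<^sub>R
      (u powr (t - 1) * (1 - u) powr (- t) * (1 - v * u) powr (- t))) \<in> borel_measurable borel"
    by (rule lborel.borel_measurable_lebesgue_integral) measurable
  thus ?thesis unfolding angular_mean_def[abs_def] set_lebesgue_integral_def by measurable
qed

lemma angular_mean_nn_integral:
  assumes t: "0 < t" "t < 1" and v: "0 < v" "v < (1::real)"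
  shows "ennreal (angular_mean t v * (Gamma t * Gamma (1 - t))) =
     (\<integral>\<^sup>+u. ennreal (indicator {0<..<1} u * (beta_weight t t u * (1 - v * u) powr (- t))) \<partial>lborel)"
proof -
  let ?g = "\<lambda>u. beta_weight t t u * (1 - v * u) powr (- t)"
  have G: "Gamma t \<noteq> 0" "Gamma (1 - t) \<noteq> 0"
    by (rule less_imp_neq[OF Gamma_real_pos, symmetric]; use t in simp)+
  have "set_integrable lborel {0<..<1} (\<lambda>u. beta_weight t t u * (1 - v) powr (- t))"
    using beta_integral_open(1)[of t "1 - t"] t by (intro set_integrable_mult_left) (simp add: beta_weight_def[abs_def])
  hence int: "set_integrable lborel {0<..<1} ?g"
  proof (rule set_integrable_bound)
    fix u :: real assume u: "u \<in> {0<..<1}"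
    have "(1 - v * u) powr (- t) \<le> (1 - v) powr (- t)" using t u v by (intro powr_mono2') auto
    thus "\<bar>?g u\<bar> \<le> beta_weight t t u * (1 - v) powr (- t)"
      by (simp add: abs_mult beta_weight_nonneg mult_left_mono)
  qed measurable
  have "angular_mean t v * (Gamma t * Gamma (1 - t)) = (LINT u:{0<..<1}|lborel. ?g u)"
    using G by (simp add: angular_mean_def beta_weight_def)
  thus ?thesis using int
    by (subst nn_integral_eq_integral)
       (auto simp: set_integrable_def set_lebesgue_integral_def beta_weight_nonneg indicator_def)
qed

lemma angular_mean_nonneg:
  assumes "0 < t" "t < 1" "0 < v" "v < (1::real)"
  shows "angular_mean t v \<ge> 0"
  using angular_mean_series[OF assms] assms suminf_nonneg[of "\<lambda>k. (pochhammer t k / fact k)\<^sup>2 * v ^ k"]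
  by (auto simp: sums_iff)

text \<open>In the Mellin transform of the Euler integral, put \<open>s = u v\<close>. The domain becomes \<open>s < u\<close>, and
because \<open>a + b = t\<close> the powers of \<open>u\<close> combine to \<open>u\<^bsup>a - 1\<^esup>\<close>.\<close>

lemma angular_mean_mellin:
  assumes t: "0 < t" "t < 1" and ab: "a > 0" "b > 0" "a + b = t"
    and int: "set_integrable lborel {0<..<1} (\<lambda>v. v powr (b - 1) * angular_mean t v)"
  shows "ennreal ((LINT v:{0<..<1}|lborel. v powr (b - 1) * angular_mean t v) * (Gamma t * Gamma (1 - t))) =
     ordered_beta t b a"
proof -
  let ?G = "Gamma t * Gamma (1 - t)"
  have G: "?G > 0" using t by (intro mult_pos_pos Gamma_real_pos) auto
  note am = angular_mean_nonneg[OF t]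
  let ?I = "\<lambda>v. indicator {0<..<1} v :: real"
  have "ennreal ((LINT v:{0<..<1}|lborel. v powr (b - 1) * angular_mean t v) * ?G) =
     ennreal (LINT v|lborel. ?I v * (v powr (b - 1) * (angular_mean t v * ?G)))"
    unfolding set_lebesgue_integral_def Bochner_Integration.integral_mult_left_zero[symmetric]
      real_scaleR_def mult.assoc ..
  also have "\<dots> = (\<integral>\<^sup>+v. ennreal (?I v * (v powr (b - 1) * (angular_mean t v * ?G))) \<partial>lborel)"
  proof (rule nn_integral_eq_integral[symmetric])
    have "integrable lborel (\<lambda>v. (?I v *\<^sub>R (v powr (b - 1) * angular_mean t v)) * ?G)"
      using int unfolding set_integrable_def by (intro integrable_mult_left)
    thus "integrable lborel (\<lambda>v. ?I v * (v powr (b - 1) * (angular_mean t v * ?G)))"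
      by (simp add: mult_ac)
    show "AE v in lborel. 0 \<le> ?I v * (v powr (b - 1) * (angular_mean t v * ?G))"
      using am G by (intro AE_I2) (auto simp: indicator_def intro!: mult_nonneg_nonneg)
  qed
  also have "\<dots> = (\<integral>\<^sup>+v. \<integral>\<^sup>+u. ennreal (?I v * v powr (b - 1)) *
      ennreal (?I u * (beta_weight t t u * (1 - v * u) powr (- t))) \<partial>lborel \<partial>lborel)"
  proof (rule nn_integral_cong)
    fix v :: real
    show "ennreal (?I v * (v powr (b - 1) * (angular_mean t v * ?G))) = (\<integral>\<^sup>+u. ennreal (?I v * v powr (b - 1)) *
      ennreal (?I u * (beta_weight t t u * (1 - v * u) powr (- t))) \<partial>lborel)"
    proof (cases "v \<in> {0<..<1}")
      case True
      have "ennreal (?I v * (v powr (b - 1) * (angular_mean t v * ?G))) =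
          ennreal (?I v * v powr (b - 1)) * ennreal (angular_mean t v * ?G)"
        using True am[of v] G by (simp add: ennreal_mult')
      also have "ennreal (angular_mean t v * ?G) =
         (\<integral>\<^sup>+u. ennreal (?I u * (beta_weight t t u * (1 - v * u) powr (- t))) \<partial>lborel)"
        by (rule angular_mean_nn_integral) (use t True in auto)
      finally show ?thesis by (simp add: nn_integral_cmult)
    qed simp
  qed
  also have "\<dots> = (\<integral>\<^sup>+u. \<integral>\<^sup>+v. ennreal (?I v * v powr (b - 1)) *
      ennreal (?I u * (beta_weight t t u * (1 - v * u) powr (- t))) \<partial>lborel \<partial>lborel)"
    by (rule lborel_pair.Fubini') measurable
  also have "\<dots> = ordered_beta t b a" unfolding ordered_beta_def
  proof (rule nn_integral_cong)
    fix u :: real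
    show "(\<integral>\<^sup>+v. ennreal (?I v * v powr (b - 1)) *
      ennreal (?I u * (beta_weight t t u * (1 - v * u) powr (- t))) \<partial>lborel) =
      (\<integral>\<^sup>+s. ennreal (?I s * beta_weight t b s) *
      (ennreal (?I u * beta_weight t a u) * indicator {p. fst p < snd p} (s, u)) \<partial>lborel)"
    proof (cases "u \<in> {0<..<1}")
      case True
      hence u: "0 < u" "u < 1" by auto
      let ?g = "\<lambda>s. ennreal (?I s * beta_weight t b s) * (ennreal (?I u * beta_weight t a u) * indicator {p. fst p < snd p} (s, u))"
      have "(\<integral>\<^sup>+s. ?g s \<partial>lborel) = ennreal \<bar>u\<bar> * (\<integral>\<^sup>+v. ?g (0 + u * v) \<partial>lborel)"
        by (rule nn_integral_real_affine) (use u in auto)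
      also have "\<dots> = (\<integral>\<^sup>+v. ennreal u * ?g (0 + u * v) \<partial>lborel)"
        using u by (simp add: nn_integral_cmult)
      also have "\<dots> = (\<integral>\<^sup>+v. ennreal (?I v * v powr (b - 1)) *
          ennreal (?I u * (beta_weight t t u * (1 - v * u) powr (- t))) \<partial>lborel)"
      proof (rule nn_integral_cong)
        fix v :: real
        show "ennreal u * ?g (0 + u * v) = ennreal (?I v * v powr (b - 1)) *
          ennreal (?I u * (beta_weight t t u * (1 - v * u) powr (- t)))"
        proof (cases "0 < v \<and> v < 1")
          case True
          hence v: "0 < v" "v < 1" by auto
          have uv: "0 < u * v" "u * v < u" "u * v < 1" using u v mult_strict_mono[of u 1 v 1] by auto
          have "u * (u powr (b - 1) * u powr (a - 1)) = u powr (t - 1)"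
          proof -
            have "u * (u powr (b - 1) * u powr (a - 1)) = u powr (1 + ((b - 1) + (a - 1)))"
              using u by (simp only: powr_add powr_one)
            thus ?thesis using ab by (simp add: algebra_simps)
          qed
          hence "u * (beta_weight t b (u * v) * beta_weight t a u) =
              v powr (b - 1) * (beta_weight t t u * (1 - v * u) powr (- t))"
            using u v by (simp add: beta_weight_def powr_mult mult_ac)
          hence "ennreal (u * (beta_weight t b (u * v) * beta_weight t a u)) =
              ennreal (v powr (b - 1) * (beta_weight t t u * (1 - v * u) powr (- t)))" by simp
          thus ?thesis using u v uv
            by (simp add: ennreal_mult beta_weight_nonneg)
        next
          case False
          thus ?thesis using u by (auto simp: indicator_def zero_less_mult_iff mult_less_cancel_left2)
        qed
      qed
      finally show ?thesis by simp
    qed simp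
  qed
  finally show ?thesis .
qed

lemma beta_one:
  assumes b: "b > (0::real)"
  shows "Beta b (1 - 0) = 1 / b"
proof -
  have "Gamma b > 0" using b by (rule Gamma_real_pos)
  moreover have "b \<notin> \<int>\<^sub>\<le>\<^sub>0" using b by (auto elim!: nonpos_Ints_cases)
  ultimately show ?thesis by (simp add: Beta_def Gamma_plus1)
qed

lemma open_generating_integral:
  assumes t: "0 < t" "t < 1" and e: "e < 1/2"
  shows "(LINT p:half_cylinder|lborel. exp (t * (edge_log (fst p) - 1/2 * fst p + e * fst p)) - exp (t * (- (1/2 * fst p) + e * fst p)))
     = Beta (t * (1/2 - e)) (1 - t) - 1 / (t * (1/2 - e))"
proof -
  let ?b = "t * (1/2 - e)"
  have b: "?b > 0" using t e by simp
  let ?f = "\<lambda>x. exp (- (?b * x)) * exp (t * edge_log x)" and ?g = "\<lambda>x. exp (- (?b * x)) * exp (0 * edge_log x)"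
  have eq: "exp (t * (edge_log x - 1/2 * x + e * x)) - exp (t * (- (1/2 * x) + e * x)) = ?f x - ?g x" for x
    by (simp add: algebra_simps flip: exp_add)
  note f = exp_beta_integral[OF b t(2)] and g = exp_beta_integral[OF b zero_less_one]
  have "(LINT p:half_cylinder|lborel. ?f (fst p) - ?g (fst p)) = (LINT x:{0<..}|lborel. ?f x - ?g x)"
    by (rule set_integrable_strip(2)[OF set_integral_diff(1)[OF f(1) g(1)]]) auto
  also have "\<dots> = Beta ?b (1 - t) - Beta ?b (1 - 0)"
    by (subst set_integral_diff(2)[OF f(1) g(1)]) (simp only: f g)
  also have "Beta ?b (1 - 0) = 1 / ?b" by (rule beta_one[OF b])
  finally show ?thesis unfolding eq .
qed

text \<open>The complex beta integral in terms of real ones, in the manner of Kawai, Lewellen and Tye. Each summand on the left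
is an integral over the unit disc; exchanging \<open>a\<close> and \<open>b\<close> corresponds to \<open>w \<mapsto> 1/w\<close> and also to exchanging the
two triangles of the unit square.\<close>

lemma klt_mellin_sum:
  assumes t: "0 < t" "t < 1" and ab: "a > 0" "b > 0" "a + b = t"
    and int: "set_integrable lborel {0<..<1} (\<lambda>v. v powr (a - 1) * angular_mean t v)"
             "set_integrable lborel {0<..<1} (\<lambda>v. v powr (b - 1) * angular_mean t v)"
  shows "(LINT v:{0<..<1}|lborel. v powr (a - 1) * angular_mean t v) +
         (LINT v:{0<..<1}|lborel. v powr (b - 1) * angular_mean t v) =
         Beta a (1 - t) * Beta b (1 - t) / (Gamma t * Gamma (1 - t))"
proof -
  let ?G = "Gamma t * Gamma (1 - t)"
  let ?M = "\<lambda>c. LINT v:{0<..<1}|lborel. v powr (c - 1) * angular_mean t v"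
  have G: "?G > 0" using t by (intro mult_pos_pos Gamma_real_pos) auto
  note am = angular_mean_nonneg[OF t]
  have M: "?M c \<ge> 0" for c unfolding set_lebesgue_integral_def
    by (intro Bochner_Integration.integral_nonneg) (auto simp: indicator_def am)
  have B: "Beta a (1 - t) \<ge> 0" "Beta b (1 - t) \<ge> 0"
    using ab t by (auto simp: Beta_def intro!: divide_nonneg_nonneg mult_nonneg_nonneg Gamma_real_nonneg)
  have MG: "?M c * ?G \<ge> 0" for c by (rule mult_nonneg_nonneg[OF M less_imp_le[OF G]])
  have "ennreal (?M a * ?G + ?M b * ?G) = ennreal (?M a * ?G) + ennreal (?M b * ?G)"
    by (rule ennreal_plus[OF MG MG])
  also have "\<dots> = ordered_beta t a b + ordered_beta t b a"
    using angular_mean_mellin[OF t ab(2,1) _ int(1)] angular_mean_mellin[OF t ab int(2)] ab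
    by (simp add: add.commute)
  also have "\<dots> = ennreal (Beta b (1 - t) * Beta a (1 - t))"
    by (rule ordered_beta_add) (use ab t in auto)
  finally have "?M a * ?G + ?M b * ?G = Beta b (1 - t) * Beta a (1 - t)"
    by (subst (asm) ennreal_inj[OF add_nonneg_nonneg[OF MG MG] mult_nonneg_nonneg[OF B(2,1)]])
  hence "(?M a + ?M b) * ?G = Beta a (1 - t) * Beta b (1 - t)" by (simp add: algebra_simps)
  thus ?thesis by (rule eq_divide_imp[OF less_imp_neq[OF G, symmetric]])
qed

text \<open>The slope parameter is \<open>2 e\<close> here and \<open>e\<close> in the open case, so that both lead to the same
\<open>b = t (1/2 - e)\<close>.\<close>

lemma closed_generating_integral:
  assumes t: "0 < t" "t \<le> 1/64" and e: "\<bar>e\<bar> < 1/2"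
  shows "set_integrable lborel {0<..<1} (\<lambda>v. v powr (t * (1/2 - e) - 1) * angular_mean t v)"
    and "(LINT p:half_cylinder|lborel. exp (t * (closed_kernel (fst p) (snd p) - 1 * fst p + (2 * e) * fst p))
            - exp (t * (- (1 * fst p) + (2 * e) * fst p)))
     = (LINT v:{0<..<1}|lborel. v powr (t * (1/2 - e) - 1) * angular_mean t v) / 2 - 1 / (2 * (t * (1/2 - e)))"
proof -
  interpret closed: torus_kernel closed_kernel 1 by (rule closed_kernel_torus_kernel)
  let ?b = "t * (1/2 - e)"
  have b: "?b > 0" using t e by simp
  have b2: "2 * ?b > 0" using b by simp
  let ?g = "\<lambda>x. exp (- (2 * ?b * x)) * exp (0 * edge_log x)"
  let ?f = "\<lambda>p. exp (- (2 * ?b * fst p)) * exp (t * closed_kernel (fst p) (snd p))"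
  have eq: "exp (t * (closed_kernel (fst p) (snd p) - 1 * fst p + (2 * e) * fst p))
            - exp (t * (- (1 * fst p) + (2 * e) * fst p)) = ?f p - ?g (fst p)" for p
    by (simp add: algebra_simps flip: exp_add)
  have e1: "\<bar>2 * e\<bar> \<le> 1" using e by simp
  have d: "set_integrable lborel half_cylinder (\<lambda>p. ?f p - ?g (fst p))"
    using closed.gen_coeff_sums(1)[OF t e1] unfolding eq .
  note g = exp_beta_integral[OF b2 zero_less_one]
  have gi: "set_integrable lborel half_cylinder (\<lambda>p. ?g (fst p))"
    by (rule set_integrable_strip(1)[OF g(1)]) auto
  have "set_integrable lborel half_cylinder (\<lambda>p. (?f p - ?g (fst p)) + ?g (fst p))"
    by (rule set_integral_add(1)[OF d gi])
  hence fi: "set_integrable lborel half_cylinder ?f" by simp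
  have t1: "t < 1" using t by simp
  have inner: "(LINT y:{0..1}|lborel. ?f (x, y)) = 2 * exp (- (2 * x)) *
      (exp (- (2 * x)) powr (?b - 1) * angular_mean t (exp (- (2 * x))) / 2)" if x: "x > 0" for x
  proof -
    have "exp (- (2 * x)) * exp (- (2 * x)) powr (?b - 1) = exp (- (2 * ?b * x))"
      by (simp add: powr_def algebra_simps flip: exp_add)
    moreover have "(LINT y:{0..1}|lborel. ?f (x, y)) = exp (- (2 * ?b * x)) * angular_mean t (exp (- (2 * x)))"
      using angular_mean_eq[OF t(1) t1 x] by simp
    ultimately show ?thesis by (simp add: mult.assoc[symmetric])
  qed
  let ?k = "\<lambda>v. v powr (?b - 1) * angular_mean t v / 2"
  have outer: "set_integrable lborel {0<..} (\<lambda>x. LINT y:{0..1}|lborel. ?f (x, y))"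
  proof -
    have "integrable (lborel \<Otimes>\<^sub>M lborel) (\<lambda>p. indicator half_cylinder p *\<^sub>R ?f p)"
      using fi by (simp add: lborel_prod set_integrable_def)
    from lborel_pair.integrable_fst'[OF this]
    have "integrable lborel (\<lambda>x. LINT y|lborel. indicator half_cylinder (x, y) *\<^sub>R ?f (x, y))" .
    also have "(\<lambda>x. LINT y|lborel. indicator half_cylinder (x, y) *\<^sub>R ?f (x, y)) =
        (\<lambda>x. indicator {0<..} x *\<^sub>R (LINT y:{0..1}|lborel. ?f (x, y)))"
      unfolding set_lebesgue_integral_def integral_scaleR_right[symmetric]
      by (intro ext Bochner_Integration.integral_cong refl) (auto simp: indicator_def)
    finally show ?thesis by (simp only: set_integrable_def)
  qed
  also have "?this \<longleftrightarrow> set_integrable lborel {0<..} (\<lambda>x. 2 * exp (- (2 * x)) * ?k (exp (- (2 * x))))"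
    by (rule set_integrable_cong) (use inner in auto)
  also have "\<dots> \<longleftrightarrow> set_integrable lborel {0<..<1} ?k"
    by (rule exp_substitution) auto
  finally have ki: "set_integrable lborel {0<..<1} ?k" .
  from set_integrable_mult_right[OF this, of 2]
  show "set_integrable lborel {0<..<1} (\<lambda>v. v powr (?b - 1) * angular_mean t v)" by simp
  have "(LINT p:half_cylinder|lborel. ?f p) = (LINT x:{0<..}|lborel. LINT y:{0..1}|lborel. ?f (x, y))"
    by (rule fubini_rectangle[OF fi])
  also have "\<dots> = (LINT x:{0<..}|lborel. 2 * exp (- (2 * x)) * ?k (exp (- (2 * x))))"
    by (rule set_lebesgue_integral_cong) (use inner in auto)
  also have "\<dots> = (LINT v:{0<..<1}|lborel. ?k v)"
    by (rule exp_substitution(2)[OF _ _ ki]) auto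
  also have "\<dots> = (LINT v:{0<..<1}|lborel. v powr (?b - 1) * angular_mean t v) / 2" by simp
  finally have F: "(LINT p:half_cylinder|lborel. ?f p) = (LINT v:{0<..<1}|lborel. v powr (?b - 1) * angular_mean t v) / 2" .
  have "(LINT p:half_cylinder|lborel. ?g (fst p)) = (LINT x:{0<..}|lborel. ?g x)"
    by (rule set_integrable_strip(2)[OF g(1)]) auto
  also have "\<dots> = Beta (2 * ?b) (1 - 0)" by (rule g(2))
  also have "\<dots> = 1 / (2 * ?b)" by (rule beta_one[OF b2])
  finally have Gg: "(LINT p:half_cylinder|lborel. ?g (fst p)) = 1 / (2 * ?b)" .
  show "(LINT p:half_cylinder|lborel. exp (t * (closed_kernel (fst p) (snd p) - 1 * fst p + (2 * e) * fst p))
            - exp (t * (- (1 * fst p) + (2 * e) * fst p)))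
     = (LINT v:{0<..<1}|lborel. v powr (?b - 1) * angular_mean t v) / 2 - 1 / (2 * ?b)"
    unfolding eq set_integral_diff(2)[OF fi gi] F Gg ..
qed

section \<open>Open and closed moments correspond under the single-valued map\<close>

lemma Gamma_reflection_real:
  assumes "0 < b" "b < (1::real)"
  shows "1 / Gamma (1 - b) = Gamma b * sin (pi * b) / pi"
proof -
  have "Gamma (of_real b :: complex) * Gamma (1 - of_real b) = of_real pi / sin (of_real pi * of_real b)"
    by (rule Gamma_reflection_complex)
  moreover have "Gamma (1 - of_real b) = complex_of_real (Gamma (1 - b))"
    using Gamma_complex_of_real[of "1 - b"] by simp
  moreover have "sin (of_real pi * of_real b) = complex_of_real (sin (pi * b))"
    by (simp only: sin_of_real[symmetric] of_real_mult)
  ultimately have "complex_of_real (Gamma b * Gamma (1 - b)) = of_real (pi / sin (pi * b))"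
    by (simp only: Gamma_complex_of_real of_real_mult of_real_divide)
  hence "Gamma b * Gamma (1 - b) = pi / sin (pi * b)" by (simp only: of_real_eq_iff)
  moreover have "sin (pi * b) > 0" using assms by (intro sin_gt_zero) auto
  moreover have "Gamma b > 0" "Gamma (1 - b) > 0" using assms by (auto intro: Gamma_real_pos)
  ultimately show ?thesis by (simp add: field_simps)
qed

lemma Gamma_Suc_real:
  assumes "a > 0"
  shows "Gamma (1 + a) = a * Gamma (a :: real)"
proof -
  have "a \<notin> \<int>\<^sub>\<le>\<^sub>0" using assms by (auto elim!: nonpos_Ints_cases)
  from Gamma_plus1[OF this] show ?thesis by (simp only: add.commute)
qed

lemma beta_sum_reflection:
  assumes t: "0 < t" "t < (1::real)" and ab: "a > 0" "b > 0" "a + b = t"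
  shows "a * b * (Beta a (1 - t) + Beta b (1 - t)) =
     Gamma (1 + a) * Gamma (1 + b) * Gamma (1 - t) * ((sin (pi * a) + sin (pi * b)) / pi)"
proof -
  have B: "Beta a (1 - t) = Gamma a * Gamma (1 - t) * (Gamma b * sin (pi * b) / pi)"
    if "a > 0" "b > 0" "a + b = t" for a b
  proof -
    have *: "a + (1 - t) = 1 - b" using that by simp
    have "Beta a (1 - t) = Gamma a * Gamma (1 - t) * (1 / Gamma (1 - b))" unfolding Beta_def * by simp
    also have "1 / Gamma (1 - b) = Gamma b * sin (pi * b) / pi"
      by (rule Gamma_reflection_real) (use that t in auto)
    finally show ?thesis .
  qed
  have "b + a = t" using ab by simp
  show ?thesis
    unfolding B[OF ab] B[OF ab(2,1) \<open>b + a = t\<close>] Gamma_Suc_real[OF ab(1)] Gamma_Suc_real[OF ab(2)]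
    by (simp add: field_simps)
qed

lemma beta_product_ratio:
  assumes t: "0 < t" "t < (1::real)" and ab: "a > 0" "b > 0" "a + b = t"
  shows "a * b * (Beta a (1 - t) * Beta b (1 - t) / (Gamma t * Gamma (1 - t))) =
     t * (Gamma (1 + a) * Gamma (1 + b) * Gamma (1 - t) / (Gamma (1 - a) * Gamma (1 - b) * Gamma (1 + t)))"
proof -
  have *: "a + (1 - t) = 1 - b" "b + (1 - t) = 1 - a" using ab by auto
  have B: "Beta a (1 - t) = Gamma a * Gamma (1 - t) / Gamma (1 - b)"
          "Beta b (1 - t) = Gamma b * Gamma (1 - t) / Gamma (1 - a)" unfolding Beta_def * by auto
  have ne: "Gamma (1 - t) \<noteq> 0" "Gamma (1 - a) \<noteq> 0" "Gamma (1 - b) \<noteq> 0" "Gamma t \<noteq> 0"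
    by (rule less_imp_neq[OF Gamma_real_pos, symmetric]; use t ab in simp)+
  show ?thesis using t ne
    unfolding B Gamma_Suc_real[OF ab(1)] Gamma_Suc_real[OF ab(2)] Gamma_Suc_real[OF t(1)]
    by (simp add: divide_simps)
qed

lemma gamma_triple_of_real:
  "gamma_triple e (of_real t) = of_real (Gamma (1 + t * (1/2 + e)) * Gamma (1 + t * (1/2 - e)) * Gamma (1 - t))"
proof -
  have "1 + of_real (1/2 + e) * of_real t = complex_of_real (1 + t * (1/2 + e))"
       "1 + of_real (1/2 - e) * of_real t = complex_of_real (1 + t * (1/2 - e))"
       "1 - of_real t = complex_of_real (1 - t)" by (simp_all add: algebra_simps)
  thus ?thesis unfolding gamma_triple_def by (simp only: Gamma_complex_of_real of_real_mult)
qed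

interpretation open_kernel: torus_kernel "\<lambda>x y. edge_log x" "1/2"
  by (rule open_kernel_torus_kernel)

interpretation closed_kernel: torus_kernel closed_kernel 1
  by (rule closed_kernel_torus_kernel)

lemma power_series_shift:
  fixes g :: "nat \<Rightarrow> real"
  assumes "(\<lambda>N. g N * t ^ N) sums s"
  shows "(\<lambda>n. (if n < j then 0 else g (n - j)) * t ^ n) sums (t ^ j * s)"
proof -
  let ?d = "\<lambda>n. (if n < j then 0 else g (n - j)) * t ^ n"
  have "(\<lambda>N. ?d (N + j)) sums (t ^ j * s)"
    using sums_mult[OF assms, of "t ^ j"] by (simp add: power_add mult_ac)
  moreover have "(\<Sum>i<j. ?d i) = 0" by simp
  ultimately show ?thesis using sums_iff_shift[of ?d j "t ^ j * s"] by simp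
qed

text \<open>Multiplied by \<open>a b = t\<^sup>2 (1/4 - e\<^sup>2)\<close>, the open generating function is the series of \<open>open_series_fps\<close> minus the
term \<open>t\<close>, hence the index \<open>N + 2\<close>.\<close>

lemma open_coefficient_identity:
  assumes e: "0 < e" "e < 1/2"
  shows "(1/4 - e\<^sup>2) * (open_kernel.gen_coeff N e + open_kernel.gen_coeff N (- e)) = poly (open_series_poly (N + 2)) e"
proof -
  let ?g = "\<lambda>N. (1/4 - e\<^sup>2) * (open_kernel.gen_coeff N e + open_kernel.gen_coeff N (- e))"
  let ?R = "\<lambda>t. Gamma (1 + t * (1/2 + e)) * Gamma (1 + t * (1/2 - e)) * Gamma (1 - t) *
     ((sin (pi * (t * (1/2 + e))) + sin (pi * (t * (1/2 - e)))) / pi)"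
  define d where "d = (\<lambda>n. (if n < 2 then 0 else ?g (n - 2)) + (if n = 1 then 1 else 0))"
  obtain r where r: "0 < r" "\<And>t. 0 < t \<Longrightarrow> t < r \<Longrightarrow> (\<lambda>n. poly (open_series_poly n) e * t ^ n) sums ?R t"
  proof (rule has_fps_expansion_real_sums[OF open_series_fps[of e]])
    fix t :: real
    have *: "of_real (pi * (1/2 + e)) * of_real t = complex_of_real (pi * (t * (1/2 + e)))"
         "of_real (pi * (1/2 - e)) * of_real t = complex_of_real (pi * (t * (1/2 - e)))"
      by (simp_all add: algebra_simps)
    show "gamma_triple e (of_real t) * ((sin (of_real (pi * (1/2 + e)) * of_real t) +
        sin (of_real (pi * (1/2 - e)) * of_real t)) / of_real pi) = of_real (?R t)"
      unfolding * gamma_triple_of_real unfolding sin_of_real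
      unfolding of_real_add[symmetric] unfolding of_real_divide[symmetric] unfolding of_real_mult[symmetric] ..
  qed blast
  have "(\<lambda>n. d n * t ^ n) sums ?R t" if t: "0 < t" "t < 1/64" for t
  proof -
    have t': "0 < t" "t \<le> 1/64" "t < 1" using t by auto
    define a b where "a = t * (1/2 + e)" and "b = t * (1/2 - e)"
    have "a > 0" "b > 0" using t e by (simp_all add: a_def b_def)
    moreover have "a + b = t" by (simp add: a_def b_def algebra_simps)
    ultimately have ab: "a > 0" "b > 0" "a + b = t" by blast+
    have abt: "a * b = t\<^sup>2 * (1/4 - e\<^sup>2)" by (simp add: a_def b_def power2_eq_square algebra_simps)
    have "(\<lambda>N. open_kernel.gen_coeff N e * t ^ N) sums (Beta b (1 - t) - 1 / b)"
      using open_kernel.gen_coeff_sums(2)[OF t'(1,2), of e] open_generating_integral[OF t'(1,3), of e] e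
      by (simp add: b_def)
    moreover have "(\<lambda>N. open_kernel.gen_coeff N (- e) * t ^ N) sums (Beta a (1 - t) - 1 / a)"
      using open_kernel.gen_coeff_sums(2)[OF t'(1,2), of "- e"] open_generating_integral[OF t'(1,3), of "- e"] e
      by (simp add: a_def)
    ultimately have "(\<lambda>N. (1/4 - e\<^sup>2) * (open_kernel.gen_coeff N e * t ^ N + open_kernel.gen_coeff N (- e) * t ^ N))
        sums ((1/4 - e\<^sup>2) * ((Beta b (1 - t) - 1 / b) + (Beta a (1 - t) - 1 / a)))"
      by (intro sums_mult sums_add)
    hence "(\<lambda>N. ?g N * t ^ N) sums ((1/4 - e\<^sup>2) * ((Beta b (1 - t) - 1 / b) + (Beta a (1 - t) - 1 / a)))"
      by (simp add: algebra_simps)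
    from power_series_shift[OF this, of 2]
    have "(\<lambda>n. (if n < 2 then 0 else ?g (n - 2)) * t ^ n) sums
        (t\<^sup>2 * ((1/4 - e\<^sup>2) * ((Beta b (1 - t) - 1 / b) + (Beta a (1 - t) - 1 / a))))" .
    moreover have "(\<lambda>n. (if n = 1 then 1 else 0) * t ^ n) sums t"
      using sums_single[of 1 "\<lambda>n. t ^ n"] by (simp add: if_distrib[of "\<lambda>x. x * _"] cong: if_cong)
    ultimately have "(\<lambda>n. d n * t ^ n) sums (a * b * ((Beta b (1 - t) - 1 / b) + (Beta a (1 - t) - 1 / a)) + t)"
      using sums_add unfolding d_def abt by (simp add: distrib_right mult.assoc)
    also have "a * b * ((Beta b (1 - t) - 1 / b) + (Beta a (1 - t) - 1 / a)) + t
        = a * b * (Beta a (1 - t) + Beta b (1 - t))"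
      using ab by (simp add: field_simps)
    also have "\<dots> = ?R t"
      using beta_sum_reflection[OF t'(1,3) ab] by (simp add: a_def b_def)
    finally show ?thesis .
  qed
  hence "(\<lambda>n. poly (open_series_poly n) e) = d"
    using r by (intro power_series_unique_right[of "min r (1/64)" _ ?R]) auto
  hence "poly (open_series_poly (N + 2)) e = d (N + 2)" by (rule fun_cong)
  thus ?thesis by (simp add: d_def)
qed

text \<open>Here the factor \<open>a b / t\<close> suffices, hence the index \<open>N + 1\<close>.\<close>

lemma closed_coefficient_identity:
  assumes e: "0 < e" "e < 1/2"
  shows "(1/4 - e\<^sup>2) * (2 * (closed_kernel.gen_coeff N (2 * e) + closed_kernel.gen_coeff N (2 * - e)))
     = poly (exp_series_poly closed_weight (N + 1)) e"
proof -
  let ?g = "\<lambda>N. (1/4 - e\<^sup>2) * (2 * (closed_kernel.gen_coeff N (2 * e) + closed_kernel.gen_coeff N (2 * - e)))"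
  let ?R = "\<lambda>t. (Gamma (1 + t * (1/2 + e)) * Gamma (1 + t * (1/2 - e)) * Gamma (1 - t)) /
     (Gamma (1 + - t * (1/2 + e)) * Gamma (1 + - t * (1/2 - e)) * Gamma (1 - - t))"
  define d where "d = (\<lambda>n. (if n < 1 then 0 else ?g (n - 1)) + (if n = 0 then 1 else 0))"
  obtain r where r: "0 < r" "\<And>t. 0 < t \<Longrightarrow> t < r \<Longrightarrow>
      (\<lambda>n. poly (exp_series_poly closed_weight n) e * t ^ n) sums ?R t"
  proof (rule has_fps_expansion_real_sums[OF gamma_ratio_fps[of e]])
    fix t :: real
    show "gamma_ratio e (of_real t) = of_real (?R t)"
      unfolding gamma_ratio_def of_real_minus[symmetric] gamma_triple_of_real of_real_divide ..
  qed blast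
  have "(\<lambda>n. d n * t ^ n) sums ?R t" if t: "0 < t" "t < 1/64" for t
  proof -
    have t': "0 < t" "t \<le> 1/64" "t < 1" using t by auto
    define a b where "a = t * (1/2 + e)" and "b = t * (1/2 - e)"
    have "a > 0" "b > 0" using t e by (simp_all add: a_def b_def)
    moreover have "a + b = t" by (simp add: a_def b_def algebra_simps)
    ultimately have ab: "a > 0" "b > 0" "a + b = t" by blast+
    have abt: "a * b = t\<^sup>2 * (1/4 - e\<^sup>2)" by (simp add: a_def b_def power2_eq_square algebra_simps)
    let ?M = "\<lambda>c. LINT v:{0<..<1}|lborel. v powr (c - 1) * angular_mean t v"
    have e1: "\<bar>e\<bar> < 1/2" "\<bar>- e\<bar> < 1/2" "\<bar>2 * e\<bar> \<le> 1" "\<bar>2 * - e\<bar> \<le> 1" using e by auto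
    note c1 = closed_generating_integral[OF t'(1,2) e1(1), folded b_def]
    have a_eq: "t * (1/2 - - e) = a" by (simp add: a_def)
    note c2 = closed_generating_integral[OF t'(1,2) e1(2), unfolded a_eq]
    have "(\<lambda>N. closed_kernel.gen_coeff N (2 * e) * t ^ N) sums (?M b / 2 - 1 / (2 * b))"
      using closed_kernel.gen_coeff_sums(2)[OF t'(1,2) e1(3)] unfolding c1(2) .
    moreover have "(\<lambda>N. closed_kernel.gen_coeff N (2 * - e) * t ^ N) sums (?M a / 2 - 1 / (2 * a))"
      using closed_kernel.gen_coeff_sums(2)[OF t'(1,2) e1(4)] unfolding c2(2) .
    ultimately have "(\<lambda>N. (1/4 - e\<^sup>2) * (2 * (closed_kernel.gen_coeff N (2 * e) * t ^ N + closed_kernel.gen_coeff N (2 * - e) * t ^ N)))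
        sums ((1/4 - e\<^sup>2) * (2 * ((?M b / 2 - 1 / (2 * b)) + (?M a / 2 - 1 / (2 * a)))))"
      by (intro sums_mult sums_add)
    also have "2 * ((?M b / 2 - 1 / (2 * b)) + (?M a / 2 - 1 / (2 * a))) = (?M a + ?M b) - 1 / a - 1 / b"
      using ab(1,2) by (simp add: field_simps)
    also have "?M a + ?M b = Beta a (1 - t) * Beta b (1 - t) / (Gamma t * Gamma (1 - t))"
      by (rule klt_mellin_sum[OF t'(1,3) ab c2(1) c1(1)])
    finally have "(\<lambda>N. ?g N * t ^ N) sums ((1/4 - e\<^sup>2) *
        (Beta a (1 - t) * Beta b (1 - t) / (Gamma t * Gamma (1 - t)) - 1 / a - 1 / b))"
      by (simp add: algebra_simps)
    from power_series_shift[OF this, of 1]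
    have "(\<lambda>n. (if n < 1 then 0 else ?g (n - 1)) * t ^ n) sums (t ^ 1 * ((1/4 - e\<^sup>2) *
        (Beta a (1 - t) * Beta b (1 - t) / (Gamma t * Gamma (1 - t)) - 1 / a - 1 / b)))" .
    moreover have "(\<lambda>n. (if n = 0 then 1 else 0) * t ^ n) sums 1"
      using sums_single[of 0 "\<lambda>n. t ^ n"] by (simp add: if_distrib[of "\<lambda>x. x * _"] cong: if_cong)
    ultimately have "(\<lambda>n. (if n < 1 then 0 else ?g (n - 1)) * t ^ n + (if n = 0 then 1 else 0) * t ^ n) sums (t ^ 1 * ((1/4 - e\<^sup>2) *
        (Beta a (1 - t) * Beta b (1 - t) / (Gamma t * Gamma (1 - t)) - 1 / a - 1 / b)) + 1)"
      by (rule sums_add)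
    hence "(\<lambda>n. d n * t ^ n) sums (t ^ 1 * ((1/4 - e\<^sup>2) *
        (Beta a (1 - t) * Beta b (1 - t) / (Gamma t * Gamma (1 - t)) - 1 / a - 1 / b)) + 1)"
      by (simp only: d_def distrib_right)
    also have "t ^ 1 * ((1/4 - e\<^sup>2) *
        (Beta a (1 - t) * Beta b (1 - t) / (Gamma t * Gamma (1 - t)) - 1 / a - 1 / b)) + 1 = ?R t"
    proof -
      let ?B = "Beta a (1 - t) * Beta b (1 - t) / (Gamma t * Gamma (1 - t))"
      have "t ^ 1 * ((1/4 - e\<^sup>2) * (?B - 1 / a - 1 / b)) + 1 = (a * b * (?B - 1 / a - 1 / b)) / t + 1"
        using t unfolding abt by (simp add: power2_eq_square)
      also have "a * b * (?B - 1 / a - 1 / b) = a * b * ?B - t"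
        using ab(1,2) unfolding right_diff_distrib ab(3)[symmetric] by simp
      also have "(a * b * ?B - t) / t + 1 = (a * b * ?B) / t" using t by (simp add: diff_divide_distrib)
      also have "a * b * ?B = t * ?R t"
        unfolding beta_product_ratio[OF t'(1,3) ab] by (simp add: a_def b_def)
      finally show ?thesis using t by simp
    qed
    finally show ?thesis .
  qed
  hence "(\<lambda>n. poly (exp_series_poly closed_weight n) e) = d"
    using r by (intro power_series_unique_right[of "min r (1/64)" _ ?R]) auto
  hence "poly (exp_series_poly closed_weight (N + 1)) e = d (N + 1)" by (rule fun_cong)
  thus ?thesis by (simp add: d_def)
qed

text \<open>Comparing coefficients in the two preceding identities. The coefficient of \<open>e\<^bsup>2 m\<^esup>\<close> carries \<open>2\<^bsup>2 m\<^esup>\<close> on the closed side because of the slope parameter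
\<open>2 e\<close>, and the remaining factor \<open>2\<close> compares \<open>1 / (a b)\<close> with \<open>1 / (2 a b)\<close>.\<close>

theorem sv_maps_moment:
  assumes sv: "single_valued_projection sv"
  shows "sv_maps sv (open_kernel.moment (2 * m) n) (2 * 4 ^ m * closed_kernel.moment (2 * m) n)"
proof -
  define N where "N = 2 * m + n"
  \<comment> \<open>adding the values at \<open>e\<close> and \<open>- e\<close> kills the odd powers of \<open>e\<close>\<close>
  define c where "c = (\<lambda>k. real (N choose k) / fact N * open_kernel.moment k (N - k) * (1 + (-1) ^ k))"
  define c' where "c' = (\<lambda>k. 2 * (real (N choose k) / fact N * closed_kernel.moment k (N - k) * 2 ^ k * (1 + (-1) ^ k)))"
  have "sv_maps sv (c (2 * m)) (c' (2 * m))"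
  proof (rule sv_maps_coefficients[OF sv, where N = N and n = "N + 1"])
    fix e :: real assume e: "0 < e" "e < 1/2"
    have "(\<Sum>k\<le>N. c k * e ^ k) = open_kernel.gen_coeff N e + open_kernel.gen_coeff N (- e)"
      unfolding open_kernel.gen_coeff_moments sum.distrib[symmetric] c_def
      by (intro sum.cong refl) (simp add: power_minus[of e] algebra_simps add_divide_distrib)
    thus "(1/4 - e\<^sup>2) * (\<Sum>k\<le>N. c k * e ^ k) = poly (open_series_poly (Suc (N + 1))) e"
      using open_coefficient_identity[OF e, of N] by simp
    have neg: "(2 * - e) ^ k = (-1) ^ k * 2 ^ k * e ^ k" for k
      unfolding power_mult_distrib power_minus[of e] by simp
    have "(\<Sum>k\<le>N. c' k * e ^ k) = 2 * (closed_kernel.gen_coeff N (2 * e) + closed_kernel.gen_coeff N (2 * - e))"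
      unfolding closed_kernel.gen_coeff_moments sum.distrib[symmetric] c'_def sum_distrib_left
      by (intro sum.cong refl) (simp only: neg, simp add: power_mult_distrib algebra_simps add_divide_distrib)
    thus "(1/4 - e\<^sup>2) * (\<Sum>k\<le>N. c' k * e ^ k) = poly (exp_series_poly closed_weight (N + 1)) e"
      using closed_coefficient_identity[OF e, of N] by simp
  qed (simp add: N_def)
  moreover define q where "q = real (N choose (2 * m)) / fact N * 2"
  have "c (2 * m) = q * open_kernel.moment (2 * m) n"
    by (simp add: c_def q_def N_def)
  moreover have "c' (2 * m) = q * (2 * 4 ^ m * closed_kernel.moment (2 * m) n)"
    by (simp add: c'_def q_def N_def power_mult)
  ultimately have 1: "sv_maps sv (q * open_kernel.moment (2 * m) n) (q * (2 * 4 ^ m * closed_kernel.moment (2 * m) n))"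
    by simp
  have "q = real (N choose (2 * m)) / of_nat (fact N) * 2" by (simp add: q_def)
  hence "q \<in> \<rat>" by (simp only:) (intro Rats_mult Rats_divide Rats_of_nat Rats_number_of)
  hence "1 / q \<in> \<rat>" by (intro Rats_divide) auto
  from sv_maps_cmult[OF sv this 1] have "sv_maps sv (1 / q * (q * open_kernel.moment (2 * m) n))
      (1 / q * (q * (2 * 4 ^ m * closed_kernel.moment (2 * m) n)))" .
  moreover have "q \<noteq> 0" by (simp add: q_def N_def)
  ultimately show ?thesis by simp
qed

section \<open>Asymptotics of the theta function\<close>

text \<open>Bounding the logarithms of the partial products and passing to the limit avoids the logarithm of an infinite product.\<close>

lemma prodinf_one_minus_bound:
  fixes a :: "nat \<Rightarrow> complex"
  assumes s: "summable (\<lambda>n. cmod (a n))" and half: "\<And>n. cmod (a n) \<le> 1/2"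
  shows "convergent_prod (\<lambda>n. 1 - a n)" "prodinf (\<lambda>n. 1 - a n) \<noteq> 0"
    and "\<bar>ln (cmod (prodinf (\<lambda>n. 1 - a n)))\<bar> \<le> 2 * suminf (\<lambda>n. cmod (a n))"
proof -
  have nz: "1 - a n \<noteq> 0" for n using half[of n] by auto
  have "summable (\<lambda>n. norm ((1 - a n) - 1))" using s by (simp add: norm_minus_commute)
  hence "abs_convergent_prod (\<lambda>n. 1 - a n)" by (rule summable_imp_abs_convergent_prod)
  thus cp: "convergent_prod (\<lambda>n. 1 - a n)" by (rule abs_convergent_prod_imp_convergent_prod)
  show P: "prodinf (\<lambda>n. 1 - a n) \<noteq> 0" by (rule prodinf_nonzero[OF cp nz])
  let ?S = "suminf (\<lambda>n. cmod (a n))"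
  have one: "\<bar>ln (cmod (1 - a n))\<bar> \<le> 2 * cmod (a n)" for n
  proof -
    let ?r = "cmod (a n)"
    have lo: "1 - ?r \<le> cmod (1 - a n)" using norm_triangle_ineq2[of 1 "a n"] by simp
    have hi: "cmod (1 - a n) \<le> 1 + ?r" using norm_triangle_ineq4[of 1 "a n"] by simp
    have pos: "cmod (1 - a n) > 0" using nz by simp
    have "ln (cmod (1 - a n)) \<le> cmod (1 - a n) - 1" by (rule ln_le_minus_one[OF pos])
    hence u: "ln (cmod (1 - a n)) \<le> 2 * ?r" using hi norm_ge_zero[of "a n"] by linarith
    have "1 / cmod (1 - a n) \<le> 1 / (1 - ?r)" using lo half[of n] by (intro frac_le) auto
    moreover have "1 / (1 - ?r) \<le> 1 + 2 * ?r" 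
    proof -
      have "0 \<le> ?r * (1 - 2 * ?r)" using half[of n] by (intro mult_nonneg_nonneg) auto
      thus ?thesis using half[of n] by (simp add: divide_le_eq algebra_simps)
    qed
    moreover have "ln (1 / cmod (1 - a n)) \<le> 1 / cmod (1 - a n) - 1"
      by (rule ln_le_minus_one) (use pos in simp)
    ultimately have "- ln (cmod (1 - a n)) \<le> 2 * ?r" using pos by (simp add: ln_div)
    with u show ?thesis by linarith
  qed
  have part: "\<bar>ln (cmod (\<Prod>i\<le>n. 1 - a i))\<bar> \<le> 2 * ?S" for n
  proof -
    have "ln (cmod (\<Prod>i\<le>n. 1 - a i)) = (\<Sum>i\<le>n. ln (cmod (1 - a i)))"
      using nz by (simp add: prod_norm[symmetric] ln_prod)
    hence "\<bar>ln (cmod (\<Prod>i\<le>n. 1 - a i))\<bar> \<le> (\<Sum>i\<le>n. 2 * cmod (a i))"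
      using sum_abs[of "\<lambda>i. ln (cmod (1 - a i))" "{..n}"] sum_mono[of "{..n}" "\<lambda>i. \<bar>ln (cmod (1 - a i))\<bar>" "\<lambda>i. 2 * cmod (a i)"] one
      by (metis (no_types, lifting) order_trans)
    also have "\<dots> \<le> 2 * ?S"
      unfolding sum_distrib_left[symmetric] by (intro mult_left_mono sum_le_suminf s) auto
    finally show ?thesis .
  qed
  have "(\<lambda>n. \<bar>ln (cmod (\<Prod>i\<le>n. 1 - a i))\<bar>) \<longlonglongrightarrow> \<bar>ln (cmod (prodinf (\<lambda>n. 1 - a n)))\<bar>"
    using P by (intro tendsto_intros convergent_prod_LIMSEQ cp) auto
  thus "\<bar>ln (cmod (prodinf (\<lambda>n. 1 - a n)))\<bar> \<le> 2 * ?S"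
    by (rule LIMSEQ_le_const2) (use part in auto)
qed

lemma geometric_exp_bound:
  fixes a :: "nat \<Rightarrow> complex"
  assumes Y: "Y \<ge> 1" and a: "\<And>n. cmod (a n) \<le> exp (- Y) ^ Suc n"
  shows "summable (\<lambda>n. cmod (a n))" "\<And>n. cmod (a n) \<le> 1/2" "suminf (\<lambda>n. cmod (a n)) \<le> 2 * exp (- Y)"
proof -
  let ?r = "exp (- Y)"
  have "?r \<le> exp (- 1)" using Y by simp
  also have "exp (- 1 :: real) \<le> 1/2" using exp_ge_add_one_self[of 1] by (simp add: exp_minus field_simps)
  finally have r: "?r \<le> 1/2" .
  have g: "(\<lambda>n. ?r ^ Suc n) sums (?r * (1 / (1 - ?r)))"
    unfolding power_Suc by (intro sums_mult geometric_sums) (use r Y in auto)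
  show s: "summable (\<lambda>n. cmod (a n))"
    by (rule summable_comparison_test'[OF sums_summable[OF g], of 0]) (use a in auto)
  show "cmod (a n) \<le> 1/2" for n
  proof -
    have "?r ^ Suc n \<le> ?r ^ 1" using r Y by (intro power_decreasing) auto
    thus ?thesis using a[of n] r unfolding power_one_right by linarith
  qed
  have "suminf (\<lambda>n. cmod (a n)) \<le> ?r * (1 / (1 - ?r))"
    using suminf_le[OF a s sums_summable[OF g]] sums_unique[OF g] by simp
  also have "\<dots> \<le> ?r * 2"
  proof (rule mult_left_mono)
    have "1 / (1 - ?r) \<le> 1 / (1/2)" using r Y by (intro frac_le) auto
    thus "1 / (1 - ?r) \<le> 2" by simp
  qed auto
  finally show "suminf (\<lambda>n. cmod (a n)) \<le> 2 * ?r" by simp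
qed

lemma cmod_exp_two_pi_i: "cmod (exp (2 * of_real pi * \<i> * z)) = exp (- (2 * pi * Im z))"
  by (simp add: norm_exp_eq_Re)

lemma cmod_two_sin_pi:
  "cmod (2 * sin (of_real pi * z)) = exp (pi * Im z) * cmod (1 - exp (2 * of_real pi * \<i> * z))"
proof -
  have "2 * sin (of_real pi * z) = \<i> * exp (- (\<i> * (of_real pi * z))) * (1 - exp (2 * of_real pi * \<i> * z))"
  proof -
    have "exp (- (\<i> * (of_real pi * z))) * exp (2 * of_real pi * \<i> * z) = exp (\<i> * (of_real pi * z))"
      by (simp flip: exp_add add: algebra_simps)
    hence "\<i> * exp (- (\<i> * (of_real pi * z))) * (1 - exp (2 * of_real pi * \<i> * z)) =
        \<i> * (exp (- (\<i> * (of_real pi * z))) - exp (\<i> * (of_real pi * z)))"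
      by (simp add: right_diff_distrib mult.assoc)
    also have "\<dots> = 2 * sin (of_real pi * z)" by (simp add: sin_exp_eq field_simps)
    finally show ?thesis ..
  qed
  thus ?thesis by (simp add: norm_mult norm_exp_eq_Re)
qed

text \<open>Of the factors in the product formula only \<open>1 - w\<close> and \<open>1 - q / w\<close> are not uniformly close to \<open>1\<close>
on the strip. They are the two end terms.\<close>

lemma log_theta_eta:
  assumes z: "Im z = v * Im \<tau>" and v: "0 < v" "v < 1" and Y: "2 * pi * Im \<tau> \<ge> 1"
  defines "Y \<equiv> 2 * pi * Im \<tau>"
  shows "\<bar>ln (cmod (theta1 z \<tau> / dedekind_eta \<tau>)) -
     (- (Y / 12) + Y * v / 2 + ln (cmod (1 - exp (2 * of_real pi * \<i> * z)))
       + ln (cmod (1 - exp (2 * of_real pi * \<i> * (\<tau> - z)))))\<bar> \<le> 8 * exp (- Y)"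
proof -
  define q where "q = nome \<tau>"
  define w where "w = exp (2 * of_real pi * \<i> * z)"
  have Y1: "Y \<ge> 1" using assms by simp
  have nq: "cmod q = exp (- Y)" by (simp add: q_def nome_def cmod_exp_two_pi_i Y_def)
  have nw: "cmod w = exp (- (Y * v))" by (simp add: w_def cmod_exp_two_pi_i Y_def z mult_ac)
  have w0: "w \<noteq> 0" by (simp add: w_def)
  have iw: "exp (- (2 * of_real pi * \<i> * z)) = 1 / w" by (simp add: w_def exp_minus inverse_eq_divide)
  let ?A = "\<lambda>n. q ^ Suc n" and ?B = "\<lambda>n. q ^ Suc n * w" and ?C = "\<lambda>n. q ^ Suc n / w"
  have A: "cmod (?A n) \<le> exp (- Y) ^ Suc n" for n by (simp add: norm_mult norm_power nq)
  have B: "cmod (?B n) \<le> exp (- Y) ^ Suc n" for n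
    using Y1 v by (simp add: norm_mult norm_power nq nw mult_le_cancel_left1 del: power_Suc)
  have C: "cmod (?C (Suc n)) \<le> exp (- Y) ^ Suc n" for n
  proof -
    have "cmod (?C (Suc n)) = exp (- Y) ^ Suc n * (exp (- Y) / exp (- (Y * v)))"
      by (simp add: norm_mult norm_power norm_divide nq nw)
    also have "exp (- Y) / exp (- (Y * v)) = exp (- (Y * (1 - v)))" by (simp add: algebra_simps flip: exp_diff)
    also have "exp (- Y) ^ Suc n * exp (- (Y * (1 - v))) \<le> exp (- Y) ^ Suc n * 1"
      using Y1 v by (intro mult_left_mono) auto
    finally show ?thesis by simp
  qed
  note pA = prodinf_one_minus_bound[OF geometric_exp_bound(1,2)[OF Y1 A]]
  note pB = prodinf_one_minus_bound[OF geometric_exp_bound(1,2)[OF Y1 B]]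
  note pC = prodinf_one_minus_bound[OF geometric_exp_bound(1,2)[OF Y1 C]]
  have cC: "convergent_prod (\<lambda>n. 1 - ?C n)" using pC(1) convergent_prod_Suc_iff[of "\<lambda>n. 1 - ?C n"] 
    by (simp only: convergent_prod_iff_shift[of "\<lambda>n. 1 - ?C n" 1, symmetric] Suc_eq_plus1)
  have "cmod (?C 0) = exp (- (Y * (1 - v)))"
    by (simp add: norm_divide nq nw algebra_simps flip: exp_diff)
  also have "\<dots> < 1" using Y1 v by simp
  finally have C0: "1 - ?C 0 \<noteq> 0" by auto
  have qw: "exp (2 * of_real pi * \<i> * (\<tau> - z)) = ?C 0"
    by (simp add: q_def nome_def w_def right_diff_distrib exp_diff)
  have C_split: "prodinf (\<lambda>n. 1 - ?C n) = (1 - ?C 0) * prodinf (\<lambda>n. 1 - ?C (Suc n))"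
    using prodinf_split_head[OF cC C0] C0 by (simp add: field_simps)
  have prod3: "prodinf (\<lambda>n. (1 - ?A n) * (1 - ?A n * w) * (1 - ?A n * (1 / w))) =
      prodinf (\<lambda>n. 1 - ?A n) * prodinf (\<lambda>n. 1 - ?B n) * prodinf (\<lambda>n. 1 - ?C n)"
    using prodinf_mult[OF convergent_prod_mult[OF pA(1) pB(1)] cC] prodinf_mult[OF pA(1) pB(1)] by simp
  define S where "S = 2 * sin (of_real pi * z)"
  have nS: "cmod S = exp (pi * Im z) * cmod (1 - w)" unfolding S_def w_def by (rule cmod_two_sin_pi)
  have "theta1 z \<tau> = exp (2 * of_real pi * \<i> * \<tau> / 8) * S *
      (prodinf (\<lambda>n. 1 - ?A n) * prodinf (\<lambda>n. 1 - ?B n) * prodinf (\<lambda>n. 1 - ?C n))"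
    unfolding theta1_def q_def[symmetric] iw w_def[symmetric] prod3 by (simp add: S_def)
  moreover have "dedekind_eta \<tau> = exp (2 * of_real pi * \<i> * \<tau> / 24) * prodinf (\<lambda>n. 1 - ?A n)"
    unfolding dedekind_eta_def q_def[symmetric] ..
  ultimately have "theta1 z \<tau> / dedekind_eta \<tau> =
      exp (2 * of_real pi * \<i> * \<tau> / 8) / exp (2 * of_real pi * \<i> * \<tau> / 24) * S *
      prodinf (\<lambda>n. 1 - ?B n) * ((1 - ?C 0) * prodinf (\<lambda>n. 1 - ?C (Suc n)))"
    using pA(2) unfolding C_split by simp
  also have "exp (2 * of_real pi * \<i> * \<tau> / 8) / exp (2 * of_real pi * \<i> * \<tau> / 24) = exp (2 * of_real pi * \<i> * (\<tau> / 12))"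
    by (simp flip: exp_diff)
  finally have "cmod (theta1 z \<tau> / dedekind_eta \<tau>) =
      exp (- (2 * pi * Im (\<tau> / 12))) * (exp (pi * Im z) * cmod (1 - w)) *
      cmod (prodinf (\<lambda>n. 1 - ?B n)) * (cmod (1 - ?C 0) * cmod (prodinf (\<lambda>n. 1 - ?C (Suc n))))"
    by (simp only: norm_mult cmod_exp_two_pi_i nS)
  moreover have "1 - w \<noteq> 0"
  proof -
    have "cmod w < 1" unfolding nw using Y1 v by simp
    thus ?thesis by auto
  qed
  ultimately have "ln (cmod (theta1 z \<tau> / dedekind_eta \<tau>)) =
      - (2 * pi * Im (\<tau> / 12)) + (pi * Im z + ln (cmod (1 - w))) +
      ln (cmod (prodinf (\<lambda>n. 1 - ?B n))) + (ln (cmod (1 - ?C 0)) + ln (cmod (prodinf (\<lambda>n. 1 - ?C (Suc n)))))"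
    using C0 pB(2) pC(2) by (simp add: ln_mult)
  moreover have "2 * pi * Im (\<tau> / 12) = Y / 12" "pi * Im z = Y * v / 2"
    by (simp_all add: Y_def z)
  ultimately have eq: "ln (cmod (theta1 z \<tau> / dedekind_eta \<tau>)) -
     (- (Y / 12) + Y * v / 2 + ln (cmod (1 - w)) + ln (cmod (1 - ?C 0))) =
      ln (cmod (prodinf (\<lambda>n. 1 - ?B n))) + ln (cmod (prodinf (\<lambda>n. 1 - ?C (Suc n))))"
    by simp
  have "\<bar>ln (cmod (prodinf (\<lambda>n. 1 - ?B n)))\<bar> \<le> 4 * exp (- Y)"
    using pB(3) geometric_exp_bound(3)[OF Y1 B] by linarith
  moreover have "\<bar>ln (cmod (prodinf (\<lambda>n. 1 - ?C (Suc n))))\<bar> \<le> 4 * exp (- Y)"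
    using pC(3) geometric_exp_bound(3)[OF Y1 C] by linarith
  ultimately show ?thesis
    unfolding qw w_def[symmetric] eq by (intro order_trans[OF abs_triangle_ineq]) linarith
qed

lemma log_one_minus_exp:
  "ln (cmod (1 - exp (2 * of_real pi * \<i> * z))) = - closed_kernel (2 * pi * Im z) (Re z) / 2"
proof -
  have "exp (2 * of_real pi * \<i> * z) = of_real (exp (- (2 * pi * Im z))) * cis (2 * pi * Re z)"
    by (subst exp_eq_polar) (simp add: mult_ac)
  thus ?thesis by (simp add: closed_kernel_def)
qed

lemma closed_kernel_zero: "x > 0 \<Longrightarrow> closed_kernel x 0 = 2 * edge_log x"
proof -
  assume x: "x > 0"
  have "1 - complex_of_real (exp (- x)) = of_real (1 - exp (- x))" by simp
  hence "cmod (1 - complex_of_real (exp (- x))) = \<bar>1 - exp (- x)\<bar>" by (simp only: norm_of_real)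
  thus ?thesis using x by (simp add: closed_kernel_def edge_log_def)
qed

lemma closed_propagator_expansion:
  assumes z: "Im z = v * Im \<tau>" and v: "0 < v" "v < 1" and Y: "2 * pi * Im \<tau> \<ge> 1"
  defines "Y \<equiv> 2 * pi * Im \<tau>"
  shows "\<bar>closed_propagator z \<tau> - (closed_kernel.worldline Y (Y / 6) v + closed_kernel (Y * v) (Re z)
     + closed_kernel (Y * (1 - v)) (Re \<tau> - Re z))\<bar> \<le> 16 * exp (- Y)"
proof -
  have pos: "Im \<tau> > 0" 
  proof -
    have "0 < 2 * pi * Im \<tau>" using Y by linarith
    thus ?thesis by (simp add: zero_less_mult_iff)
  qed
  have im: "2 * pi * Im z = Y * v" "2 * pi * Im (\<tau> - z) = Y * (1 - v)"
    by (simp_all add: z Y_def algebra_simps)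
  have G: "closed_propagator z \<tau> = - 2 * ln (cmod (theta1 z \<tau> / dedekind_eta \<tau>)) + Y * v\<^sup>2"
  proof -
    have "2 * pi * (Im z)\<^sup>2 / Im \<tau> = Y * v\<^sup>2" using pos by (simp add: z Y_def power2_eq_square)
    moreover have "ln (x\<^sup>2) = 2 * ln x" if "x \<ge> 0" for x :: real
      using that by (cases "x = 0") (auto simp: ln_realpow)
    ultimately show ?thesis unfolding closed_propagator_def by (simp del: norm_divide)
  qed
  show ?thesis
    using log_theta_eta[OF z v Y] unfolding G Y_def[symmetric] log_one_minus_exp im closed_kernel.worldline_def
    by (simp add: algebra_simps)
qed

text \<open>On the imaginary axis both angles vanish, so the closed kernel reduces to twice the open one. The constant
\<open>\<pi>\<^sup>2 / (6 T)\<close> in the propagator is the \<open>\<zeta>(2) / T\<close> that \<open>sv\<close> removes.\<close>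

lemma open_propagator_expansion:
  assumes T: "T \<ge> 1" and v: "0 < v" "v < 1"
  defines "\<tau> \<equiv> \<i> * of_real (T / pi)"
  defines "R \<equiv> - ln (cmod (theta1 (of_real v * \<tau>) \<tau> / dedekind_eta \<tau>)) + T * v\<^sup>2 - pi\<^sup>2 / (6 * T)"
  shows "open_propagator (of_real v * \<tau>) \<tau> = of_real R"
    and "\<bar>R - (open_kernel.worldline (2 * T) (T / 6 - pi\<^sup>2 / (6 * T)) v + edge_log (2 * T * v) + edge_log (2 * T * (1 - v)))\<bar>
      \<le> 8 * exp (- (2 * T))"
proof -
  have im: "2 * pi * Im \<tau> = 2 * T" "Re \<tau> = 0" by (simp_all add: \<tau>_def)
  have "\<i> * of_real pi / \<tau> = of_real (pi\<^sup>2 / T)" using T by (simp add: \<tau>_def power2_eq_square field_simps)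
  moreover have "(of_real v * \<tau>)\<^sup>2 = of_real (- (v\<^sup>2 * T\<^sup>2 / pi\<^sup>2))"
    by (simp add: \<tau>_def power_mult_distrib power_divide)
  ultimately have "\<i> * of_real pi / \<tau> * ((of_real v * \<tau>)\<^sup>2 + 1 / 6) = of_real (pi\<^sup>2 / T * (- (v\<^sup>2 * T\<^sup>2 / pi\<^sup>2) + 1 / 6))"
    by simp
  also have "pi\<^sup>2 / T * (- (v\<^sup>2 * T\<^sup>2 / pi\<^sup>2) + 1 / 6) = - (T * v\<^sup>2) + pi\<^sup>2 / (6 * T)"
    using T by (simp add: field_simps power2_eq_square)
  finally show "open_propagator (of_real v * \<tau>) \<tau> = of_real R"
    unfolding open_propagator_def R_def by simp
  have z: "Im (of_real v * \<tau>) = v * Im \<tau>" by simp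
  have Y: "2 * pi * Im \<tau> \<ge> 1" using T unfolding im by simp
  have im': "2 * pi * Im (of_real v * \<tau>) = 2 * T * v" "2 * pi * Im (\<tau> - of_real v * \<tau>) = 2 * T * (1 - v)"
      "Re (of_real v * \<tau>) = 0" "Re (\<tau> - of_real v * \<tau>) = 0"
    by (simp_all add: \<tau>_def algebra_simps)
  have pos: "2 * T * v > 0" "2 * T * (1 - v) > 0" using T v by auto
  show "\<bar>R - (open_kernel.worldline (2 * T) (T / 6 - pi\<^sup>2 / (6 * T)) v + edge_log (2 * T * v) + edge_log (2 * T * (1 - v)))\<bar>
      \<le> 8 * exp (- (2 * T))"
    using log_theta_eta[OF z v Y] unfolding im log_one_minus_exp im' closed_kernel_zero[OF pos(1)]
      closed_kernel_zero[OF pos(2)] open_kernel.worldline_def R_def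
    by (simp add: algebra_simps)
qed

section \<open>The closed amplitude as an integral over the unit box\<close>

lemma Complex_borel [measurable]: "(\<lambda>p. Complex (snd p) (fst p)) \<in> borel_measurable (borel :: (real \<times> real) measure)"
  unfolding Complex_eq by (intro borel_measurable_continuous_onI continuous_intros)

text \<open>The imaginary part comes first, to match the order of the coordinates of \<open>half_cylinder\<close>.\<close>

lemma lborel_complex: "(lborel :: complex measure) = distr lborel borel (\<lambda>p. Complex (snd p) (fst p))"
proof (rule lborel_eqI)
  fix l u :: complex
  assume le: "\<And>b. b \<in> Basis \<Longrightarrow> l \<bullet> b \<le> u \<bullet> b"
  have lu: "Re l \<le> Re u" "Im l \<le> Im u" using le[of 1] le[of \<i>] by (auto simp: Basis_complex_def)
  have "emeasure (distr lborel borel (\<lambda>p. Complex (snd p) (fst p))) (box l u) =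
      emeasure lborel ((\<lambda>p. Complex (snd p) (fst p)) -` box l u \<inter> space lborel)"
    by (rule emeasure_distr) auto
  also have "(\<lambda>p. Complex (snd p) (fst p)) -` box l u \<inter> space lborel =
      {Im l<..<Im u} \<times> {Re l<..<Re u}"
    by (auto simp: box_def Basis_complex_def)
  also have "emeasure lborel ({Im l<..<Im u} \<times> {Re l<..<Re u}) =
      emeasure lborel {Im l<..<Im u} * emeasure lborel {Re l<..<Re u}"
    by (subst lborel_prod[symmetric], rule lborel.emeasure_pair_measure_Times) auto
  also have "\<dots> = ennreal (Im u - Im l) * ennreal (Re u - Re l)" using lu by simp
  also have "\<dots> = ennreal (\<Prod>b\<in>Basis. (u - l) \<bullet> b)"
    using lu by (simp add: Basis_complex_def ennreal_mult mult.commute)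
  finally show "emeasure (distr lborel borel (\<lambda>p. Complex (snd p) (fst p))) (box l u) = (\<Prod>b\<in>Basis. (u - l) \<bullet> b)" .
qed simp

lemma theta_factor_convergent:
  assumes "cmod q < 1"
  shows "convergent_prod (\<lambda>n. 1 - q ^ Suc n * c)"
proof -
  have "summable (\<lambda>n. cmod q ^ Suc n * cmod c)"
    using assms by (intro summable_mult2) (simp add: summable_geometric summable_mult)
  hence "summable (\<lambda>n. norm ((1 - q ^ Suc n * c) - 1))"
    by (simp add: norm_minus_commute norm_mult norm_power)
  hence "abs_convergent_prod (\<lambda>n. 1 - q ^ Suc n * c)" by (rule summable_imp_abs_convergent_prod)
  thus ?thesis by (rule abs_convergent_prod_imp_convergent_prod)
qed

lemma nome_small: "Im \<tau> > 0 \<Longrightarrow> cmod (nome \<tau>) < 1"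
  by (simp add: nome_def cmod_exp_two_pi_i)

lemma theta1_borel:
  assumes \<tau>: "Im \<tau> > 0"
  shows "(\<lambda>z. theta1 z \<tau>) \<in> borel_measurable borel"
proof -
  let ?q = "nome \<tau>"
  let ?f = "\<lambda>z n. (1 - ?q ^ Suc n) * (1 - ?q ^ Suc n * exp (2 * of_real pi * \<i> * z))
                   * (1 - ?q ^ Suc n * exp (- (2 * of_real pi * \<i> * z)))"
  have q: "cmod ?q < 1" by (rule nome_small[OF \<tau>])
  have "convergent_prod (?f z)" for z
    using theta_factor_convergent[OF q, of 1] by (intro convergent_prod_mult theta_factor_convergent q) simp
  hence lim: "(\<lambda>n. \<Prod>i\<le>n. ?f z i) \<longlonglongrightarrow> prodinf (?f z)" for z by (rule convergent_prod_LIMSEQ)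
  have "(\<lambda>z. prodinf (?f z)) \<in> borel_measurable borel"
  proof (rule borel_measurable_LIMSEQ_metric[OF _ lim])
    show "(\<lambda>z. \<Prod>i\<le>n. ?f z i) \<in> borel_measurable borel" for n
      by (intro borel_measurable_continuous_onI continuous_intros)
  qed
  moreover have "(\<lambda>z::complex. 2 * exp (2 * of_real pi * \<i> * \<tau> / 8) * sin (of_real pi * z)) \<in> borel_measurable borel"
    by (intro borel_measurable_continuous_onI continuous_intros)
  ultimately show ?thesis unfolding theta1_def by (rule borel_measurable_times[rotated])
qed

lemma theta1_periodic: "theta1 (z + 1) \<tau> = - theta1 z \<tau>"
proof -
  have 1: "exp (2 * of_real pi * \<i> * (z + 1)) = exp (2 * of_real pi * \<i> * z)"
    by (simp add: distrib_left exp_add)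
  have 2: "exp (- (2 * of_real pi * \<i> * (z + 1))) = exp (- (2 * of_real pi * \<i> * z))"
    unfolding exp_minus 1 ..
  have 3: "sin (of_real pi * (z + 1)) = - sin (of_real pi * z)"
    by (simp add: distrib_left sin_add flip: sin_of_real cos_of_real)
  show ?thesis unfolding theta1_def 1 2 3 by simp
qed

lemma closed_propagator_periodic: "closed_propagator (z + 1) \<tau> = closed_propagator z \<tau>"
  unfolding closed_propagator_def theta1_periodic by (simp add: norm_divide)

lemma closed_propagator_borel:
  assumes "Im \<tau> > 0"
  shows "(\<lambda>z. closed_propagator z \<tau>) \<in> borel_measurable borel"
proof -
  note [measurable] = theta1_borel[OF assms]
  have [measurable]: "Im \<in> borel_measurable borel" by (intro borel_measurable_continuous_onI continuous_intros)
  show ?thesis unfolding closed_propagator_def by measurable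
qed

text \<open>At fixed \<open>v\<close> the fundamental parallelogram is an interval of length one that starts at \<open>v Re \<tau>\<close>. By periodicity
it can be replaced by the unit interval. The assumption \<open>bnd\<close> makes the slices integrable for every \<open>v\<close>, and not only
for almost every one.\<close>

lemma closed_D_eq:
  assumes \<tau>: "Im \<tau> > 0"
    and int: "set_integrable lborel unit_box (\<lambda>p. closed_propagator (Complex (snd p) (fst p * Im \<tau>)) \<tau> ^ l)"
    and bnd: "\<And>v. 0 < v \<Longrightarrow> v < 1 \<Longrightarrow> \<exists>B. \<forall>x. \<bar>closed_propagator (Complex x (v * Im \<tau>)) \<tau>\<bar> \<le> B"
  shows "closed_D l \<tau> = (LINT p:unit_box|lborel. closed_propagator (Complex (snd p) (fst p * Im \<tau>)) \<tau> ^ l)"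
proof -
  let ?y = "Im \<tau>"
  let ?G = "\<lambda>z. closed_propagator z \<tau> ^ l"
  let ?g = "\<lambda>v x. ?G (Complex x (v * ?y))"
  note [measurable] = closed_propagator_borel[OF \<tau>]
  define P where "P = fundamental_parallelogram \<tau>"
  have P_iff: "Complex x (v * ?y) \<in> P \<longleftrightarrow> 0 \<le> v \<and> v < 1 \<and> v * Re \<tau> \<le> x \<and> x < v * Re \<tau> + 1" for x v
  proof
    assume "Complex x (v * ?y) \<in> P"
    then obtain u' v' where uv: "Complex x (v * ?y) = of_real u' + of_real v' * \<tau>" "0 \<le> u'" "u' < 1" "0 \<le> v'" "v' < 1"
      by (auto simp: P_def fundamental_parallelogram_def)
    from uv(1) have "x = u' + v' * Re \<tau>" "v * ?y = v' * ?y" by (auto simp: complex_eq_iff)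
    thus "0 \<le> v \<and> v < 1 \<and> v * Re \<tau> \<le> x \<and> x < v * Re \<tau> + 1" using uv \<tau> by auto
  next
    assume "0 \<le> v \<and> v < 1 \<and> v * Re \<tau> \<le> x \<and> x < v * Re \<tau> + 1"
    thus "Complex x (v * ?y) \<in> P" unfolding P_def fundamental_parallelogram_def
      by (intro CollectI exI[of _ "x - v * Re \<tau>"] exI[of _ v]) (auto simp: complex_eq_iff)
  qed
  let ?Q = "{p::real\<times>real. 0 \<le> fst p \<and> fst p < 1 \<and> fst p * Re \<tau> \<le> snd p \<and> snd p < fst p * Re \<tau> + 1}"
  have Q [measurable]: "?Q \<in> sets borel" by measurable
  have P [measurable]: "P \<in> sets borel"
  proof -
    have [measurable]: "Re \<in> borel_measurable borel" "Im \<in> borel_measurable borel"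
      by (intro borel_measurable_continuous_onI continuous_intros)+
    have "P = {z. 0 \<le> Im z / ?y \<and> Im z / ?y < 1 \<and> Im z / ?y * Re \<tau> \<le> Re z \<and> Re z < Im z / ?y * Re \<tau> + 1}"
    proof (intro set_eqI)
      fix z
      have "z = Complex (Re z) (Im z / ?y * ?y)" using \<tau> by simp
      thus "z \<in> P \<longleftrightarrow> z \<in> {z. 0 \<le> Im z / ?y \<and> Im z / ?y < 1 \<and> Im z / ?y * Re \<tau> \<le> Re z \<and> Re z < Im z / ?y * Re \<tau> + 1}"
        using P_iff[of "Re z" "Im z / ?y"] by (metis (no_types, lifting) mem_Collect_eq)
    qed
    also have "\<dots> \<in> sets borel" by measurable
    finally show ?thesis .
  qed
  let ?h = "\<lambda>z. indicat_real P z *\<^sub>R ?G z"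
  have hm [measurable]: "?h \<in> borel_measurable borel" by measurable
  have "(LINT z:P|lborel. ?G z) = (LINT z|distr lborel borel (\<lambda>p. Complex (snd p) (fst p)). ?h z)"
    unfolding set_lebesgue_integral_def lborel_complex[symmetric] ..
  also have "\<dots> = (LINT p|lborel. ?h (Complex (snd p) (fst p)))"
    by (rule integral_distr) auto
  finally have s1: "(LINT z:P|lborel. ?G z) = (LINT p|lborel. ?h (Complex (snd p) (fst p)))" .
  let ?H = "\<lambda>p::real\<times>real. ?h (Complex (snd p) (fst p))"
  have Hm: "?H \<in> borel_measurable borel" by measurable
  have s2: "(LINT p|lborel. ?H p) = \<bar>?y * 1\<bar> * (LINT p|lborel. ?H (0 + ?y * fst p, 0 + 1 * snd p))"
    by (rule lborel_affine_plane(2)[OF Hm]) (use \<tau> in simp_all)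
  have s3: "?H (0 + ?y * fst p, 0 + 1 * snd p) = indicat_real ?Q p *\<^sub>R ?g (fst p) (snd p)" for p
    using P_iff[of "snd p" "fst p"] by (simp add: indicator_def mult.commute)
  have s4: "(LINT p|lborel. ?H (0 + ?y * fst p, 0 + 1 * snd p)) = (LINT p|lborel. indicat_real ?Q p *\<^sub>R ?g (fst p) (snd p))"
    by (rule Bochner_Integration.integral_cong[OF refl s3])
  have y1: "\<bar>?y * 1\<bar> = ?y" using \<tau> by simp
  have "(LINT z:P|lborel. ?G z) = \<bar>?y * 1\<bar> * (LINT p|lborel. indicat_real ?Q p *\<^sub>R ?g (fst p) (snd p))"
    by (rule trans[OF s1 trans[OF s2 arg_cong[OF s4, of "\<lambda>x. \<bar>?y * 1\<bar> * x"]]])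
  hence 1: "(LINT z:P|lborel. ?G z) = ?y * (LINT p|lborel. indicat_real ?Q p *\<^sub>R ?g (fst p) (snd p))"
    unfolding y1 .
  let ?k = "\<lambda>p. indicat_real ?Q p *\<^sub>R ?g (fst p) (snd p)"
  have gm2: "(\<lambda>p. ?g (fst p) (snd p)) \<in> borel_measurable borel"
  proof -
    have "(\<lambda>p::real\<times>real. Complex (snd p) (fst p * ?y)) \<in> borel_measurable borel"
      unfolding Complex_eq by (intro borel_measurable_continuous_onI continuous_intros)
    from borel_measurable_power[OF measurable_compose[OF this closed_propagator_borel[OF \<tau>]], of l]
    show ?thesis .
  qed
  have gm1: "?g v \<in> borel_measurable borel" for v
  proof -
    have "(\<lambda>x. Complex x (v * ?y)) \<in> borel_measurable borel"
      unfolding Complex_eq by (intro borel_measurable_continuous_onI continuous_intros)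
    from borel_measurable_power[OF measurable_compose[OF this closed_propagator_borel[OF \<tau>]], of l]
    show ?thesis .
  qed
  have "?k \<in> borel_measurable borel"
    by (intro borel_measurable_scaleR borel_measurable_indicator Q gm2)
  hence km: "?k \<in> borel_measurable (lborel \<Otimes>\<^sub>M lborel)"
    by (simp only: lborel_prod measurable_lborel1 measurable_lborel2)
  have km1: "(\<lambda>x. ?k (v, x)) \<in> borel_measurable lborel" for v
    by (rule measurable_compose[OF measurable_Pair1' km]) simp
  have k2: "(\<lambda>(v, x). ?k (v, x)) \<in> borel_measurable (lborel \<Otimes>\<^sub>M lborel)"
    using km by (simp only: case_prod_beta' fst_conv snd_conv prod.collapse)
  have kn: "(\<lambda>(v, x). norm (?k (v, x))) \<in> borel_measurable (lborel \<Otimes>\<^sub>M lborel)"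
    using measurable_compose[OF km borel_measurable_norm]
    by (simp only: case_prod_beta' fst_conv snd_conv prod.collapse)
  have slice: "set_integrable lborel {a..b} (?g v)"
       "(LINT x:{v * Re \<tau>..v * Re \<tau> + 1}|lborel. ?g v x) = (LINT x:{0..1}|lborel. ?g v x)"
       "(LINT x:{v * Re \<tau>..v * Re \<tau> + 1}|lborel. \<bar>?g v x\<bar>) = (LINT x:{0..1}|lborel. \<bar>?g v x\<bar>)"
    if v: "0 < v" "v < 1" for v a b
  proof -
    obtain B where B: "\<And>x. \<bar>closed_propagator (Complex x (v * ?y)) \<tau>\<bar> \<le> B" using bnd[OF v] by blast
    have B': "\<bar>?g v x\<bar> \<le> B ^ l" for x using B[of x] by (simp add: power_abs power_mono)
    note m = gm1[of v]
    have per: "?g v (x + 1) = ?g v x" for x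
    proof -
      have "Complex (x + 1) (v * ?y) = Complex x (v * ?y) + 1" by (simp add: complex_eq_iff)
      thus ?thesis by (simp only: closed_propagator_periodic)
    qed
    show "set_integrable lborel {a..b} (?g v)"
      by (rule set_integrable_bound[where w = "\<lambda>_. B ^ l"])
         (use B' m in \<open>auto intro!: borel_integrable_atLeastAtMost' continuous_intros\<close>)
    show "(LINT x:{v * Re \<tau>..v * Re \<tau> + 1}|lborel. ?g v x) = (LINT x:{0..1}|lborel. ?g v x)"
      by (rule periodic_integral_shift[OF m B' per])
    show "(LINT x:{v * Re \<tau>..v * Re \<tau> + 1}|lborel. \<bar>?g v x\<bar>) = (LINT x:{0..1}|lborel. \<bar>?g v x\<bar>)"
      by (rule periodic_integral_shift[where B = "B ^ l"]) (use B' per m in auto)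
  qed
  have ae: "AE v in lborel. v \<noteq> (0::real)" by (rule AE_lborel_singleton)
  \<comment> \<open>up to a null set, the half-open slices may be closed\<close>
  have kslice: "AE x in lborel. ?k (v, x) = indicator {0<..<1} v * (indicator {v * Re \<tau>..v * Re \<tau> + 1} x * ?g v x)"
    if "v \<noteq> 0" for v
    using AE_lborel_singleton[of "v * Re \<tau> + 1"]
    by eventually_elim (use that in \<open>auto simp: indicator_def\<close>)
  have kint: "integrable (lborel \<Otimes>\<^sub>M lborel) ?k"
  proof (rule lborel_pair.Fubini_integrable[OF km])
    have "set_integrable lborel unit_box (\<lambda>p. \<bar>?g (fst p) (snd p)\<bar>)" using int by (rule set_integrable_abs)
    hence "integrable (lborel \<Otimes>\<^sub>M lborel) (\<lambda>p. indicat_real unit_box p *\<^sub>R \<bar>?g (fst p) (snd p)\<bar>)"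
      by (simp only: set_integrable_def lborel_prod)
    from lborel_pair.integrable_fst'[OF this]
    have i1: "integrable lborel (\<lambda>v. LINT x|lborel. indicat_real unit_box (v, x) *\<^sub>R \<bar>?g v x\<bar>)" by simp
    show "integrable lborel (\<lambda>v. LINT x|lborel. norm (?k (v, x)))"
    proof (rule integrable_cong_AE_imp[OF i1])
      show "(\<lambda>v. LINT x|lborel. norm (?k (v, x))) \<in> borel_measurable lborel"
        by (rule lborel.borel_measurable_lebesgue_integral[OF kn])
      show "AE v in lborel. (LINT x|lborel. indicat_real unit_box (v, x) *\<^sub>R \<bar>?g v x\<bar>) = (LINT x|lborel. norm (?k (v, x)))"
        using ae
      proof eventually_elim
        case (elim v)
        have "(LINT x|lborel. norm (?k (v, x))) =
            (LINT x|lborel. indicator {0<..<1} v * (indicator {v * Re \<tau>..v * Re \<tau> + 1} x * \<bar>?g v x\<bar>))"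
        proof (rule integral_cong_AE)
          show "AE x in lborel. norm (?k (v, x)) = indicator {0<..<1} v * (indicator {v * Re \<tau>..v * Re \<tau> + 1} x * \<bar>?g v x\<bar>)"
            using kslice[OF elim] by eventually_elim (auto simp: abs_mult)
        qed (use km1[of v] gm1[of v] in \<open>simp_all add: borel_measurable_times borel_measurable_indicator\<close>)
        also have "\<dots> = indicator {0<..<1} v * (LINT x:{v * Re \<tau>..v * Re \<tau> + 1}|lborel. \<bar>?g v x\<bar>)"
          by (simp add: set_lebesgue_integral_def)
        also have "\<dots> = indicator {0<..<1} v * (LINT x:{0..1}|lborel. \<bar>?g v x\<bar>)"
          using slice(3)[of v] by (auto simp: indicator_def)
        also have "\<dots> = (LINT x|lborel. indicat_real unit_box (v, x) *\<^sub>R \<bar>?g v x\<bar>)"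
          by (simp add: set_lebesgue_integral_def indicator_times mult.assoc)
        finally show ?case ..
      qed
    qed
    show "AE v in lborel. integrable lborel (\<lambda>x. ?k (v, x))"
      using ae
    proof eventually_elim
      case (elim v)
      have "integrable lborel (\<lambda>x. indicator {0<..<1} v * (indicator {v * Re \<tau>..v * Re \<tau> + 1} x * ?g v x))"
        using slice(1)[of v "v * Re \<tau>" "v * Re \<tau> + 1"] by (auto simp: indicator_def set_integrable_def)
      thus ?case
      proof (rule integrable_cong_AE_imp)
        show "(\<lambda>x. ?k (v, x)) \<in> borel_measurable lborel" by (rule km1)
        show "AE x in lborel. indicator {0<..<1} v * (indicator {v * Re \<tau>..v * Re \<tau> + 1} x * ?g v x) = ?k (v, x)"
          using kslice[OF elim] by eventually_elim (rule sym)
      qed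
    qed
  qed
  have "(LINT p|lborel. ?k p) = (LINT v|lborel. LINT x|lborel. ?k (v, x))"
    using lborel_pair.integral_fst'[OF kint] by (simp only: lborel_prod)
  also have "\<dots> = (LINT v|lborel. indicator {0<..<1} v *\<^sub>R (LINT x:{0..1}|lborel. ?g v x))"
  proof (rule integral_cong_AE)
    show "AE v in lborel. (LINT x|lborel. ?k (v, x)) = indicator {0<..<1} v *\<^sub>R (LINT x:{0..1}|lborel. ?g v x)"
      using ae
    proof eventually_elim
      case (elim v)
      have "(LINT x|lborel. ?k (v, x)) =
            (LINT x|lborel. indicator {0<..<1} v * (indicator {v * Re \<tau>..v * Re \<tau> + 1} x * ?g v x))"
        by (rule integral_cong_AE[OF _ _ kslice[OF elim]])
           (use km1[of v] gm1[of v] in \<open>simp_all add: borel_measurable_times borel_measurable_indicator\<close>)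
      also have "\<dots> = indicator {0<..<1} v * (LINT x:{v * Re \<tau>..v * Re \<tau> + 1}|lborel. ?g v x)"
        by (simp add: set_lebesgue_integral_def)
      also have "\<dots> = indicator {0<..<1} v * (LINT x:{0..1}|lborel. ?g v x)"
        using slice(2)[of v] by (auto simp: indicator_def)
      finally show ?case by simp
    qed
    show "(\<lambda>v. LINT x|lborel. ?k (v, x)) \<in> borel_measurable lborel"
      by (rule lborel.borel_measurable_lebesgue_integral[OF k2])
    show "(\<lambda>v. indicat_real {0<..<1} v *\<^sub>R (LINT x:{0..1}|lborel. ?g v x)) \<in> borel_measurable lborel"
    proof -
      have "(\<lambda>p. indicator {0..1} (snd p) *\<^sub>R ?g (fst p) (snd p)) \<in> borel_measurable (lborel \<Otimes>\<^sub>M lborel)"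
        unfolding lborel_prod measurable_lborel1 measurable_lborel2
        by (intro borel_measurable_scaleR gm2 borel_measurable_indicator' measurable_snd) auto
      hence "(\<lambda>v. LINT x:{0..1}|lborel. ?g v x) \<in> borel_measurable lborel"
        unfolding set_lebesgue_integral_def
        by (intro lborel.borel_measurable_lebesgue_integral) (simp add: case_prod_beta')
      thus ?thesis by (intro borel_measurable_scaleR borel_measurable_indicator) auto
    qed
  qed
  also have "\<dots> = (LINT p:unit_box|lborel. ?g (fst p) (snd p))"
    unfolding fubini_rectangle[OF int] by (simp add: set_lebesgue_integral_def)
  finally show ?thesis unfolding closed_D_def P_def[symmetric] 1 using \<tau> by simp
qed

section \<open>Asymptotics of the two amplitudes\<close>

text \<open>The open propagator at \<open>z = v \<tau>\<close>, as a real number.\<close>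

definition open_line :: "real \<Rightarrow> real \<Rightarrow> real" where
  "open_line T v = - ln (cmod (theta1 (of_real v * (\<i> * of_real (T / pi))) (\<i> * of_real (T / pi)) / dedekind_eta (\<i> * of_real (T / pi))))
     + T * v\<^sup>2 - pi\<^sup>2 / (6 * T)"

lemma open_line_borel:
  assumes "T > 0"
  shows "open_line T \<in> borel_measurable borel"
proof -
  have "Im (\<i> * of_real (T / pi)) > 0" using assms by simp
  note [measurable] = theta1_borel[OF this]
  have [measurable]: "(\<lambda>v. of_real v * (\<i> * of_real (T / pi)) :: complex) \<in> borel_measurable borel"
    by (intro borel_measurable_continuous_onI continuous_intros)
  have [measurable]: "(\<lambda>v. theta1 (of_real v * (\<i> * of_real (T / pi))) (\<i> * of_real (T / pi))) \<in> borel_measurable borel"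
    by measurable
  show ?thesis unfolding open_line_def by measurable
qed

lemma open_B_eq:
  assumes T: "T \<ge> 1" and int: "set_integrable lborel {0<..<1} (\<lambda>v. open_line T v ^ l)"
  shows "open_B l (\<i> * of_real (T / pi)) = of_real (LINT v:{0<..<1}|lborel. open_line T v ^ l)"
proof -
  let ?\<tau> = "\<i> * of_real (T / pi)"
  let ?I = "LINT v:{0<..<1}|lborel. open_line T v ^ l"
  have "((\<lambda>v. open_line T v ^ l) has_integral ?I) {0<..<1}"
    using set_borel_integral_eq_integral[OF int] by (simp add: has_integral_integral)
  hence "((\<lambda>v. open_line T v ^ l) has_integral ?I) {0..1}"
    by (simp add: has_integral_Icc_iff_Ioo)
  hence "((\<lambda>v. of_real (open_line T v ^ l) :: complex) has_integral of_real ?I) {0..1}"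
    by (rule has_integral_of_real)
  hence "((\<lambda>v. open_propagator (linepath 0 ?\<tau> v) ?\<tau> ^ l / ?\<tau> * vector_derivative (linepath 0 ?\<tau>) (at v)) has_integral of_real ?I) {0..1}"
  proof (rule has_integral_spike_finite[of "{0, 1}", rotated 2])
    fix v :: real assume "v \<in> {0..1} - {0, 1}"
    hence v: "0 < v" "v < 1" by auto
    have "linepath 0 ?\<tau> v = of_real v * ?\<tau>" by (simp add: linepath_def scaleR_conv_of_real)
    moreover have "open_propagator (of_real v * ?\<tau>) ?\<tau> = of_real (open_line T v)"
      unfolding open_line_def by (rule open_propagator_expansion(1)[OF T v])
    moreover have "?\<tau> \<noteq> 0" using T by simp
    ultimately show "open_propagator (linepath 0 ?\<tau> v) ?\<tau> ^ l / ?\<tau> * vector_derivative (linepath 0 ?\<tau>) (at v) = of_real (open_line T v ^ l)"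
      by simp
  qed auto
  thus ?thesis unfolding open_B_def contour_integral_integral by (rule integral_unique)
qed

definition open_expansion :: "nat \<Rightarrow> real \<Rightarrow> real" where
  "open_expansion l T = (LINT v:{0<..<1}|lborel. open_kernel.worldline (2 * T) (T / 6 - pi\<^sup>2 / (6 * T)) v ^ l)
     + 2 * open_kernel.moment_sum l (2 * T) (T / 6 - pi\<^sup>2 / (6 * T)) / (2 * T)"

definition closed_expansion :: "nat \<Rightarrow> real \<Rightarrow> real" where
  "closed_expansion l Y = (LINT v:{0<..<1}|lborel. closed_kernel.worldline Y (Y / 6) v ^ l)
     + 2 * closed_kernel.moment_sum l Y (Y / 6) / Y"

lemma open_asymptotics:
  obtains C where "\<And>T. T \<ge> 1 \<Longrightarrow> cmod (open_B l (\<i> * of_real (T / pi)) - of_real (open_expansion l T)) \<le> C * exp (- T)"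
proof -
  obtain C where C: "C \<ge> 0"
    "\<And>K c0 c F. K \<ge> 1 \<Longrightarrow> \<bar>c0\<bar> \<le> (1 + pi\<^sup>2) * K \<Longrightarrow> F \<in> borel_measurable borel \<Longrightarrow>
       (\<And>v y. 0 < v \<Longrightarrow> v < 1 \<Longrightarrow>
          \<bar>F (v, y) - (open_kernel.worldline K c0 v + edge_log (K * v) + edge_log (K * (1 - v)))\<bar> \<le> 8 * exp (- K)) \<Longrightarrow>
       set_integrable lborel unit_box (\<lambda>p. F p ^ l) \<and>
       \<bar>(LINT p:unit_box|lborel. F p ^ l) -
          ((LINT v:{0<..<1}|lborel. open_kernel.worldline K c0 v ^ l) + 2 * open_kernel.moment_sum l K c0 / K)\<bar> \<le> C * exp (- (5 * K / 8))"
    by (rule open_kernel.two_ended_asymptotics[of "1 + pi\<^sup>2" 8 l]) blast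
  have "cmod (open_B l (\<i> * of_real (T / pi)) - of_real (open_expansion l T)) \<le> C * exp (- T)" if T: "T \<ge> 1" for T
  proof -
    let ?c0 = "T / 6 - pi\<^sup>2 / (6 * T)"
    let ?F = "\<lambda>p::real\<times>real. open_line T (fst p)"
    have T0: "T > 0" using T by simp
    note [measurable] = open_line_borel[OF T0]
    have K: "2 * T \<ge> 1" using T by simp
    have c0: "\<bar>?c0\<bar> \<le> (1 + pi\<^sup>2) * (2 * T)"
    proof -
      have "pi\<^sup>2 / (6 * T) \<le> pi\<^sup>2 / 1" using T by (intro divide_left_mono) auto
      moreover have "pi\<^sup>2 * 1 \<le> pi\<^sup>2 * (2 * T)" using T by (intro mult_left_mono) auto
      moreover have "pi\<^sup>2 / (6 * T) \<ge> 0" using T by simp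
      ultimately show ?thesis using T unfolding distrib_right by linarith
    qed
    have Fm: "?F \<in> borel_measurable borel" by measurable
    have F: "\<bar>?F (v, y) - (open_kernel.worldline (2 * T) ?c0 v + edge_log (2 * T * v) + edge_log (2 * T * (1 - v)))\<bar> \<le> 8 * exp (- (2 * T))"
      if "0 < v" "v < 1" for v y
      using open_propagator_expansion(2)[OF T that] unfolding open_line_def fst_conv .
    from C(2)[OF K c0 Fm F]
    have int: "set_integrable lborel unit_box (\<lambda>p. ?F p ^ l)"
      and le: "\<bar>(LINT p:unit_box|lborel. ?F p ^ l) - open_expansion l T\<bar> \<le> C * exp (- (5 * (2 * T) / 8))"
      unfolding open_expansion_def by blast+
    have int1: "set_integrable lborel {0<..<1} (\<lambda>v. open_line T v ^ l)"
    proof -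
      have "integrable (lborel \<Otimes>\<^sub>M lborel) (\<lambda>p. indicat_real unit_box p *\<^sub>R ?F p ^ l)"
        using int by (simp only: set_integrable_def lborel_prod)
      from lborel_pair.integrable_fst'[OF this]
      have "integrable lborel (\<lambda>v. LINT x|lborel. indicat_real unit_box (v, x) *\<^sub>R open_line T v ^ l)" by simp
      also have "(\<lambda>v. LINT x|lborel. indicat_real unit_box (v, x) *\<^sub>R open_line T v ^ l) =
          (\<lambda>v. indicat_real {0<..<1} v *\<^sub>R (LINT x:{0..1::real}|lborel. open_line T v ^ l))"
        by (simp add: set_lebesgue_integral_def indicator_times mult.assoc)
      finally show ?thesis by (simp only: set_integral_unit_const set_integrable_def)
    qed
    have "(LINT p:unit_box|lborel. ?F p ^ l) = (LINT v:{0<..<1}|lborel. open_line T v ^ l)"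
      unfolding fubini_rectangle[OF int] by (simp add: set_integral_unit_const)
    hence "cmod (open_B l (\<i> * of_real (T / pi)) - of_real (open_expansion l T)) = \<bar>(LINT p:unit_box|lborel. ?F p ^ l) - open_expansion l T\<bar>"
      unfolding open_B_eq[OF T int1] by (simp flip: of_real_diff)
    also have "\<dots> \<le> C * exp (- (5 * (2 * T) / 8))" by (rule le)
    also have "\<dots> \<le> C * exp (- T)" using C(1) T by (intro mult_left_mono) auto
    finally show ?thesis .
  qed
  thus thesis using that by blast
qed

lemma closed_asymptotics:
  obtains C where "\<And>\<tau>. 2 * pi * Im \<tau> \<ge> 1 \<Longrightarrow>
    \<bar>closed_D l \<tau> - closed_expansion l (2 * pi * Im \<tau>)\<bar> \<le> C * exp (- (5 / 8) * (2 * pi * Im \<tau>))"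
proof -
  obtain C where C: "C \<ge> 0"
    "\<And>K c0 c F. K \<ge> 1 \<Longrightarrow> \<bar>c0\<bar> \<le> 1 * K \<Longrightarrow> F \<in> borel_measurable borel \<Longrightarrow>
       (\<And>v y. 0 < v \<Longrightarrow> v < 1 \<Longrightarrow>
          \<bar>F (v, y) - (closed_kernel.worldline K c0 v + closed_kernel (K * v) y + closed_kernel (K * (1 - v)) (c - y))\<bar> \<le> 16 * exp (- K)) \<Longrightarrow>
       set_integrable lborel unit_box (\<lambda>p. F p ^ l) \<and>
       \<bar>(LINT p:unit_box|lborel. F p ^ l) -
          ((LINT v:{0<..<1}|lborel. closed_kernel.worldline K c0 v ^ l) + 2 * closed_kernel.moment_sum l K c0 / K)\<bar> \<le> C * exp (- (5 * K / 8))"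
    by (rule closed_kernel.two_ended_asymptotics[of 1 16 l]) blast
  have "\<bar>closed_D l \<tau> - closed_expansion l (2 * pi * Im \<tau>)\<bar> \<le> C * exp (- (5 / 8) * (2 * pi * Im \<tau>))"
    if Y: "2 * pi * Im \<tau> \<ge> 1" for \<tau>
  proof -
    let ?Y = "2 * pi * Im \<tau>"
    let ?F = "\<lambda>p::real\<times>real. closed_propagator (Complex (snd p) (fst p * Im \<tau>)) \<tau>"
    have "0 < 2 * pi * Im \<tau>" using Y by linarith
    hence \<tau>: "Im \<tau> > 0" by (simp add: zero_less_mult_iff)
    have Fm: "?F \<in> borel_measurable borel"
    proof -
      have "(\<lambda>p::real\<times>real. Complex (snd p) (fst p * Im \<tau>)) \<in> borel_measurable borel"
        unfolding Complex_eq by (intro borel_measurable_continuous_onI continuous_intros)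
      from measurable_compose[OF this closed_propagator_borel[OF \<tau>]] show ?thesis .
    qed
    have F: "\<bar>?F (v, y) - (closed_kernel.worldline ?Y (?Y / 6) v + closed_kernel (?Y * v) y + closed_kernel (?Y * (1 - v)) (Re \<tau> - y))\<bar> \<le> 16 * exp (- ?Y)"
      if v: "0 < v" "v < 1" for v y
    proof -
      have "Im (Complex y (v * Im \<tau>)) = v * Im \<tau>" by simp
      from closed_propagator_expansion[OF this v Y] show ?thesis by simp
    qed
    have c0: "\<bar>?Y / 6\<bar> \<le> 1 * ?Y" using Y \<tau> by simp
    from C(2)[OF Y c0 Fm F]
    have int: "set_integrable lborel unit_box (\<lambda>p. ?F p ^ l)"
      and le: "\<bar>(LINT p:unit_box|lborel. ?F p ^ l) - closed_expansion l ?Y\<bar> \<le> C * exp (- (5 * ?Y / 8))"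
      unfolding closed_expansion_def by blast+
    have bnd: "\<exists>B. \<forall>x. \<bar>closed_propagator (Complex x (v * Im \<tau>)) \<tau>\<bar> \<le> B" if v: "0 < v" "v < 1" for v
    proof (intro exI allI)
      fix x
      have "?Y * v > 0" "?Y * (1 - v) > 0" using Y v by auto
      hence "\<bar>closed_kernel (?Y * v) x\<bar> \<le> 2 * edge_log (?Y * v)" "\<bar>closed_kernel (?Y * (1 - v)) (Re \<tau> - x)\<bar> \<le> 2 * edge_log (?Y * (1 - v))"
        by (auto intro: closed_kernel_bound)
      thus "\<bar>closed_propagator (Complex x (v * Im \<tau>)) \<tau>\<bar> \<le>
          \<bar>closed_kernel.worldline ?Y (?Y / 6) v\<bar> + 2 * edge_log (?Y * v) + 2 * edge_log (?Y * (1 - v)) + 16 * exp (- ?Y)"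
        using F[OF v, of x] unfolding fst_conv snd_conv by linarith
    qed
    have D: "closed_D l \<tau> = (LINT p:unit_box|lborel. ?F p ^ l)"
      by (rule closed_D_eq[OF \<tau> int]) (rule bnd)
    have "- (5 / 8) * ?Y = - (5 * ?Y / 8)" by simp
    with le show ?thesis unfolding D by (simp only:)
  qed
  thus thesis using that by blast
qed

section \<open>Uniqueness of the Laurent polynomials\<close>

lemma laurent_eval_superset:
  assumes "finite S" "Poly_Mapping.keys p \<subseteq> S"
  shows "laurent_eval p x = (\<Sum>k\<in>S. Poly_Mapping.lookup p k * x powi k)"
  unfolding laurent_eval_def using assms by (intro sum.mono_neutral_left) (auto simp: in_keys_iff)

lemma laurent_eval_add: "laurent_eval (p + q) x = laurent_eval p x + laurent_eval q x"
proof -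
  let ?S = "Poly_Mapping.keys p \<union> Poly_Mapping.keys q"
  have "laurent_eval (p + q) x = (\<Sum>k\<in>?S. Poly_Mapping.lookup (p + q) k * x powi k)"
    by (rule laurent_eval_superset[OF _ Poly_Mapping.keys_add]) simp
  also have "\<dots> = (\<Sum>k\<in>?S. Poly_Mapping.lookup p k * x powi k) + (\<Sum>k\<in>?S. Poly_Mapping.lookup q k * x powi k)"
    by (simp add: lookup_add distrib_right sum.distrib)
  also have "\<dots> = laurent_eval p x + laurent_eval q x"
    by (simp add: laurent_eval_superset[of ?S])
  finally show ?thesis .
qed

lemma laurent_eval_diff: "laurent_eval (p - q) x = laurent_eval p x - laurent_eval q x"
  using laurent_eval_add[of "p - q" q x] by simp

lemma laurent_eval_single: "laurent_eval (Poly_Mapping.single k c) x = c * x powi k"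
  by (subst laurent_eval_superset[of "{k}"]) auto

lemma powi_neg_tendsto_0:
  assumes "j < (0::int)"
  shows "((\<lambda>x::real. x powi j) \<longlongrightarrow> 0) at_top"
proof -
  define n where "n = nat (- j - 1)"
  have n: "j = - int (Suc n)" using assms by (simp add: n_def)
  have "((\<lambda>x::real. inverse (x ^ Suc n)) \<longlongrightarrow> 0) at_top"
    by (intro tendsto_inverse_0_at_top filterlim_pow_at_top filterlim_ident) auto
  thus ?thesis unfolding n by (simp add: power_int_minus del: power_Suc of_nat_Suc)
qed

text \<open>Divided by its top power, a nonzero Laurent polynomial tends to its leading coefficient, while an
exponentially small function tends to \<open>0\<close>.\<close>

lemma laurent_exponentially_small_eq_0:
  assumes c: "c > 0" and O: "(\<lambda>x. laurent_eval p x) \<in> O[at_top](\<lambda>x. exp (- c * x))"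
  shows "p = 0"
proof (rule ccontr)
  assume "p \<noteq> 0"
  hence ne: "Poly_Mapping.keys p \<noteq> {}" by simp
  define k where "k = Max (Poly_Mapping.keys p)"
  have k: "k \<in> Poly_Mapping.keys p" "\<And>j. j \<in> Poly_Mapping.keys p \<Longrightarrow> j \<le> k"
    unfolding k_def using ne by (auto intro: Max_in)
  \<comment> \<open>crude bound for \<open>x powi (- k)\<close> by a power with natural exponent\<close>
  define m where "m = nat \<bar>k\<bar>"
  have "((\<lambda>x. \<Sum>j\<in>Poly_Mapping.keys p. Poly_Mapping.lookup p j * x powi (j - k)) \<longlongrightarrow>
      (\<Sum>j\<in>Poly_Mapping.keys p. if j = k then Poly_Mapping.lookup p k else 0)) at_top"
  proof (rule tendsto_sum)
    fix j assume j: "j \<in> Poly_Mapping.keys p"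
    show "((\<lambda>x. Poly_Mapping.lookup p j * x powi (j - k)) \<longlongrightarrow> (if j = k then Poly_Mapping.lookup p k else 0)) at_top"
    proof (cases "j = k")
      case False
      hence "j - k < 0" using k(2)[OF j] by simp
      from tendsto_mult_right_zero[OF powi_neg_tendsto_0[OF this]] show ?thesis using False by simp
    qed simp
  qed
  hence lim: "((\<lambda>x. \<Sum>j\<in>Poly_Mapping.keys p. Poly_Mapping.lookup p j * x powi (j - k)) \<longlongrightarrow> Poly_Mapping.lookup p k) at_top"
    using k(1) by simp
  have "((\<lambda>x. laurent_eval p x * x powi (- k)) \<longlongrightarrow> Poly_Mapping.lookup p k) at_top"
  proof (rule Lim_transform_eventually[OF lim])
    show "eventually (\<lambda>x. (\<Sum>j\<in>Poly_Mapping.keys p. Poly_Mapping.lookup p j * x powi (j - k)) = laurent_eval p x * x powi (- k)) at_top"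
      using eventually_gt_at_top[of 0]
      by eventually_elim (simp add: laurent_eval_def sum_distrib_right power_int_diff power_int_minus divide_inverse mult.assoc)
  qed
  moreover have "((\<lambda>x. laurent_eval p x * x powi (- k)) \<longlongrightarrow> 0) at_top"
  proof -
    from O obtain B where B: "eventually (\<lambda>x. norm (laurent_eval p x) \<le> B * norm (exp (- c * x))) at_top"
      by (elim landau_o.bigE)
    have "c / 2 > 0" using c by simp
    from power_le_exp[OF this, of m] obtain D where D: "D \<ge> 0" "\<And>y. y \<ge> 0 \<Longrightarrow> (1 + y) ^ m \<le> D * exp (c / 2 * y)" by blast
    have "eventually (\<lambda>x. norm (laurent_eval p x * x powi (- k)) \<le> \<bar>B\<bar> * D * exp (- (c / 2) * x)) at_top"
      using B eventually_ge_at_top[of 1]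
    proof eventually_elim
      case (elim x)
      have "x powi (- k) \<le> x powi (int m)" using elim by (intro power_int_increasing) (auto simp: m_def)
      also have "\<dots> \<le> (1 + x) ^ m" using elim by (simp add: power_mono)
      also have "\<dots> \<le> D * exp (c / 2 * x)" using elim by (intro D) auto
      finally have 1: "\<bar>x powi (- k)\<bar> \<le> D * exp (c / 2 * x)" using elim by simp
      have "norm (laurent_eval p x) \<le> \<bar>B\<bar> * exp (- c * x)"
        using elim(1) by (auto intro: order_trans mult_right_mono)
      hence "norm (laurent_eval p x) * \<bar>x powi (- k)\<bar> \<le> (\<bar>B\<bar> * exp (- c * x)) * (D * exp (c / 2 * x))"
        using 1 by (intro mult_mono) auto
      also have "\<dots> = \<bar>B\<bar> * D * (exp (- c * x) * exp (c / 2 * x))" by (simp add: mult_ac)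
      also have "exp (- c * x) * exp (c / 2 * x) = exp (- (c / 2) * x)" by (simp flip: exp_add)
      finally show ?case by (simp add: abs_mult)
    qed
    moreover have "((\<lambda>x. \<bar>B\<bar> * D * exp (- (c / 2) * x)) \<longlongrightarrow> 0) at_top"
    proof -
      have "filterlim (\<lambda>x. (c / 2) * x) at_top at_top"
        using c by (intro filterlim_tendsto_pos_mult_at_top[OF tendsto_const] filterlim_ident) auto
      hence "filterlim (\<lambda>x. - (c / 2) * x) at_bot at_top"
        by (simp add: filterlim_uminus_at_top)
      from filterlim_compose[OF exp_at_bot this] show ?thesis by (intro tendsto_mult_right_zero)
    qed
    ultimately show ?thesis by (rule Lim_null_comparison)
  qed
  ultimately have "Poly_Mapping.lookup p k = 0" by (intro tendsto_unique[OF trivial_limit_at_top_linorder])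
  with k(1) show False by (simp add: in_keys_iff)
qed

section \<open>Laurent polynomials related by the single-valued map\<close>

text \<open>Two functions on the positive axis that are given by a Laurent polynomial over the algebra and by its
image under \<open>sv\<close>. Working with functions makes the closure under products immediate from
\<open>x\<^bsup>k\<^esup> x\<^bsup>k'\<^esup> = x\<^bsup>k + k'\<^esup>\<close>; the rule \<open>cong\<close> discards the value at \<open>0\<close>, where this law fails.\<close>

inductive laurent_pair :: "(real \<Rightarrow> real) \<Rightarrow> (real \<Rightarrow> real) \<Rightarrow> (real \<Rightarrow> real) \<Rightarrow> bool"
  for sv :: "real \<Rightarrow> real" where
  monomial: "sv_maps sv c d \<Longrightarrow> laurent_pair sv (\<lambda>x. c * x powi k) (\<lambda>x. d * x powi k)"
| add: "laurent_pair sv f g \<Longrightarrow> laurent_pair sv f' g' \<Longrightarrow> laurent_pair sv (\<lambda>x. f x + f' x) (\<lambda>x. g x + g' x)"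
| cong: "laurent_pair sv f g \<Longrightarrow> (\<And>x. x > 0 \<Longrightarrow> f x = f' x) \<Longrightarrow> (\<And>x. x > 0 \<Longrightarrow> g x = g' x) \<Longrightarrow> laurent_pair sv f' g'"

context
  fixes sv :: "real \<Rightarrow> real"
  assumes sv: "single_valued_projection sv"
begin

lemma laurent_pair_const: "sv_maps sv c d \<Longrightarrow> laurent_pair sv (\<lambda>_. c) (\<lambda>_. d)"
  using laurent_pair.monomial[of sv c d 0] by simp

lemma laurent_pair_0: "laurent_pair sv (\<lambda>_. 0) (\<lambda>_. 0)"
  by (intro laurent_pair_const sv_maps_0[OF sv])

lemma laurent_pair_mult:
  assumes "laurent_pair sv f g" "laurent_pair sv f' g'"
  shows "laurent_pair sv (\<lambda>x. f x * f' x) (\<lambda>x. g x * g' x)"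
  using assms(1)
proof induction
  case (monomial c d k)
  show ?case using assms(2)
  proof induction
    case (monomial c' d' k')
    have "laurent_pair sv (\<lambda>x. (c * c') * x powi (k + k')) (\<lambda>x. (d * d') * x powi (k + k'))"
      by (intro laurent_pair.monomial sv_maps_mult[OF sv] monomial \<open>sv_maps sv c d\<close>)
    thus ?case by (rule laurent_pair.cong) (simp_all add: power_int_add)
  next
    case (add h i h' i')
    from laurent_pair.add[OF add.IH] show ?case by (simp add: distrib_left)
  next
    case (cong h i h' i')
    show ?case by (rule laurent_pair.cong[OF cong.IH]) (use cong in auto)
  qed
next
  case (add h i h' i')
  from laurent_pair.add[OF add.IH] show ?case by (simp add: distrib_right)
next
  case (cong h i h' i')
  show ?case by (rule laurent_pair.cong[OF cong.IH]) (use cong in auto)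
qed

lemma laurent_pair_power: "laurent_pair sv f g \<Longrightarrow> laurent_pair sv (\<lambda>x. f x ^ n) (\<lambda>x. g x ^ n)"
proof (induction n)
  case 0 show ?case using laurent_pair_const[OF sv_maps_1[OF sv]] by simp
next
  case (Suc n) from laurent_pair_mult[OF Suc.prems Suc.IH[OF Suc.prems]] show ?case by simp
qed

lemma laurent_pair_sum:
  "(\<And>i. i \<in> I \<Longrightarrow> laurent_pair sv (f i) (g i)) \<Longrightarrow> laurent_pair sv (\<lambda>x. \<Sum>i\<in>I. f i x) (\<lambda>x. \<Sum>i\<in>I. g i x)"
  by (induction I rule: infinite_finite_induct) (auto intro: laurent_pair_0 laurent_pair.add)

lemma laurent_pair_rat: "c \<in> \<rat> \<Longrightarrow> laurent_pair sv (\<lambda>_. c) (\<lambda>_. c)"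
  by (intro laurent_pair_const sv_maps_Rats[OF sv])

lemma laurent_pair_id: "laurent_pair sv (\<lambda>x. x) (\<lambda>x. x)"
  using laurent_pair.monomial[OF sv_maps_1[OF sv], of 1] by simp

lemma laurent_pair_inverse: "laurent_pair sv (\<lambda>x. 1 / x) (\<lambda>x. 1 / x)"
  using laurent_pair.monomial[OF sv_maps_1[OF sv], of "-1"] by (simp add: divide_inverse)

lemma laurent_pair_imp_laurent:
  assumes "laurent_pair sv f g"
  shows "\<exists>p. (\<forall>k. Poly_Mapping.lookup p k \<in> mzv_algebra) \<and> (\<forall>x>0. f x = laurent_eval p x) \<and>
     (\<forall>x>0. g x = laurent_eval (Poly_Mapping.map sv p) x)"
  using assms
proof induction
  case (monomial c d k)
  have z: "sv 0 = 0" "0 \<in> mzv_algebra" using sv_maps_0[OF sv] by (auto simp: sv_maps_def[OF sv])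
  have "Poly_Mapping.map sv (Poly_Mapping.single k c) = Poly_Mapping.single k (sv c)"
    by (rule poly_mapping_eqI) (auto simp: Poly_Mapping.map.rep_eq lookup_single when_def z)
  moreover have "sv c = d" "c \<in> mzv_algebra" using monomial by (auto simp: sv_maps_def[OF sv])
  ultimately show ?case
    by (intro exI[of _ "Poly_Mapping.single k c"]) (auto simp: laurent_eval_single lookup_single when_def z)
next
  case (add f g f' g')
  from add.IH obtain p q where
    p: "\<forall>k. Poly_Mapping.lookup p k \<in> mzv_algebra" "\<forall>x>0. f x = laurent_eval p x" "\<forall>x>0. g x = laurent_eval (Poly_Mapping.map sv p) x" and
    q: "\<forall>k. Poly_Mapping.lookup q k \<in> mzv_algebra" "\<forall>x>0. f' x = laurent_eval q x" "\<forall>x>0. g' x = laurent_eval (Poly_Mapping.map sv q) x"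
    by blast
  have z: "sv 0 = 0" using sv_maps_0[OF sv] by (auto simp: sv_maps_def[OF sv])
  have lm: "Poly_Mapping.lookup (Poly_Mapping.map sv r) k = sv (Poly_Mapping.lookup r k)" for r :: "int \<Rightarrow>\<^sub>0 real" and k
    by (auto simp: Poly_Mapping.map.rep_eq when_def z)
  have "Poly_Mapping.map sv (p + q) = Poly_Mapping.map sv p + Poly_Mapping.map sv q"
  proof (rule poly_mapping_eqI)
    fix k
    have "sv_maps sv (Poly_Mapping.lookup p k + Poly_Mapping.lookup q k) (sv (Poly_Mapping.lookup p k) + sv (Poly_Mapping.lookup q k))"
      using p(1) q(1) by (intro sv_maps_add[OF sv]) (auto simp: sv_maps_def[OF sv])
    thus "Poly_Mapping.lookup (Poly_Mapping.map sv (p + q)) k = Poly_Mapping.lookup (Poly_Mapping.map sv p + Poly_Mapping.map sv q) k"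
      by (simp add: lm lookup_add sv_maps_def[OF sv])
  qed
  with p q show ?case
    by (intro exI[of _ "p + q"]) (auto simp: laurent_eval_add lookup_add intro: mzv_algebra.add)
next
  case (cong f g f' g')
  thus ?case by auto
qed

text \<open>The polynomial is the second Bernoulli polynomial.\<close>

definition bernoulli_moment :: "nat \<Rightarrow> real" where
  "bernoulli_moment j = (LINT v:{0<..<1}|lborel. (v\<^sup>2 - v + 1/6) ^ j)"

lemma sv_maps_bernoulli_moment: "sv_maps sv (bernoulli_moment j) (bernoulli_moment j)"
proof -
  define P :: "real poly" where "P = [:1/6, -1, 1:] ^ j"
  have mono: "set_integrable lborel {0<..<1} (\<lambda>v. coeff P i * v ^ i)"
    "(LINT v:{0<..<1}|lborel. coeff P i * v ^ i) = coeff P i * (1 / real (Suc i))" for i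
  proof -
    have s: "set_integrable lborel {0<..<1} (\<lambda>v::real. v ^ i)"
      by (rule set_integrable_subset[of _ "{0..1}"]) (auto intro!: borel_integrable_atLeastAtMost' continuous_intros)
    thus "set_integrable lborel {0<..<1} (\<lambda>v. coeff P i * v ^ i)" by (rule set_integrable_mult_right)
    have "((\<lambda>v::real. v ^ i) has_integral (1 ^ Suc i / real (Suc i) - 0 ^ Suc i / real (Suc i))) {0..1}"
      by (intro fundamental_theorem_of_calculus)
         (auto intro!: derivative_eq_intros simp flip: has_real_derivative_iff_has_vector_derivative simp del: of_nat_Suc power_Suc)
    hence "((\<lambda>v::real. v ^ i) has_integral (1 / real (Suc i))) {0<..<1}"
      by (simp add: has_integral_Icc_iff_Ioo)
    hence "(LINT v:{0<..<1}|lborel. v ^ i :: real) = 1 / real (Suc i)"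
      using set_borel_integral_eq_integral(2)[OF s] by (simp add: integral_unique)
    thus "(LINT v:{0<..<1}|lborel. coeff P i * v ^ i) = coeff P i * (1 / real (Suc i))" by simp
  qed
  have "(v\<^sup>2 - v + 1/6) ^ j = (\<Sum>i\<le>degree P. coeff P i * v ^ i)" for v
  proof -
    have "(v\<^sup>2 - v + 1/6) ^ j = poly P v" by (simp add: P_def power2_eq_square algebra_simps)
    thus ?thesis by (simp add: poly_altdef)
  qed
  hence "bernoulli_moment j = (\<Sum>i\<le>degree P. coeff P i * (1 / real (Suc i)))"
    unfolding bernoulli_moment_def by (simp only: set_integral_sum_fun(2)[OF mono(1)] mono(2))
  moreover have "sv_maps sv (coeff P i) (coeff P i)" for i
  proof -
    have "sv_maps_poly sv ([:1/6, -1, 1:] :: real poly) [:1/6, -1, 1:]"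
      by (rule sv_maps_poly_rat[OF sv]) (auto simp: coeff_pCons split: nat.splits)
    from sv_maps_poly_power[OF sv this, of j] show ?thesis by (simp add: P_def sv_maps_poly_def[OF sv])
  qed
  ultimately show ?thesis
    by (simp only:) (intro sv_maps_sum[OF sv] sv_maps_mult[OF sv] sv_maps_Rats[OF sv, of "1 / real (Suc _)"], auto)
qed

lemma worldline_power_integral:
  "(LINT v:{0<..<1}|lborel. (T * (v\<^sup>2 - v + 1/6) + s) ^ l) =
   (\<Sum>i\<le>l. real (l choose i) * T ^ i * bernoulli_moment i * s ^ (l - i))"
proof -
  have i: "set_integrable lborel {0<..<1} (\<lambda>v::real. real (l choose i) * T ^ i * s ^ (l - i) * (v\<^sup>2 - v + 1/6) ^ i)" for i
    by (rule set_integrable_subset[of _ "{0..1}"]) (auto intro!: borel_integrable_atLeastAtMost' continuous_intros)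
  have "(T * (v\<^sup>2 - v + 1/6) + s) ^ l = (\<Sum>i\<le>l. real (l choose i) * T ^ i * s ^ (l - i) * (v\<^sup>2 - v + 1/6) ^ i)" for v
    unfolding binomial_ring power_mult_distrib by (intro sum.cong refl) (simp only: mult_ac)
  hence "(LINT v:{0<..<1}|lborel. (T * (v\<^sup>2 - v + 1/6) + s) ^ l) =
      (\<Sum>i\<le>l. real (l choose i) * T ^ i * s ^ (l - i) * bernoulli_moment i)"
    by (simp only: set_integral_sum_fun(2)[OF i] set_integral_mult_right bernoulli_moment_def)
  thus ?thesis by (simp only: mult_ac)
qed

text \<open>Both expansions are built in the same way from the rational numbers, the variable, the constant that is \<open>- \<zeta>(2) / x\<close>
on the open side and \<open>0\<close> on the closed side, and the moments.\<close>

lemma expansions_related: "laurent_pair sv (open_expansion l) (closed_expansion l)"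
proof -
  \<comment> \<open>\<open>s x\<close> is \<open>- \<zeta>(2) / x\<close>, and \<open>z x\<close> is its image \<open>0\<close> in the form delivered by \<open>sv_maps_pi_power\<close>\<close>
  define s where "s = (\<lambda>x::real. - (pi ^ (2 * 1)) * (1/6) * (1 / x))"
  define z where "z = (\<lambda>x::real. - (if (1::nat) = 0 then 1 else 0) * (1/6) * (1 / x))"
  have z0: "z x = 0" for x by (simp add: z_def)
  have sz: "laurent_pair sv s z"
  proof -
    have "sv_maps sv ((-1) * pi ^ (2 * 1)) ((-1) * (if (1::nat) = 0 then 1 else 0))"
      by (intro sv_maps_cmult[OF sv] sv_maps_pi_power[OF sv]) auto
    hence "sv_maps sv (- (pi ^ (2 * 1))) (- (if (1::nat) = 0 then 1 else 0))" by simp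
    thus ?thesis unfolding s_def z_def
      by (intro laurent_pair_mult laurent_pair_inverse laurent_pair_rat laurent_pair_const) auto
  qed
  have part1: "laurent_pair sv (\<lambda>x. \<Sum>i\<le>l. real (l choose i) * x ^ i * bernoulli_moment i * s x ^ (l - i))
      (\<lambda>x. \<Sum>i\<le>l. real (l choose i) * x ^ i * bernoulli_moment i * z x ^ (l - i))"
    by (intro laurent_pair_sum laurent_pair_mult laurent_pair_power laurent_pair_rat laurent_pair_id sz
        laurent_pair_const[OF sv_maps_bernoulli_moment]) auto
  have part2: "laurent_pair sv
     (\<lambda>x. 1 / x * (\<Sum>n\<le>l. \<Sum>m\<le>l - n. real (l choose n) * real ((l - n) choose m) * (1/4 * (1 / x)) ^ m *
        (x * (1/6) + s x) ^ (l - n - m) * open_kernel.moment (2 * m) n))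
     (\<lambda>x. 1 / x * (\<Sum>n\<le>l. \<Sum>m\<le>l - n. real (l choose n) * real ((l - n) choose m) * (1/4 * (1 / x)) ^ m *
        (x * (1/6) + z x) ^ (l - n - m) * (2 * 4 ^ m * closed_kernel.moment (2 * m) n)))"
    by (intro laurent_pair_mult laurent_pair_sum laurent_pair_power laurent_pair.add laurent_pair_inverse
        laurent_pair_id sz laurent_pair_const[OF sv_maps_moment[OF sv]] laurent_pair_rat) auto
  show ?thesis
  proof (rule laurent_pair.cong[OF laurent_pair.add[OF part1 part2]])
    fix x :: real assume x: "x > 0"
    have s: "- (pi\<^sup>2 / (6 * x)) = s x" using x by (simp add: s_def power2_eq_square)
    have "open_kernel.worldline (2 * x) (x / 6 - pi\<^sup>2 / (6 * x)) v = x * (v\<^sup>2 - v + 1/6) + s x" for v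
      unfolding open_kernel.worldline_def s[symmetric] using x by (simp add: field_simps)
    hence w: "(LINT v:{0<..<1}|lborel. open_kernel.worldline (2 * x) (x / 6 - pi\<^sup>2 / (6 * x)) v ^ l) =
      (\<Sum>i\<le>l. real (l choose i) * x ^ i * bernoulli_moment i * s x ^ (l - i))"
      by (simp only: worldline_power_integral)
    have "x / 6 - pi\<^sup>2 / (6 * x) = x * (1/6) + s x" unfolding s[symmetric] by simp
    moreover have "1/2 / (2 * x) = 1/4 * (1 / x)" by simp
    moreover have "2 * M / (2 * x) = 1 / x * M" for M by simp
    ultimately show "(\<Sum>i\<le>l. real (l choose i) * x ^ i * bernoulli_moment i * s x ^ (l - i)) +
      1 / x * (\<Sum>n\<le>l. \<Sum>m\<le>l - n. real (l choose n) * real ((l - n) choose m) * (1/4 * (1 / x)) ^ m *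
        (x * (1/6) + s x) ^ (l - n - m) * open_kernel.moment (2 * m) n) = open_expansion l x"
      unfolding open_expansion_def w open_kernel.moment_sum_def by (simp only:)
    have "closed_kernel.worldline x (x / 6) v = x * (v\<^sup>2 - v + 1/6) + z x" for v
      unfolding closed_kernel.worldline_def z0 by (simp add: field_simps)
    hence w': "(LINT v:{0<..<1}|lborel. closed_kernel.worldline x (x / 6) v ^ l) =
      (\<Sum>i\<le>l. real (l choose i) * x ^ i * bernoulli_moment i * z x ^ (l - i))"
      by (simp only: worldline_power_integral)
    have "2 * closed_kernel.moment_sum l x (x / 6) / x =
       1 / x * (\<Sum>n\<le>l. \<Sum>m\<le>l - n. real (l choose n) * real ((l - n) choose m) * (1/4 * (1 / x)) ^ m *
        (x * (1/6) + z x) ^ (l - n - m) * (2 * 4 ^ m * closed_kernel.moment (2 * m) n))"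
      unfolding closed_kernel.moment_sum_def z0 sum_distrib_left sum_divide_distrib
      by (intro sum.cong refl) (simp add: power_mult_distrib power_divide mult_ac)
    thus "(\<Sum>i\<le>l. real (l choose i) * x ^ i * bernoulli_moment i * z x ^ (l - i)) +
      1 / x * (\<Sum>n\<le>l. \<Sum>m\<le>l - n. real (l choose n) * real ((l - n) choose m) * (1/4 * (1 / x)) ^ m *
        (x * (1/6) + z x) ^ (l - n - m) * (2 * 4 ^ m * closed_kernel.moment (2 * m) n)) = closed_expansion l x"
      unfolding closed_expansion_def w' by (simp only:)
  qed
qed

end

text \<open>The expansion is a Laurent polynomial with the required error; two such polynomials differ by an
exponentially small one.\<close>

lemma open_laurent_eqI:
  assumes b: "\<And>x. x > 0 \<Longrightarrow> open_expansion l x = laurent_eval b x"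
  shows "open_laurent l = b"
proof -
  obtain C where C: "\<And>T. T \<ge> 1 \<Longrightarrow> cmod (open_B l (\<i> * of_real (T / pi)) - of_real (open_expansion l T)) \<le> C * exp (- T)"
    by (rule open_asymptotics) blast
  let ?O = "\<lambda>b. (\<lambda>T. cmod (open_B l (\<i> * of_real (T / pi)) - of_real (laurent_eval b T))) \<in> O[at_top](\<lambda>T. exp (- T))"
  have Ob: "?O b"
  proof (rule bigoI[where c = C])
    show "eventually (\<lambda>T. norm (cmod (open_B l (\<i> * of_real (T / pi)) - of_real (laurent_eval b T))) \<le> C * norm (exp (- T))) at_top"
      using eventually_ge_at_top[of 1] by eventually_elim (use C b in auto)
  qed
  show ?thesis unfolding open_laurent_def
  proof (rule the_equality)
    show "?O b" by (rule Ob)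
    fix b' assume Ob': "?O b'"
    have "(\<lambda>T. laurent_eval (b' - b) T) \<in> O[at_top](\<lambda>T. cmod (open_B l (\<i> * of_real (T / pi)) - of_real (laurent_eval b T))
        + cmod (open_B l (\<i> * of_real (T / pi)) - of_real (laurent_eval b' T)))"
    proof (rule bigoI[where c = 1], rule always_eventually, rule allI)
      fix T
      let ?B = "open_B l (\<i> * of_real (T / pi))"
      have "cmod ((?B - of_real (laurent_eval b T)) - (?B - of_real (laurent_eval b' T))) \<le>
          cmod (?B - of_real (laurent_eval b T)) + cmod (?B - of_real (laurent_eval b' T))"
        by (rule norm_triangle_ineq4)
      also have "(?B - of_real (laurent_eval b T)) - (?B - of_real (laurent_eval b' T)) = of_real (laurent_eval (b' - b) T)"
        by (simp add: laurent_eval_diff)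
      finally show "norm (laurent_eval (b' - b) T) \<le> 1 * norm (cmod (?B - of_real (laurent_eval b T)) + cmod (?B - of_real (laurent_eval b' T)))"
        by simp
    qed
    also have "(\<lambda>T. cmod (open_B l (\<i> * of_real (T / pi)) - of_real (laurent_eval b T))
        + cmod (open_B l (\<i> * of_real (T / pi)) - of_real (laurent_eval b' T))) \<in> O[at_top](\<lambda>T. exp (- T))"
      by (rule sum_in_bigo[OF Ob Ob'])
    finally have "(\<lambda>T. laurent_eval (b' - b) T) \<in> O[at_top](\<lambda>T. exp (- 1 * T))" by simp
    from laurent_exponentially_small_eq_0[OF zero_less_one this] show "b' = b" by simp
  qed
qed

text \<open>As in the open case, but uniqueness is tested along the imaginary axis, with the smaller of the two exponential rates.\<close>

lemma closed_laurent_eqI: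
  assumes d: "\<And>x. x > 0 \<Longrightarrow> closed_expansion l x = laurent_eval d x"
  shows "closed_laurent l = d"
proof -
  obtain C where C: "\<And>\<tau>. 2 * pi * Im \<tau> \<ge> 1 \<Longrightarrow>
    \<bar>closed_D l \<tau> - closed_expansion l (2 * pi * Im \<tau>)\<bar> \<le> C * exp (- (5 / 8) * (2 * pi * Im \<tau>))"
    by (rule closed_asymptotics) blast
  let ?O = "\<lambda>c d. (\<lambda>\<tau>. closed_D l \<tau> - laurent_eval d (2 * pi * Im \<tau>))
       \<in> O[filtercomap Im at_top](\<lambda>\<tau>. exp (- c * (2 * pi * Im \<tau>)))"
  have Od: "?O (5/8) d"
  proof (rule bigoI[where c = C])
    have "eventually (\<lambda>y. 2 * pi * y \<ge> 1) at_top"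
      using eventually_ge_at_top[of "1 / (2 * pi)"] by eventually_elim (simp add: field_simps)
    hence "eventually (\<lambda>\<tau>. 2 * pi * Im \<tau> \<ge> 1) (filtercomap Im at_top)" by (rule eventually_filtercomapI)
    thus "eventually (\<lambda>\<tau>. norm (closed_D l \<tau> - laurent_eval d (2 * pi * Im \<tau>)) \<le> C * norm (exp (- (5/8) * (2 * pi * Im \<tau>)))) (filtercomap Im at_top)"
    proof eventually_elim
      case (elim \<tau>)
      hence pos: "2 * pi * Im \<tau> > 0" by linarith
      from C[OF elim] show ?case unfolding d[OF pos] by simp
    qed
  qed
  have fl: "filterlim (\<lambda>x. \<i> * of_real (x / (2 * pi))) (filtercomap Im at_top) at_top"
  proof -
    have "filterlim (\<lambda>x. 1 / (2 * pi) * x) at_top at_top"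
      by (intro filterlim_tendsto_pos_mult_at_top[OF tendsto_const] filterlim_ident) auto
    thus ?thesis by (simp add: filterlim_filtercomap_iff o_def)
  qed
  show ?thesis unfolding closed_laurent_def
  proof (rule the_equality)
    show "\<exists>c>0. ?O c d" using Od by (intro exI[of _ "5/8"]) auto
    fix d' assume "\<exists>c>0. ?O c d'"
    then obtain c where c: "c > 0" "?O c d'" by blast
    define c' where "c' = min c (5/8)"
    have c': "c' > 0" "c' \<le> c" "c' \<le> 5/8" using c(1) by (auto simp: c'_def)
    have weaken: "(\<lambda>x. closed_D l (\<i> * of_real (x / (2 * pi))) - laurent_eval e x) \<in> O[at_top](\<lambda>x. exp (- c' * x))"
      if "?O a e" "c' \<le> a" for a e
    proof -
      have "(\<lambda>x. closed_D l (\<i> * of_real (x / (2 * pi))) - laurent_eval e x) \<in> O[at_top](\<lambda>x. exp (- a * x))"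
        using landau_o.big.compose[OF that(1) fl] by simp
      also have "(\<lambda>x. exp (- a * x)) \<in> O[at_top](\<lambda>x. exp (- c' * x))"
      proof (rule bigoI[where c = 1])
        show "eventually (\<lambda>x. norm (exp (- a * x)) \<le> 1 * norm (exp (- c' * x))) at_top"
          using eventually_ge_at_top[of 0] by eventually_elim (use that(2) in \<open>auto intro: mult_right_mono\<close>)
      qed
      finally show ?thesis .
    qed
    have "(\<lambda>x. (closed_D l (\<i> * of_real (x / (2 * pi))) - laurent_eval d x) - (closed_D l (\<i> * of_real (x / (2 * pi))) - laurent_eval d' x))
        \<in> O[at_top](\<lambda>x. exp (- c' * x))"
      by (rule sum_in_bigo(2)[OF weaken[OF Od c'(3)] weaken[OF c(2) c'(2)]])
    hence "(\<lambda>x. laurent_eval (d' - d) x) \<in> O[at_top](\<lambda>x. exp (- c' * x))"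
      by (simp add: laurent_eval_diff)
    from laurent_exponentially_small_eq_0[OF c'(1) this] show "d' = d" by simp
  qed
qed

theorem theoremB:
  fixes sv :: "real \<Rightarrow> real" and l :: nat
  assumes "single_valued_projection sv"
  shows "Poly_Mapping.map sv (open_laurent l) = closed_laurent l"
proof -
  from laurent_pair_imp_laurent[OF assms expansions_related[OF assms, of l]]
  obtain b where b: "\<And>x. x > 0 \<Longrightarrow> open_expansion l x = laurent_eval b x"
    "\<And>x. x > 0 \<Longrightarrow> closed_expansion l x = laurent_eval (Poly_Mapping.map sv b) x" by blast
  have "open_laurent l = b" by (rule open_laurent_eqI[OF b(1)])
  moreover have "closed_laurent l = Poly_Mapping.map sv b" by (rule closed_laurent_eqI[OF b(2)])
  ultimately show ?thesis by simp
qed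

end
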